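(* Let $d\ge1$. Suppose that $\mathcal T$ is a metric space, and that for every $t\in\mathcal T$ there is a unital C*-algebra $\mathcal A_t$ and a $d$-tuple $\xi_t=(\xi_{t,1},\ldots,\xi_{t,d})\in\mathcal A_t^d$ generating $\mathcal A_t$ as a unital C*-algebra. Assume that all the $\xi_{t,i}$ (for all $t\in\mathcal T$ and $i=1,\ldots,d$) are unitary. Let $t_0\in\mathcal T$. If $$\lim_{t\to t_0}\|p(\xi_t)\|=\|p(\xi_{t_0})\|\quad\text{for all } n\in\mathbb N\text{ and all } p\in M_n(\mathbb C_1\langle z,z^*\rangle),$$ then $$\lim_{t\to t_0}\|p(\xi_t)\|=\|p(\xi_{t_0})\|\quad\text{for all } p\in\mathbb C\langle z,z^*\rangle,$$ and therefore also $\lim_{t\to t_0}\|p(\xi_t)\|=\|p(\xi_{t_0})\|$ for all $n\in\mathbb N$ and all $p\in M_n(\mathbb C\langle z,z^*\rangle)$.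
   Context: $M_n=M_n(\mathbb C)$. $\mathbb C\langle z,z^*\rangle$ is the $*$-algebra of $*$-polynomials in noncommuting variables $z_1,\ldots,z_d,z_1^*,\ldots,z_d^*$; $\mathbb C_1\langle z,z^*\rangle$ is the subspace of $*$-polynomials of degree at most $1$. $M_n(\mathbb C\langle z,z^*\rangle)$ is the space of $*$-polynomials with $n\times n$ matrix coefficients, and $M_n(\mathbb C_1\langle z,z^*\rangle)$ is its subspace of polynomials of degree at most $1$. For $p\in M_n(\mathbb C\langle z,z^*\rangle)$ and $\xi_t\in\mathcal A_t^d$, $p(\xi_t)\in M_n\otimes\mathcal A_t$, with the C*-norm. *)

theory Defs
  imports
    Complex_Main
    "HOL-Library.Poly_Mapping"
    "HOL-Algebra.Module"
    "Jordan_Normal_Form.Matrix"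
begin

section \<open>Unital C*-algebras\<close>

text \<open>The algebras of a family indexed by a metric space must be allowed to vary with the index,
  so C*-algebras are structures with an explicit carrier, extending the records of HOL-Algebra.\<close>

record 'a star_algebra = "(complex, 'a) module" +
  adj :: "'a \<Rightarrow> 'a"

record 'a normed_star_algebra = "'a star_algebra" +
  nrm :: "'a \<Rightarrow> real"

locale unital_star_algebra = ring A for A :: "('a, 'b) star_algebra_scheme" (structure) +
  assumes smult_closed: "x \<in> carrier A \<Longrightarrow> c \<odot> x \<in> carrier A"
    and smult_l_distr: "x \<in> carrier A \<Longrightarrow> (b + c) \<odot> x = b \<odot> x \<oplus> c \<odot> x"
    and smult_r_distr:
      "\<lbrakk>x \<in> carrier A; y \<in> carrier A\<rbrakk> \<Longrightarrow> c \<odot> (x \<oplus> y) = c \<odot> x \<oplus> c \<odot> y"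
    and smult_assoc: "x \<in> carrier A \<Longrightarrow> (b * c) \<odot> x = b \<odot> (c \<odot> x)"
    and smult_1: "x \<in> carrier A \<Longrightarrow> 1 \<odot> x = x"
    and smult_mult_left:
      "\<lbrakk>x \<in> carrier A; y \<in> carrier A\<rbrakk> \<Longrightarrow> (c \<odot> x) \<otimes> y = c \<odot> (x \<otimes> y)"
    and smult_mult_right:
      "\<lbrakk>x \<in> carrier A; y \<in> carrier A\<rbrakk> \<Longrightarrow> x \<otimes> (c \<odot> y) = c \<odot> (x \<otimes> y)"
    and adj_closed: "x \<in> carrier A \<Longrightarrow> adj A x \<in> carrier A"
    and adj_add:
      "\<lbrakk>x \<in> carrier A; y \<in> carrier A\<rbrakk> \<Longrightarrow> adj A (x \<oplus> y) = adj A x \<oplus> adj A y"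
    and adj_smult: "x \<in> carrier A \<Longrightarrow> adj A (c \<odot> x) = cnj c \<odot> adj A x"
    and adj_mult:
      "\<lbrakk>x \<in> carrier A; y \<in> carrier A\<rbrakk> \<Longrightarrow> adj A (x \<otimes> y) = adj A y \<otimes> adj A x"
    and adj_adj: "x \<in> carrier A \<Longrightarrow> adj A (adj A x) = x"

definition norm_converges ::
    "('a, 'b) star_algebra_scheme \<Rightarrow> ('a \<Rightarrow> real) \<Rightarrow> (nat \<Rightarrow> 'a) \<Rightarrow> 'a \<Rightarrow> bool" where
  "norm_converges A N s x \<longleftrightarrow> (\<lambda>k. N (s k \<ominus>\<^bsub>A\<^esub> x)) \<longlonglongrightarrow> 0"

definition norm_Cauchy ::
    "('a, 'b) star_algebra_scheme \<Rightarrow> ('a \<Rightarrow> real) \<Rightarrow> (nat \<Rightarrow> 'a) \<Rightarrow> bool" where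
  "norm_Cauchy A N s \<longleftrightarrow>
     (\<forall>e>0. \<exists>K. \<forall>j\<ge>K. \<forall>k\<ge>K. N (s j \<ominus>\<^bsub>A\<^esub> s k) < e)"

locale cstar_norm = unital_star_algebra A
  for A :: "('a, 'b) star_algebra_scheme" (structure) and N :: "'a \<Rightarrow> real" +
  assumes norm_nonneg: "x \<in> carrier A \<Longrightarrow> 0 \<le> N x"
    and norm_eq_0_iff: "x \<in> carrier A \<Longrightarrow> N x = 0 \<longleftrightarrow> x = \<zero>"
    and norm_triangle: "\<lbrakk>x \<in> carrier A; y \<in> carrier A\<rbrakk> \<Longrightarrow> N (x \<oplus> y) \<le> N x + N y"
    and norm_smult: "x \<in> carrier A \<Longrightarrow> N (c \<odot> x) = cmod c * N x"
    and norm_mult: "\<lbrakk>x \<in> carrier A; y \<in> carrier A\<rbrakk> \<Longrightarrow> N (x \<otimes> y) \<le> N x * N y"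
    and norm_cstar: "x \<in> carrier A \<Longrightarrow> N (adj A x \<otimes> x) = (N x)\<^sup>2"
    and complete:
      "\<lbrakk>\<And>k. s k \<in> carrier A; norm_Cauchy A N s\<rbrakk> \<Longrightarrow> \<exists>x\<in>carrier A. norm_converges A N s x"

locale unital_cstar_algebra = cstar_norm A "nrm A"
  for A :: "('a, 'b) normed_star_algebra_scheme" (structure)

definition unital_cstar_subalgebra ::
    "('a, 'b) normed_star_algebra_scheme \<Rightarrow> 'a set \<Rightarrow> bool" where
  "unital_cstar_subalgebra A B \<longleftrightarrow>
     B \<subseteq> carrier A \<and> \<one>\<^bsub>A\<^esub> \<in> B \<and>
     (\<forall>x\<in>B. \<forall>y\<in>B. x \<oplus>\<^bsub>A\<^esub> y \<in> B) \<and>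
     (\<forall>c. \<forall>x\<in>B. c \<odot>\<^bsub>A\<^esub> x \<in> B) \<and>
     (\<forall>x\<in>B. \<forall>y\<in>B. x \<otimes>\<^bsub>A\<^esub> y \<in> B) \<and>
     (\<forall>x\<in>B. adj A x \<in> B) \<and>
     (\<forall>s x. (\<forall>k. s k \<in> B) \<and> x \<in> carrier A \<and> norm_converges A (nrm A) s x \<longrightarrow> x \<in> B)"

definition generates_unital_cstar ::
    "('a, 'b) normed_star_algebra_scheme \<Rightarrow> 'a set \<Rightarrow> bool" where
  "generates_unital_cstar A S \<longleftrightarrow>
     S \<subseteq> carrier A \<and> (\<forall>B. unital_cstar_subalgebra A B \<and> S \<subseteq> B \<longrightarrow> B = carrier A)"

definition is_unitary :: "('a, 'b) star_algebra_scheme \<Rightarrow> 'a \<Rightarrow> bool" where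
  "is_unitary A u \<longleftrightarrow>
     u \<in> carrier A \<and> adj A u \<otimes>\<^bsub>A\<^esub> u = \<one>\<^bsub>A\<^esub> \<and> u \<otimes>\<^bsub>A\<^esub> adj A u = \<one>\<^bsub>A\<^esub>"

section \<open>Matrix amplifications\<close>

text \<open>\<open>M\<^sub>n \<otimes> A\<close> is the *-algebra of n by n matrices with entries in A.\<close>

definition matrix_algebra :: "nat \<Rightarrow> ('a, 'b) star_algebra_scheme \<Rightarrow> 'a mat star_algebra" where
  "matrix_algebra n A =
    \<lparr>carrier = {X \<in> carrier_mat n n. \<forall>i<n. \<forall>j<n. X $$ (i, j) \<in> carrier A},
     mult = (\<lambda>X Y. mat n n (\<lambda>(i, j). \<Oplus>\<^bsub>A\<^esub>k\<in>{..<n}. X $$ (i, k) \<otimes>\<^bsub>A\<^esub> Y $$ (k, j))),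
     one = mat n n (\<lambda>(i, j). if i = j then \<one>\<^bsub>A\<^esub> else \<zero>\<^bsub>A\<^esub>),
     zero = mat n n (\<lambda>(i, j). \<zero>\<^bsub>A\<^esub>),
     add = (\<lambda>X Y. mat n n (\<lambda>(i, j). X $$ (i, j) \<oplus>\<^bsub>A\<^esub> Y $$ (i, j))),
     smult = (\<lambda>c X. mat n n (\<lambda>(i, j). c \<odot>\<^bsub>A\<^esub> X $$ (i, j))),
     adj = (\<lambda>X. mat n n (\<lambda>(i, j). adj A (X $$ (j, i))))\<rparr>"

text \<open>The C*-norm of \<open>M\<^sub>n \<otimes> A\<close> is characterised as the only norm that makes this *-algebra a
  C*-algebra. Only the values on the carrier are unique, so the description is of the value
  \<open>N X\<close> and not of the function \<open>N\<close>.\<close>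

definition matrix_cstar_norm :: "nat \<Rightarrow> ('a, 'b) star_algebra_scheme \<Rightarrow> 'a mat \<Rightarrow> real" where
  "matrix_cstar_norm n A X = (THE r. \<exists>N. cstar_norm (matrix_algebra n A) N \<and> r = N X)"

section \<open>Noncommutative *-polynomials\<close>

text \<open>\<open>Z i\<close> and \<open>Zstar i\<close> are the formal variables \<open>z\<^sub>i\<close> and \<open>z\<^sub>i\<^sup>*\<close>, indexed by \<open>i < d\<close>. A
  *-polynomial is a finitely supported family of complex coefficients indexed by words.\<close>

datatype letter = Z nat | Zstar nat

primrec letter_index :: "letter \<Rightarrow> nat" where
  "letter_index (Z i) = i"
| "letter_index (Zstar i) = i"

type_synonym star_poly = "letter list \<Rightarrow>\<^sub>0 complex"

definition star_polys :: "nat \<Rightarrow> star_poly set" where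
  "star_polys d = {p. \<forall>w\<in>Poly_Mapping.keys p. \<forall>l\<in>set w. letter_index l < d}"

definition star_polys_1 :: "nat \<Rightarrow> star_poly set" where
  "star_polys_1 d = {p \<in> star_polys d. \<forall>w\<in>Poly_Mapping.keys p. length w \<le> 1}"

definition matrices_over :: "nat \<Rightarrow> 'c set \<Rightarrow> 'c mat set" where
  "matrices_over n S = {P \<in> carrier_mat n n. \<forall>i<n. \<forall>j<n. P $$ (i, j) \<in> S}"

primrec eval_letter :: "('a, 'b) star_algebra_scheme \<Rightarrow> (nat \<Rightarrow> 'a) \<Rightarrow> letter \<Rightarrow> 'a" where
  "eval_letter A \<xi> (Z i) = \<xi> i"
| "eval_letter A \<xi> (Zstar i) = adj A (\<xi> i)"

definition eval_word :: "('a, 'b) star_algebra_scheme \<Rightarrow> (nat \<Rightarrow> 'a) \<Rightarrow> letter list \<Rightarrow> 'a" where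
  "eval_word A \<xi> w = foldr (\<lambda>l x. eval_letter A \<xi> l \<otimes>\<^bsub>A\<^esub> x) w \<one>\<^bsub>A\<^esub>"

definition eval_poly :: "('a, 'b) star_algebra_scheme \<Rightarrow> (nat \<Rightarrow> 'a) \<Rightarrow> star_poly \<Rightarrow> 'a" where
  "eval_poly A \<xi> p = (\<Oplus>\<^bsub>A\<^esub>w\<in>Poly_Mapping.keys p. Poly_Mapping.lookup p w \<odot>\<^bsub>A\<^esub> eval_word A \<xi> w)"

text \<open>A polynomial \<open>\<Sum>\<^sub>w a\<^sub>w w\<close> with matrix coefficients \<open>a\<^sub>w\<close> is encoded as the matrix of its scalar
  polynomial entries; its value \<open>\<Sum>\<^sub>w a\<^sub>w \<otimes> \<xi>\<^sup>w\<close> is then computed entrywise.\<close>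

definition eval_matrix_poly ::
    "nat \<Rightarrow> ('a, 'b) star_algebra_scheme \<Rightarrow> (nat \<Rightarrow> 'a) \<Rightarrow> star_poly mat \<Rightarrow> 'a mat" where
  "eval_matrix_poly n A \<xi> P = mat n n (\<lambda>(i, j). eval_poly A \<xi> (P $$ (i, j)))"

end

theory Submission
  imports Defs "HOL-Computational_Algebra.Formal_Power_Series"
begin

text \<open>
The norm of a matrix \<open>q = \<Sum>\<^sub>w a\<^sub>w \<otimes> \<xi>\<^sup>w\<close> is a matter of positivity: \<open>\<parallel>q\<parallel> \<le> b\<close> if and only if
the quadratic form \<open>b\<^sup>2|x|\<^sup>2 - |q x|\<^sup>2\<close> is positive. To make this form linear in the generators,
introduce an independent vector \<open>x\<^sub>w\<close> for every word up to the degree of \<open>q\<close>, with the empty word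
standing for \<open>x\<close>, and consider
\<open>L(x) = b\<^sup>2|x\<^sub>[]|\<^sup>2 - |\<Sum>\<^sub>w a\<^sub>w x\<^sub>w|\<^sup>2 + K \<Sum> |x\<^sub>l\<^sub>w - \<xi>\<^sub>l x\<^sub>w|\<^sup>2\<close>.
As \<open>\<xi>\<^sub>l\<close> is unitary, \<open>|x\<^sub>l\<^sub>w - \<xi>\<^sub>l x\<^sub>w|\<^sup>2 = |x\<^sub>l\<^sub>w|\<^sup>2 + |x\<^sub>w|\<^sup>2 - 2 Re \<langle>x\<^sub>l\<^sub>w, \<xi>\<^sub>l x\<^sub>w\<rangle>\<close>, so \<open>L\<close> is a
matrix polynomial of degree one. If \<open>\<parallel>q\<parallel> < b\<close> and \<open>K\<close> is large, the penalty forces \<open>x\<^sub>w\<close> to be close to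
\<open>\<xi>\<^sup>w x\<^sub>[]\<close> and \<open>L\<close> is positive; the required \<open>K\<close> depends on the coefficients and not on the algebra.
Conversely the substitution \<open>x\<^sub>w = \<xi>\<^sup>w x\<close> removes the penalty and gives back \<open>b\<^sup>2|x|\<^sup>2 - |q x|\<^sup>2\<close>. Since
\<open>L \<le> c\<close> for a constant \<open>c\<close>, again independent of the algebra, positivity of \<open>L\<close> says that
\<open>\<parallel>c - L\<parallel> \<le> c\<close>, and this norm is one of those that converge by assumption. A small excess of
\<open>\<parallel>c - L\<parallel>\<close> over \<open>c\<close> costs a proportionally small excess of \<open>\<parallel>q\<parallel>\<^sup>2\<close> over \<open>b\<^sup>2\<close>, which gives upper and
lower semicontinuity of the norm of \<open>q\<close> at once (\<open>linearization\<close>, \<open>mnorm_tendsto_of_linear\<close>).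

Positivity is understood as being a sum of squares of rows (\<open>gram\<close>), so that these manipulations are
algebraic identities. The link with norms is that \<open>\<parallel>x\<parallel>\<^sup>2 < r\<close> yields an \<open>s\<close> with
\<open>x\<^sup>*x + s\<^sup>*s = r\<close>, while such an identity implies \<open>\<parallel>x\<parallel>\<^sup>2 \<le> r\<close>. The first statement is a binomial series;
the second is the theorem that \<open>x\<^sup>*x\<close> is positive (\<open>pos_star_mult_self\<close>), proved here by comparing
growth of powers. The same two facts show that a C*-norm on a *-algebra is unique and that
matrices over a C*-algebra carry one (\<open>mnorm\<close>), which identifies the norm in the theorem.

To have series and ring arithmetic available, all C*-algebras whose elements lie in a
given type are embedded as corners into one C*-algebra that is a type, their bounded product.
\<close>

section \<open>C*-algebras as a type class\<close>

text \<open>The complex structure is given by a central square root \<open>imag\<close> of \<open>-1\<close>, which keeps the real normed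
algebra classes usable; complex scalars are the elements \<open>cplx c\<close> defined below. The class contains
the zero algebra: the product constructed later is one if the type has no C*-algebra other than
the trivial one.\<close>

class cstar_algebra = banach + real_normed_algebra + monoid_mult +
  fixes star :: "'a \<Rightarrow> 'a" and imag :: 'a
  assumes star_add: "star (x + y) = star x + star y"
    and star_scaleR: "star (r *\<^sub>R x) = r *\<^sub>R star x"
    and star_mult: "star (x * y) = star y * star x"
    and star_star [simp]: "star (star x) = x"
    and norm_star_mult_self: "norm (star x * x) = (norm x)\<^sup>2"
    and imag_commute: "imag * x = x * imag"
    and imag_square: "imag * imag = - 1"
    and star_imag: "star imag = - imag"

lemma star_zero [simp]: "star 0 = (0::'a::cstar_algebra)"
  using star_add[of 0 0] by simp

lemma star_minus [simp]: "star (- x) = - star x"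
  using star_add[of x "- x"] by (simp add: eq_neg_iff_add_eq_0 add.commute)

lemma star_diff: "star (x - y) = star x - star y"
  using star_add[of x "- y"] by simp

lemma star_one [simp]: "star 1 = (1::'a::cstar_algebra)"
  using star_mult[of "star 1" "1::'a"] by simp

lemma star_sum: "star (sum f I) = (\<Sum>i\<in>I. star (f i))"
  by (induction I rule: infinite_finite_induct) (auto simp: star_add)

lemma star_power: "star (x ^ k) = star x ^ k"
  by (induction k) (simp_all add: star_mult power_commutes)

lemma norm_star [simp]: "norm (star x) = norm x"
proof -
  have le: "norm y \<le> norm (star y)" for y :: 'a
  proof (cases "norm y = 0")
    case False
    have "(norm y)\<^sup>2 \<le> norm (star y) * norm y"
      using norm_mult_ineq[of "star y" y] norm_star_mult_self[of y] by simp
    with False show ?thesis by (simp add: power2_eq_square)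
  qed simp
  from le[of x] le[of "star x"] show ?thesis by simp
qed

lemma norm_one_le: "norm (1::'a::cstar_algebra) \<le> 1"
proof -
  have "norm (1::'a) = (norm (1::'a))\<^sup>2"
    using norm_star_mult_self[of 1] by simp
  then have "norm (1::'a) = 0 \<or> norm (1::'a) = 1"
    by (simp add: power2_eq_square)
  then show ?thesis by auto
qed

lemma norm_power_le: "norm (x ^ k) \<le> norm (x::'a::cstar_algebra) ^ k"
proof (induction k)
  case 0 show ?case using norm_one_le by simp
next
  case (Suc k)
  have "norm (x ^ Suc k) \<le> norm x * norm (x ^ k)" by (simp add: norm_mult_ineq)
  also have "\<dots> \<le> norm x * norm x ^ k" by (intro mult_left_mono Suc) auto
  finally show ?case by simp
qed

lemma bounded_linear_star: "bounded_linear (star :: 'a \<Rightarrow> 'a::cstar_algebra)"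
  by (rule bounded_linear_intro[where K = 1]) (auto simp: star_add star_scaleR)

lemma norm_sa_power2: "star h = h \<Longrightarrow> norm (h ^ (2 ^ j)) = (norm h :: real) ^ (2 ^ j)"
proof (induction j)
  case (Suc j)
  have "norm (h ^ (2 ^ Suc j)) = norm (star (h ^ (2 ^ j)) * h ^ (2 ^ j))"
    using Suc.prems by (simp add: star_power power_add[symmetric] mult_2)
  also have "\<dots> = (norm h ^ 2 ^ j)\<^sup>2" using Suc by (simp only: norm_star_mult_self)
  also have "\<dots> = norm h ^ (2 ^ Suc j)" by (simp add: power_mult[symmetric] power2_eq_square power_add[symmetric] mult_2)
  finally show ?case .
qed simp

text \<open>These are the coefficients of \<open>(1 - w)\<^sup>-\<^sup>1\<^sup>/\<^sup>2\<close>, whose square is the geometric series.\<close>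

lemma binomial_half_convolution:
  "(\<Sum>i\<le>k. ((-1) ^ i * (((-1/2) :: real) gchoose i)) * ((-1) ^ (k - i) * ((-1/2) gchoose (k - i)))) = 1"
proof -
  have "(\<Sum>i\<le>k. ((-1) ^ i * (((-1/2) :: real) gchoose i)) * ((-1) ^ (k - i) * ((-1/2) gchoose (k - i))))
      = (-1) ^ k * (\<Sum>i\<le>k. ((-1/2) gchoose i) * ((-1/2) gchoose (k - i)))"
    unfolding sum_distrib_left
  proof (rule sum.cong, goal_cases)
    case (2 i)
    then have "(-1) ^ k = (-1::real) ^ i * (-1) ^ (k - i)" by (simp add: power_add[symmetric])
    then show ?case by (simp only: mult_ac)
  qed simp
  also have "(\<Sum>i\<le>k. (((-1/2) :: real) gchoose i) * ((-1/2) gchoose (k - i))) = (-1) gchoose k"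
    using gbinomial_Vandermonde[of "-1/2 :: real" "-1/2" k] by (simp add: atMost_atLeast0)
  also have "(-1 :: real) gchoose k = (-1) ^ k"
    using gbinomial_minus[of "1::real" k] by (simp add: binomial_gbinomial[symmetric])
  finally show ?thesis by (simp add: power_mult_distrib[symmetric])
qed

lemma binomial_half_abs_le: "\<bar>(-1) ^ k * (((-1/2) :: real) gchoose k)\<bar> \<le> 1"
proof (induction k)
  case (Suc k)
  have "real (Suc k) * ((-1/2 :: real) gchoose Suc k) = (- 1/2 - real k) * ((-1/2) gchoose k)"
    using gbinomial_absorption[of k "-1/2::real"] gbinomial_absorb_comp[of "-1/2::real" k] by simp
  then have "real (Suc k) * \<bar>(-1/2 :: real) gchoose Suc k\<bar> = \<bar>- 1/2 - real k\<bar> * \<bar>(-1/2) gchoose k\<bar>"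
    by (metis abs_mult abs_of_nat)
  also have "\<dots> \<le> real (Suc k) * 1"
    using Suc by (intro mult_mono) (auto simp: abs_mult)
  finally show ?case by (simp add: abs_mult)
qed simp

lemma scaleR_one_mult [simp]: "(r *\<^sub>R 1) * x = r *\<^sub>R (x::'a::cstar_algebra)" "x * (r *\<^sub>R 1) = r *\<^sub>R x"
  by simp_all

text \<open>The binomial series for \<open>(1 - w)\<^sup>-\<^sup>1\<^sup>/\<^sup>2\<close> converges absolutely. As a limit of polynomials in \<open>w\<close> its sum
commutes with everything that commutes with \<open>w\<close>. It serves for inverses and for square roots, since
\<open>b (1 - w)\<close> is a square root of \<open>1 - w\<close>.\<close>

lemma inverse_sqrt:
  fixes w :: "'a::cstar_algebra"
  assumes w: "norm w < 1"
  obtains b where "b * b * (1 - w) = 1"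
    and "\<And>y. y * w = w * y \<Longrightarrow> y * b = b * y"
    and "star w = w \<Longrightarrow> star b = b"
proof -
  define c :: "nat \<Rightarrow> real" where "c k = (-1) ^ k * ((-1/2) gchoose k)" for k
  have abs_c: "\<bar>c k\<bar> \<le> 1" for k
    unfolding c_def by (rule binomial_half_abs_le)
  have norm_le: "norm (c k *\<^sub>R w ^ k) \<le> norm w ^ k" for k
    using mult_mono[OF abs_c[of k] norm_power_le[of w k]] by simp
  have geom: "summable (\<lambda>k. norm w ^ k)"
    using w by (simp add: summable_geometric)
  have sn: "summable (\<lambda>k. norm (c k *\<^sub>R w ^ k))"
    by (rule summable_comparison_test'[OF geom, of 0]) (use norm_le in auto)
  have s: "summable (\<lambda>k. c k *\<^sub>R w ^ k)"
    by (rule summable_norm_cancel[OF sn])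
  define b where "b = suminf (\<lambda>k. c k *\<^sub>R w ^ k)"
  have "(\<lambda>k. \<Sum>i\<le>k. (c i *\<^sub>R w ^ i) * (c (k - i) *\<^sub>R w ^ (k - i))) sums (b * b)"
    unfolding b_def by (rule Cauchy_product_sums[OF sn sn])
  also have "(\<lambda>k. \<Sum>i\<le>k. (c i *\<^sub>R w ^ i) * (c (k - i) *\<^sub>R w ^ (k - i))) = (\<lambda>k. w ^ k)"
  proof
    fix k
    have "(\<Sum>i\<le>k. (c i *\<^sub>R w ^ i) * (c (k - i) *\<^sub>R w ^ (k - i))) = (\<Sum>i\<le>k. c i * c (k - i)) *\<^sub>R w ^ k"
      unfolding scaleR_left.sum
      by (rule sum.cong) (auto simp: power_add[symmetric] mult.commute)
    also have "\<dots> = w ^ k"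
      using binomial_half_convolution[of k] by (simp add: c_def)
    finally show "(\<Sum>i\<le>k. (c i *\<^sub>R w ^ i) * (c (k - i) *\<^sub>R w ^ (k - i))) = w ^ k" .
  qed
  finally have bb: "(\<lambda>k. w ^ k) sums (b * b)" .
  then have 1: "(\<lambda>k. w ^ k - w ^ Suc k) sums (b * b * (1 - w))"
    using sums_mult2[OF bb, of "1 - w"] by (simp add: right_diff_distrib power_commutes)
  have "(\<lambda>k. w ^ k) \<longlonglongrightarrow> 0"
    by (rule summable_LIMSEQ_zero[OF sums_summable[OF bb]])
  then have "(\<lambda>k. w ^ k - w ^ Suc k) sums (w ^ 0 - 0)"
    by (rule telescope_sums')
  then have b1: "b * b * (1 - w) = 1"
    using sums_unique2[OF 1] by simp
  have comm: "y * b = b * y" if "y * w = w * y" for y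
  proof -
    have yk: "y * w ^ k = w ^ k * y" for k
      by (induction k) (simp, metis mult.assoc power_Suc that)
    have "y * b = suminf (\<lambda>k. y * (c k *\<^sub>R w ^ k))"
      unfolding b_def by (rule suminf_mult[OF s, symmetric])
    also have "\<dots> = suminf (\<lambda>k. (c k *\<^sub>R w ^ k) * y)" by (simp add: yk)
    also have "\<dots> = b * y" unfolding b_def by (rule suminf_mult2[OF s, symmetric])
    finally show ?thesis .
  qed
  have sb: "star b = b" if "star w = w"
  proof -
    have "star b = suminf (\<lambda>k. star (c k *\<^sub>R w ^ k))"
      unfolding b_def by (rule bounded_linear.suminf[OF bounded_linear_star s])
    also have "\<dots> = b" by (simp add: b_def star_scaleR star_power that)
    finally show ?thesis .
  qed
  show ?thesis using that[OF b1 comm sb] .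
qed

section \<open>Positive elements\<close>

text \<open>The condition says that the spectrum of \<open>h\<close> lies in \<open>[0, 2c]\<close>. Stated with the norm it needs no
spectral theory and makes sums of positive elements positive by the triangle inequality.\<close>

definition pos :: "'a::cstar_algebra \<Rightarrow> bool" where
  "pos h \<longleftrightarrow> star h = h \<and> (\<exists>c\<ge>0. norm (c *\<^sub>R 1 - h) \<le> c)"

lemma pos_sa: "pos h \<Longrightarrow> star h = h" by (simp add: pos_def)

lemma pos_add: assumes "pos h" "pos k" shows "pos (h + k)"
proof -
  obtain c d where cd: "c \<ge> 0" "norm (c *\<^sub>R 1 - h) \<le> c" "d \<ge> 0" "norm (d *\<^sub>R 1 - k) \<le> d"
    using assms by (auto simp: pos_def)
  have "norm ((c + d) *\<^sub>R 1 - (h + k)) = norm ((c *\<^sub>R 1 - h) + (d *\<^sub>R 1 - k))"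
    by (simp add: algebra_simps)
  also have "\<dots> \<le> c + d" using norm_triangle_mono cd by blast
  finally show ?thesis using assms cd unfolding pos_def
    by (auto simp: star_add intro!: exI[of _ "c + d"])
qed

lemma pos_scaleR: assumes "pos h" "r \<ge> 0" shows "pos (r *\<^sub>R h)"
proof -
  obtain c where cd: "c \<ge> 0" "norm (c *\<^sub>R 1 - h) \<le> c"
    using assms by (auto simp: pos_def)
  have "norm ((r * c) *\<^sub>R 1 - r *\<^sub>R h) = r * norm (c *\<^sub>R 1 - h)"
    using assms norm_scaleR[of r "c *\<^sub>R 1 - h"] by (simp add: scaleR_right_diff_distrib)
  also have "\<dots> \<le> r * c" using cd assms by (simp add: mult_left_mono)
  finally show ?thesis using assms cd unfolding pos_def
    by (auto simp: star_scaleR intro!: exI[of _ "r * c"])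
qed

lemma pos_of_norm_le:
  assumes "star k = k" "norm k \<le> r" shows "pos (r *\<^sub>R 1 - k)" "pos (r *\<^sub>R 1 + k)"
proof -
  have "r \<ge> 0" using assms norm_ge_zero order_trans by blast
  then show "pos (r *\<^sub>R 1 - k)" "pos (r *\<^sub>R 1 + k)" using assms unfolding pos_def
    by (auto simp: star_diff star_add star_scaleR intro!: exI[of _ r])
qed

lemma pos_const: "r \<ge> 0 \<Longrightarrow> pos (r *\<^sub>R (1::'a::cstar_algebra))"
  using pos_of_norm_le[of "0::'a" r] by simp

lemma sqrt_of_norm_less:
  assumes "star a = a" "norm (c *\<^sub>R 1 - a) < c"
  obtains s b where "star s = s" "s * s = a" "star b = b" "b * s = 1" "s * b = 1" "b * b * a = 1" "a * b = b * a"
    "\<And>y. y * a = a * y \<Longrightarrow> y * s = s * y"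
proof -
  have c: "c > 0" using assms(2) norm_ge_zero le_less_trans by blast
  define w where "w = 1 - (1 / c) *\<^sub>R a"
  have "w = (1 / c) *\<^sub>R (c *\<^sub>R 1 - a)" using c by (simp add: w_def scaleR_right_diff_distrib)
  then have "norm w = norm (c *\<^sub>R 1 - a) / c" using c by simp
  then have w: "norm w < 1" using assms(2) c by (simp only: divide_less_eq_1_pos)
  have sw: "star w = w" using assms(1) by (simp add: w_def star_diff star_scaleR)
  obtain b0 where b0: "b0 * b0 * (1 - w) = 1" "\<And>y. y * w = w * y \<Longrightarrow> y * b0 = b0 * y" "star b0 = b0"
    using inverse_sqrt[OF w] sw by metis
  have aw: "1 - w = (1 / c) *\<^sub>R a" "a = c *\<^sub>R (1 - w)" using c by (auto simp: w_def)
  define b where "b = (1 / sqrt c) *\<^sub>R b0"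
  have comm: "y * b = b * y" if "y * a = a * y" for y
  proof -
    have "y * w = w * y" using that by (simp add: w_def right_diff_distrib left_diff_distrib)
    then show ?thesis using b0(2) by (simp add: b_def)
  qed
  have ba: "a * b = b * a" by (rule comm) simp
  have bba: "b * b * a = 1" using b0(1) c by (simp add: b_def aw(1))
  have sb: "star b = b" using b0(3) by (simp add: b_def star_scaleR)
  define s where "s = b * a"
  have 1: "star s = s" using sb ba assms(1) by (simp add: s_def star_mult)
  have 2: "s * s = a" using bba ba by (metis s_def mult.assoc mult_1_left)
  have 3: "b * s = 1" using bba by (simp add: s_def mult.assoc)
  have 4: "s * b = 1" using bba ba by (metis s_def mult.assoc)
  have 5: "y * s = s * y" if "y * a = a * y" for y
    using comm[OF that] that by (metis s_def mult.assoc)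
  show ?thesis using that[OF 1 2 sb 3 4 bba ba 5] .
qed

lemma pos_sqrt:
  assumes "pos h" "\<epsilon> > 0"
  obtains s b where "star s = s" "s * s = h + \<epsilon> *\<^sub>R 1" "star b = b" "b * s = 1" "s * b = 1"
    "b * b * (h + \<epsilon> *\<^sub>R 1) = 1" "(h + \<epsilon> *\<^sub>R 1) * b = b * (h + \<epsilon> *\<^sub>R 1)"
    "\<And>y. y * h = h * y \<Longrightarrow> y * s = s * y"
proof -
  obtain c where c: "c \<ge> 0" "norm (c *\<^sub>R 1 - h) \<le> c" using assms by (auto simp: pos_def)
  have "star (h + \<epsilon> *\<^sub>R 1) = h + \<epsilon> *\<^sub>R 1" using assms by (simp add: star_add star_scaleR pos_sa)
  moreover have "norm ((c + \<epsilon>) *\<^sub>R 1 - (h + \<epsilon> *\<^sub>R 1)) < c + \<epsilon>"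
    using c assms by (simp add: scaleR_left_distrib)
  moreover have "y * (h + \<epsilon> *\<^sub>R 1) = (h + \<epsilon> *\<^sub>R 1) * y" if "y * h = h * y" for y
    using that by (simp add: distrib_left distrib_right)
  ultimately show ?thesis using sqrt_of_norm_less that by metis
qed

lemma mult_square_commute:
  fixes x :: "'a::semigroup_mult"
  assumes "x * y = y * x" shows "x * y * (x * y) = x * x * (y * y)"
proof -
  have "x * y * (x * y) = x * (y * x) * y" by (simp only: mult.assoc)
  also have "\<dots> = x * x * (y * y)" by (simp only: assms[symmetric] mult.assoc)
  finally show ?thesis .
qed

lemma commute_mult:
  fixes x :: "'a::semigroup_mult"
  assumes "x * y = y * x" "x * z = z * x" shows "x * (y * z) = y * z * x"
  by (simp only: mult.assoc[symmetric] assms(1)) (simp only: mult.assoc assms(2))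

lemma imag_mult_square: "imag * m * (imag * m) = - (m * m)" for m :: "'a::cstar_algebra"
  using mult_square_commute[OF imag_commute, of m] by (simp add: imag_square)

lemma self_adjoint_add_imag:
  fixes k :: "'a::cstar_algebra"
  assumes "star k = k" "star m = m" "k * m = m * k"
  shows "star (k + imag * m) = k - imag * m" "star (k + imag * m) * (k + imag * m) = k * k + m * m"
proof -
  show s: "star (k + imag * m) = k - imag * m"
    by (simp add: star_add star_mult star_imag assms(1,2) imag_commute)
  have "k * (imag * m) = imag * m * k"
    by (rule commute_mult) (simp_all add: imag_commute assms)
  then show "star (k + imag * m) * (k + imag * m) = k * k + m * m"
    unfolding s by (simp add: distrib_left left_diff_distrib imag_mult_square)
qed

text \<open>The hypothesis makes \<open>k + i m\<close> a multiple by \<open>\<rho>\<close> of a unitary, and \<open>k\<close> is its real part.\<close>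

lemma norm_le_of_sum_squares:
  assumes "star k = k" "star m = m" "k * m = m * k" "k * k + m * m = (\<rho>\<^sup>2) *\<^sub>R 1" "\<rho> \<ge> 0"
  shows "norm k \<le> \<rho>"
proof -
  define z where "z = k + imag * m"
  have sz: "star z = k - imag * m" "star z * z = k * k + m * m"
    using self_adjoint_add_imag[OF assms(1-3)] by (simp_all only: z_def)
  then have "(norm z)\<^sup>2 = norm ((\<rho>\<^sup>2) *\<^sub>R 1 :: 'a)"
    using norm_star_mult_self[of z] assms(4) by simp
  also have "\<dots> \<le> \<rho>\<^sup>2" using norm_one_le mult_left_mono[of "norm (1::'a)" 1 "\<rho>\<^sup>2"] by simp
  finally have nz: "norm z \<le> \<rho>" using assms(5) power2_le_imp_le by blast
  have "2 *\<^sub>R k = z + star z" by (simp add: sz(1)) (simp add: z_def scaleR_2)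
  then have "2 * norm k = norm (z + star z)" by (metis norm_scaleR abs_numeral)
  also have "\<dots> \<le> \<rho> + \<rho>" using nz by (intro norm_triangle_mono) auto
  finally show ?thesis by simp
qed

text \<open>If \<open>s\<^sup>2 = \<beta> - k + \<epsilon>\<close> and \<open>t\<^sup>2 = \<beta> + k + \<epsilon>\<close>, then \<open>k\<^sup>2 + (s t)\<^sup>2 = (\<beta> + \<epsilon>)\<^sup>2\<close>, so the previous lemma applies.
The shift by \<open>\<epsilon>\<close> provides the square roots.\<close>

lemma norm_le_of_pos:
  assumes "star k = k" "pos (\<beta> *\<^sub>R 1 - k)" "pos (\<beta> *\<^sub>R 1 + k)" "\<beta> \<ge> 0"
  shows "norm k \<le> \<beta>"
proof (rule field_le_epsilon)
  fix e :: real assume e: "e > 0"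
  obtain s where s: "star s = s" "s * s = \<beta> *\<^sub>R 1 - k + e *\<^sub>R 1" "\<And>y. y * (\<beta> *\<^sub>R 1 - k) = (\<beta> *\<^sub>R 1 - k) * y \<Longrightarrow> y * s = s * y"
    using pos_sqrt[OF assms(2) e] by metis
  obtain t where t: "star t = t" "t * t = \<beta> *\<^sub>R 1 + k + e *\<^sub>R 1" "\<And>y. y * (\<beta> *\<^sub>R 1 + k) = (\<beta> *\<^sub>R 1 + k) * y \<Longrightarrow> y * t = t * y"
    using pos_sqrt[OF assms(3) e] by metis
  have s': "y * s = s * y" if "y * k = k * y" for y
    using that by (intro s(3)) (simp add: left_diff_distrib right_diff_distrib)
  have t': "y * t = t * y" if "y * k = k * y" for y
    using that by (intro t(3)) (simp add: distrib_left distrib_right)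
  have ks: "k * s = s * k" and kt: "k * t = t * k" using s' t' by auto
  have st: "s * t = t * s" by (rule t') (simp add: ks)
  define m where "m = s * t"
  have "m * m = (s * s) * (t * t)" unfolding m_def by (rule mult_square_commute[OF st])
  also have "\<dots> = ((\<beta> + e) *\<^sub>R 1 - k) * ((\<beta> + e) *\<^sub>R 1 + k)"
    unfolding s(2) t(2) scaleR_left_distrib by (rule arg_cong2[where f = "(*)"]) (simp_all add: add_ac diff_add_eq)
  also have "\<dots> = (\<beta> + e)\<^sup>2 *\<^sub>R 1 - k * k"
    by (simp add: left_diff_distrib distrib_left power2_eq_square scaleR_right_diff_distrib)
  finally have "k * k + m * m = (\<beta> + e)\<^sup>2 *\<^sub>R 1" by simp
  moreover have "star m = m" by (simp add: m_def star_mult s(1) t(1) st)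
  moreover have "k * m = m * k" unfolding m_def by (rule commute_mult[OF ks kt])
  ultimately show "norm k \<le> \<beta> + e"
    by (intro norm_le_of_sum_squares[OF assms(1)]) (use assms e in auto)
qed

text \<open>For \<open>c > \<parallel>h\<parallel>\<^sup>2\<close> the element \<open>u = h + i (c - h\<^sup>2)\<^sup>1\<^sup>/\<^sup>2\<close> satisfies \<open>u\<^sup>*u = c\<close> and \<open>u\<^sup>2 + (u\<^sup>*)\<^sup>2 = 2 (2h\<^sup>2 - c)\<close>,
whence \<open>\<parallel>c - 2h\<^sup>2\<parallel> \<le> c\<close>.\<close>

lemma pos_square:
  assumes "star h = h" shows "pos (h * h)"
proof -
  define c where "c = (norm h)\<^sup>2 + 1"
  have c: "c > 0" by (simp add: c_def add_nonneg_pos)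
  have nh: "norm (h * h) < c" using norm_mult_ineq[of h h] unfolding c_def power2_eq_square by linarith
  have shh: "star (h * h) = h * h" using assms by (simp add: star_mult)
  obtain s where s: "star s = s" "s * s = c *\<^sub>R 1 - h * h"
      "\<And>y. y * (c *\<^sub>R 1 - h * h) = (c *\<^sub>R 1 - h * h) * y \<Longrightarrow> y * s = s * y"
    proof (rule sqrt_of_norm_less[of "c *\<^sub>R 1 - h * h" c])
    show "star (c *\<^sub>R 1 - h * h) = c *\<^sub>R 1 - h * h" by (simp add: star_diff star_scaleR shh)
    show "norm (c *\<^sub>R 1 - (c *\<^sub>R 1 - h * h)) < c" using nh by simp
  qed blast
  have hs: "h * s = s * h" by (rule s(3)) (simp add: left_diff_distrib right_diff_distrib mult.assoc)
  define u where "u = h + imag * s"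
  have su: "star u = h - imag * s" "star u * u = c *\<^sub>R 1"
    using self_adjoint_add_imag[OF assms s(1) hs] s(2) by (simp_all add: u_def)
  then have "(norm u)\<^sup>2 = norm (c *\<^sub>R 1 :: 'a)"
    using norm_star_mult_self[of u] by simp
  also have "\<dots> \<le> c" using norm_one_le mult_left_mono[of "norm (1::'a)" 1 c] c by simp
  finally have nu: "(norm u)\<^sup>2 \<le> c" .
  have "u * u + star u * star u = 2 *\<^sub>R (h * h - s * s)"
    unfolding su(1) unfolding u_def
    by (simp add: distrib_left left_diff_distrib right_diff_distrib distrib_right imag_mult_square scaleR_2)
  then have "2 *\<^sub>R (c *\<^sub>R 1 - 2 *\<^sub>R (h * h)) = - (u * u + star u * star u)"
    by (simp add: s(2) scaleR_2)
  then have "2 * norm (c *\<^sub>R 1 - 2 *\<^sub>R (h * h)) = norm (u * u + star u * star u)"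
    by (metis norm_scaleR abs_numeral norm_minus_cancel)
  also have "\<dots> \<le> c + c"
  proof (intro norm_triangle_mono)
    show "norm (u * u) \<le> c" using nu norm_mult_ineq[of u u] by (simp add: power2_eq_square)
    show "norm (star u * star u) \<le> c"
      using nu norm_mult_ineq[of "star u" "star u"] by (simp add: power2_eq_square)
  qed
  finally have "norm (c *\<^sub>R 1 - 2 *\<^sub>R (h * h)) \<le> c" by simp
  then have "pos (2 *\<^sub>R (h * h))" using c shh unfolding pos_def by (auto simp: star_scaleR intro!: exI[of _ c])
  from pos_scaleR[OF this, of "1/2"] show ?thesis by simp
qed

lemma norm_diff_le_of_pos: assumes "pos h" "norm h \<le> c" shows "norm (c *\<^sub>R 1 - h) \<le> c"
proof (rule norm_le_of_pos)
  have c: "c \<ge> 0" using assms(2) norm_ge_zero order_trans by blast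
  then show "c \<ge> 0" .
  show "star (c *\<^sub>R 1 - h) = c *\<^sub>R 1 - h" using assms pos_sa by (simp add: star_diff star_scaleR)
  show "pos (c *\<^sub>R 1 - (c *\<^sub>R 1 - h))" using assms by (simp add: algebra_simps)
  have "pos (c *\<^sub>R 1 + (c *\<^sub>R 1 - h))"
    using assms pos_sa c by (intro pos_add pos_const pos_of_norm_le) auto
  then show "pos (c *\<^sub>R 1 + (c *\<^sub>R 1 - h))" .
qed

lemma pos_closed:
  assumes "\<And>e. e > 0 \<Longrightarrow> pos (h + e *\<^sub>R 1)" shows "pos h"
proof -
  have "star (h + 1 *\<^sub>R 1) = h + 1 *\<^sub>R 1" by (intro pos_sa assms) simp
  then have sh: "star h = h" by (simp add: star_add star_scaleR)
  define c where "c = norm h + 1"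
  have "norm (c *\<^sub>R 1 - h) \<le> c"
  proof (rule field_le_epsilon)
    fix e :: real assume e: "e > 0"
    define e' where "e' = min e 1"
    have e': "e' > 0" "e' \<le> 1" "e' \<le> e" using e by (auto simp: e'_def)
    have ne: "norm (e' *\<^sub>R 1 :: 'a) \<le> e'"
      using norm_one_le mult_left_mono[of "norm (1::'a)" 1 e'] e' by simp
    then have "norm (h + e' *\<^sub>R 1) \<le> norm h + e'" by (intro norm_triangle_mono) auto
    then have "norm (h + e' *\<^sub>R 1) \<le> c" using e' by (simp add: c_def)
    then have "norm (c *\<^sub>R 1 - (h + e' *\<^sub>R 1)) \<le> c"
      using assms[of e'] e' norm_diff_le_of_pos by blast
    then have "norm ((c *\<^sub>R 1 - (h + e' *\<^sub>R 1)) + e' *\<^sub>R 1) \<le> c + e'"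
      using ne by (intro norm_triangle_mono)
    then show "norm (c *\<^sub>R 1 - h) \<le> c + e" using e' by simp
  qed
  then show ?thesis using sh unfolding pos_def by (auto simp: c_def intro!: exI[of _ c])
qed

text \<open>Up to \<open>\<epsilon>\<close> the product is the square of the self-adjoint element \<open>s q\<^sup>1\<^sup>/\<^sup>2\<close>.\<close>

lemma pos_conj_commute:
  assumes s: "star s = s" and q: "pos q" and sq: "s * q = q * s"
  shows "pos (s * q * s)"
proof (rule pos_closed)
  fix e :: real assume e: "e > 0"
  define d where "d = e / ((norm s)\<^sup>2 + 1)"
  have d: "d > 0" using e by (simp add: d_def add_nonneg_pos)
  obtain t where t: "star t = t" "t * t = q + d *\<^sub>R 1" "\<And>y. y * q = q * y \<Longrightarrow> y * t = t * y"
    using pos_sqrt[OF q d] by metis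
  have ts: "s * t = t * s" using t(3) sq by blast
  have "pos ((s * t) * (s * t))"
    by (rule pos_square) (simp add: star_mult s t(1) ts)
  also have "(s * t) * (s * t) = s * (t * t) * s" by (subst (2) ts) (simp only: mult.assoc)
  also have "\<dots> = s * q * s + d *\<^sub>R (s * s)" by (simp add: t(2) distrib_left distrib_right)
  finally have 1: "pos (s * q * s + d *\<^sub>R (s * s))" .
  have "norm (d *\<^sub>R (s * s)) \<le> d * (norm s)\<^sup>2"
    using norm_mult_ineq[of s s] d by (simp add: power2_eq_square)
  also have "\<dots> \<le> d * ((norm s)\<^sup>2 + 1)" using d by (intro mult_left_mono) auto
  also have "\<dots> = e" using add_nonneg_pos[of "(norm s)\<^sup>2" 1] by (simp add: d_def)
  finally have "pos (e *\<^sub>R 1 - d *\<^sub>R (s * s))"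
    using s by (intro pos_of_norm_le) (auto simp: star_scaleR star_mult)
  from pos_add[OF 1 this] show "pos (s * q * s + e *\<^sub>R 1)" by simp
qed

lemma le_of_power2_bounded:
  fixes x y B :: real
  assumes "\<And>j. x ^ (2 ^ j) \<le> B * y ^ (2 ^ j)" "y > 0"
  shows "x \<le> y"
proof (rule ccontr)
  assume "\<not> x \<le> y"
  then have "x / y > 1" using assms by simp
  then obtain n where n: "B < (x / y) ^ n" using real_arch_pow by blast
  have "(x / y) ^ n \<le> (x / y) ^ (2 ^ n)" using \<open>x / y > 1\<close>
    by (intro power_increasing) (auto simp: less_imp_le)
  also have "\<dots> = x ^ (2 ^ n) / y ^ (2 ^ n)" by (simp add: power_divide)
  also have "\<dots> \<le> B" using assms(1)[of n] assms(2) by (simp add: divide_simps)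
  finally show False using n by simp
qed

text \<open>This replaces the fact that \<open>y\<^sup>*y\<close> and \<open>y y\<^sup>*\<close> have the same nonzero spectrum. With \<open>H = c + y\<^sup>*y\<close> and
\<open>K = c + y y\<^sup>*\<close> one has \<open>K\<^sup>m y = y H\<^sup>m\<close>, so \<open>\<parallel>K\<^sup>m\<parallel>\<close> grows at most like \<open>\<parallel>H\<parallel>\<^sup>m \<le> (c + \<delta>)\<^sup>m\<close>; for a
self-adjoint element this rate of growth is the norm.\<close>

lemma pos_transfer:
  assumes d: "\<delta> > 0" and h: "pos (\<delta> *\<^sub>R 1 - star y * y)"
  shows "pos (\<delta> *\<^sub>R 1 - y * star y)"
proof -
  define c where "c = (norm y)\<^sup>2"
  define H where "H = c *\<^sub>R 1 + star y * y"
  define K where "K = c *\<^sub>R 1 + y * star y"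
  have c: "c \<ge> 0" by (simp add: c_def)
  have sH: "star H = H" "star K = K" by (simp_all add: H_def K_def star_add star_mult star_scaleR)
  have pH: "pos H" unfolding H_def
    by (rule pos_of_norm_le) (auto simp: star_mult norm_star_mult_self c_def)
  have nH: "norm H \<le> c + \<delta>"
  proof (rule norm_le_of_pos)
    show "pos ((c + \<delta>) *\<^sub>R 1 - H)" using h by (simp add: H_def scaleR_left_distrib)
    show "pos ((c + \<delta>) *\<^sub>R 1 + H)" using pH c d by (intro pos_add pos_const) auto
  qed (use c d sH in auto)
  have yK: "K ^ m * y = y * H ^ m" for m
  proof (induction m)
    case (Suc m)
    have "K * y = y * H" by (simp add: K_def H_def distrib_left distrib_right mult.assoc)
    then show ?case using Suc by (metis mult.assoc power_Suc)
  qed simp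
  \<comment> \<open>The recursion below reproduces the bound when \<open>c B + c \<le> B (c + \<delta>)\<close>.\<close>
  define B where "B = 1 + c / \<delta>"
  have B: "c * B + c \<le> B * (c + \<delta>)" "B \<ge> 1" using c d by (auto simp: B_def field_simps)
  have bound: "norm (K ^ m) \<le> B * (c + \<delta>) ^ m" for m
  proof (induction m)
    case 0 show ?case using order_trans[OF norm_one_le[where 'a = 'a] B(2)] by simp
  next
    case (Suc m)
    have "K ^ Suc m = K ^ m * K" by (simp add: power_commutes)
    also have "\<dots> = c *\<^sub>R K ^ m + (K ^ m * y) * star y"
      by (simp add: K_def[of] distrib_left mult.assoc)
    finally have eq: "K ^ Suc m = c *\<^sub>R K ^ m + y * H ^ m * star y" by (simp add: yK)
    have "norm (y * H ^ m * star y) \<le> norm y * norm (H ^ m) * norm (star y)"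
      using norm_mult_ineq[of "y * H ^ m" "star y"] norm_mult_ineq[of y "H ^ m"]
      by (meson mult_right_mono norm_ge_zero order_trans)
    also have "\<dots> = c * norm (H ^ m)" by (simp add: c_def power2_eq_square)
    also have "\<dots> \<le> c * (c + \<delta>) ^ m"
      using norm_power_le[of H m] power_mono[OF nH norm_ge_zero, of m] c
      by (intro mult_left_mono) auto
    finally have 1: "norm (y * H ^ m * star y) \<le> c * (c + \<delta>) ^ m" .
    have 2: "norm (c *\<^sub>R K ^ m) \<le> c * (B * (c + \<delta>) ^ m)" using Suc c by (simp add: mult_left_mono)
    have "norm (K ^ Suc m) \<le> c * (B * (c + \<delta>) ^ m) + c * (c + \<delta>) ^ m"
      unfolding eq by (intro norm_triangle_mono 1 2)
    also have "\<dots> = (c * B + c) * (c + \<delta>) ^ m" by (simp add: algebra_simps)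
    also have "\<dots> \<le> B * (c + \<delta>) * (c + \<delta>) ^ m" using B c d by (intro mult_right_mono) auto
    finally show ?case by (simp add: mult.assoc)
  qed
  have "norm K \<le> c + \<delta>"
    by (rule le_of_power2_bounded[where B = B]) (use bound[of "2 ^ _"] c d in \<open>simp_all add: norm_sa_power2[OF sH(2)]\<close>)
  then have "pos ((c + \<delta>) *\<^sub>R 1 - K)" using sH by (intro pos_of_norm_le)
  then show ?thesis by (simp add: K_def scaleR_left_distrib)
qed

text \<open>\<open>y\<^sup>*y + y y\<^sup>*\<close> is half the sum of the squares of the self-adjoint elements \<open>y + y\<^sup>*\<close> and \<open>i (y - y\<^sup>*)\<close>,
hence \<open>y\<^sup>*y \<ge> - y y\<^sup>* \<ge> - \<delta>\<close>.\<close>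

lemma pos_lower_of_upper:
  assumes "\<delta> > 0" "pos (\<delta> *\<^sub>R 1 - star y * y)"
  shows "pos (\<delta> *\<^sub>R 1 + star y * y)"
proof -
  define p where "p = y + star y"
  define z where "z = y - star y"
  define q where "q = imag * z"
  have "q * q = - (z * z)"
    unfolding q_def by (rule imag_mult_square)
  then have "p * p + q * q = 2 *\<^sub>R (y * star y + star y * y)"
    by (simp add: p_def z_def algebra_simps scaleR_2)
  moreover have "pos (p * p)" by (rule pos_square) (simp add: p_def star_add add.commute)
  moreover have "pos (q * q)"
    by (rule pos_square) (simp add: q_def z_def star_mult star_diff star_imag imag_commute algebra_simps)
  ultimately have "pos (2 *\<^sub>R (y * star y + star y * y))" by (metis pos_add)
  from pos_scaleR[OF this, of "1/2"] have "pos (y * star y + star y * y)" by simp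
  from pos_add[OF pos_transfer[OF assms] this] show ?thesis by (simp add: algebra_simps)
qed

text \<open>If \<open>a = x\<^sup>*x\<close> and \<open>a + \<nu>\<close> is strictly positive, put \<open>b = (a + \<nu>)\<^sup>-\<^sup>1\<^sup>/\<^sup>2\<close>. Then
\<open>(x b)\<^sup>*(x b) = 1 - \<nu> b\<^sup>2 \<le> 1\<close>, so \<open>2 - \<nu> b\<^sup>2 \<ge> 0\<close> by the previous lemma, and multiplication by
\<open>a + \<nu>\<close>, the square of \<open>s = b\<^sup>-\<^sup>1\<close>, gives \<open>a + \<nu>/2 \<ge> 0\<close>. Iteration drives the lower bound of \<open>a\<close> to zero.\<close>

lemma pos_star_mult_self: "pos (star x * x)"
proof -
  define a where "a = star x * x"
  have sa: "star a = a" by (simp add: a_def star_mult)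
  have step: "pos (a + (\<nu> / 2) *\<^sub>R 1)" if \<nu>: "\<nu> > \<mu>" "\<mu> \<ge> 0" and p: "pos (a + \<mu> *\<^sub>R 1)" for \<mu> \<nu>
  proof -
    have e: "\<nu> - \<mu> > 0" using \<nu> by simp
    obtain s b where sb: "star s = s" "s * s = a + \<nu> *\<^sub>R 1" "star b = b" "b * s = 1" "s * b = 1"
    proof (rule pos_sqrt[OF p e])
      fix s b assume *: "star s = s" "s * s = a + \<mu> *\<^sub>R 1 + (\<nu> - \<mu>) *\<^sub>R 1" "star b = b" "b * s = 1" "s * b = 1"
      have "a + \<mu> *\<^sub>R 1 + (\<nu> - \<mu>) *\<^sub>R 1 = a + \<nu> *\<^sub>R 1"
        by (simp add: add.assoc scaleR_left_distrib[symmetric])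
      with * show ?thesis by (intro that[of s b]) auto
    qed
    have "star (x * b) * (x * b) = b * a * b" by (simp add: star_mult a_def mult.assoc sb(3))
    also have "a = s * s - \<nu> *\<^sub>R 1" using sb by simp
    also have "b * (s * s - \<nu> *\<^sub>R 1) * b = (b * s) * (s * b) - \<nu> *\<^sub>R (b * b)"
      by (simp only: right_diff_distrib left_diff_distrib mult.assoc scaleR_one_mult mult_scaleR_right mult_1_left mult_scaleR_left)
    finally have eq: "star (x * b) * (x * b) = 1 - \<nu> *\<^sub>R (b * b)" using sb by simp
    have "pos (1 *\<^sub>R 1 - star (x * b) * (x * b))"
      unfolding eq using pos_scaleR[OF pos_square[OF sb(3)], of \<nu>] \<nu> by simp
    then have "pos (1 *\<^sub>R 1 + star (x * b) * (x * b))" by (rule pos_lower_of_upper[rotated]) simp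
    then have "pos (s * (2 *\<^sub>R 1 - \<nu> *\<^sub>R (b * b)) * s)"
    proof (intro pos_conj_commute sb)
      have "1 *\<^sub>R 1 + star (x * b) * (x * b) = 2 *\<^sub>R 1 - \<nu> *\<^sub>R (b * b)" by (simp add: eq scaleR_2)
      then show "pos (1 *\<^sub>R 1 + star (x * b) * (x * b)) \<Longrightarrow> pos (2 *\<^sub>R 1 - \<nu> *\<^sub>R (b * b))" by simp
      have "s * (b * b) = b * b * s" by (rule commute_mult) (simp_all add: sb)
      then show "s * (2 *\<^sub>R 1 - \<nu> *\<^sub>R (b * b)) = (2 *\<^sub>R 1 - \<nu> *\<^sub>R (b * b)) * s"
        by (simp add: right_diff_distrib left_diff_distrib)
    qed
    also have "s * (2 *\<^sub>R 1 - \<nu> *\<^sub>R (b * b)) * s = 2 *\<^sub>R (s * s) - \<nu> *\<^sub>R ((s * b) * (b * s))"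
      by (simp only: right_diff_distrib left_diff_distrib mult.assoc mult_scaleR_right mult_1_right mult_scaleR_left)
    also have "\<dots> = 2 *\<^sub>R (a + (\<nu> / 2) *\<^sub>R 1)"
      by (simp add: sb scaleR_right_distrib add_diff_eq[symmetric] scaleR_left_diff_distrib[symmetric])
    finally show ?thesis using pos_scaleR[of _ "1/2"] by fastforce
  qed
  \<comment> \<open>The step with \<open>\<nu> = 3/2 \<mu>\<close> turns \<open>\<mu>\<close> into \<open>3/4 \<mu>\<close>; the term \<open>e\<close> keeps \<open>\<mu>\<close> positive.\<close>
  have it: "pos (a + (norm a * (3 / 4) ^ k + e) *\<^sub>R 1)" if "e > 0" for k e
  proof (induction k)
    case 0
    show ?case using pos_add[OF pos_of_norm_le(2)[OF sa order_refl] pos_const[of e]] that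
      by (simp add: algebra_simps)
  next
    case (Suc k)
    define m where "m = norm a * (3 / 4) ^ k + e"
    have m: "m > 0" using that by (simp add: m_def add_nonneg_pos)
    have "pos (a + ((3 / 2 * m) / 2) *\<^sub>R 1)"
      by (rule step[of m]) (use m Suc in \<open>auto simp: m_def\<close>)
    moreover have "pos ((e / 4) *\<^sub>R 1)" using that by (intro pos_const) auto
    ultimately have "pos (a + ((3 / 2 * m) / 2) *\<^sub>R 1 + (e / 4) *\<^sub>R 1)" by (rule pos_add)
    then show ?case by (simp add: m_def add.assoc scaleR_left_distrib[symmetric] field_simps)
  qed
  have "pos a"
  proof (rule pos_closed)
    fix e :: real assume e: "e > 0"
    have "(\<lambda>k. norm a * (3 / 4) ^ k) \<longlonglongrightarrow> norm a * 0" by (intro tendsto_intros) auto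
    then have "\<forall>\<^sub>F k in sequentially. norm a * (3 / 4) ^ k < e / 2"
      using e by (intro order_tendstoD) auto
    then obtain k where k: "norm a * (3 / 4) ^ k < e / 2" by (auto simp: eventually_sequentially)
    have "pos (a + (norm a * (3 / 4) ^ k + e / 2) *\<^sub>R 1)" using it e by simp
    moreover have "pos ((e / 2 - norm a * (3 / 4) ^ k) *\<^sub>R 1)" using k by (intro pos_const) auto
    ultimately have "pos (a + (norm a * (3 / 4) ^ k + e / 2) *\<^sub>R 1 + (e / 2 - norm a * (3 / 4) ^ k) *\<^sub>R 1)"
      by (rule pos_add)
    then show "pos (a + e *\<^sub>R 1)" by (simp add: add.assoc scaleR_left_distrib[symmetric])
  qed
  then show ?thesis by (simp add: a_def)
qed

text \<open>This lemma and the next express the norm by hermitian squares alone.\<close>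

lemma complement_square:
  assumes "(norm x)\<^sup>2 < r"
  obtains s where "star x * x + star s * s = r *\<^sub>R 1"
proof -
  have "norm (r *\<^sub>R 1 - (r *\<^sub>R 1 - star x * x)) < r" using assms by (simp add: norm_star_mult_self)
  moreover have "star (r *\<^sub>R 1 - star x * x) = r *\<^sub>R 1 - star x * x"
    by (simp add: star_diff star_scaleR star_mult)
  ultimately obtain s where "star s = s" "s * s = r *\<^sub>R 1 - star x * x"
    using sqrt_of_norm_less by metis
  then show ?thesis using that[of s] by simp
qed

lemma norm_le_of_complement_pos:
  assumes "star x * x + p = r *\<^sub>R 1" "pos p" "r \<ge> 0"
  shows "(norm x)\<^sup>2 \<le> r"
proof -
  have p: "p = r *\<^sub>R 1 - star x * x" using assms by (simp add: algebra_simps)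
  have "norm (star x * x) \<le> r"
  proof (rule norm_le_of_pos)
    show "pos (r *\<^sub>R 1 - star x * x)" using assms(2) unfolding p .
    show "pos (r *\<^sub>R 1 + star x * x)" using assms by (intro pos_add pos_const pos_star_mult_self)
  qed (use assms in \<open>auto simp: star_mult\<close>)
  then show ?thesis by (simp add: norm_star_mult_self)
qed

text \<open>The complex numbers, as central elements of the algebra.\<close>

definition cplx :: "complex \<Rightarrow> 'a::cstar_algebra" where
  "cplx c = Re c *\<^sub>R 1 + Im c *\<^sub>R imag"

lemma cplx_commute: "cplx c * x = x * cplx c"
  by (simp add: cplx_def distrib_left distrib_right imag_commute)

lemma cplx_add: "cplx (a + b) = cplx a + cplx b"
  by (simp add: cplx_def scaleR_left_distrib)

lemma cplx_0 [simp]: "cplx 0 = 0" and cplx_1 [simp]: "cplx 1 = 1"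
  by (simp_all add: cplx_def)

lemma cplx_of_real: "cplx (of_real r) = r *\<^sub>R 1"
  by (simp add: cplx_def)

lemma cplx_mult: "cplx (a * b) = cplx a * cplx b"
  by (simp add: cplx_def distrib_left distrib_right imag_square scaleR_left_distrib scaleR_left_diff_distrib)
     (simp add: scaleR_right_distrib scaleR_right_diff_distrib mult.commute)

lemma star_cplx: "star (cplx c) = cplx (cnj c)"
  by (simp add: cplx_def star_add star_scaleR star_imag)

lemma star_cplx_mult: "star (cplx c * x) * (cplx c * y) = (cmod c)\<^sup>2 *\<^sub>R (star x * y)"
proof -
  have "star (cplx c * x) * (cplx c * y) = star x * (cplx (cnj c * c) * y)"
    by (simp add: star_mult star_cplx cplx_mult mult.assoc)
  also have "cnj c * c = of_real ((cmod c)\<^sup>2)"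
    by (metis complex_norm_square mult.commute of_real_power)
  finally show ?thesis by (simp add: cplx_of_real del: of_real_power)
qed

lemma pos_sum: "(\<And>i. i \<in> I \<Longrightarrow> pos (f i)) \<Longrightarrow> pos (sum f I)"
proof (induction I rule: infinite_finite_induct)
  case (insert i I) then show ?case by (simp add: pos_add)
qed (use pos_const[of 0] in simp_all)

text \<open>Positive matrices over an index set \<open>I\<close>, given by a certificate: as a quadratic form, \<open>H\<close> is a sum of
squares of the linear forms with coefficient rows \<open>s k\<close>. Matrices are functions
whose values outside \<open>I\<close> are irrelevant.\<close>

definition gram :: "'i set \<Rightarrow> ('i \<Rightarrow> 'i \<Rightarrow> 'a::cstar_algebra) \<Rightarrow> bool" where
  "gram I H \<longleftrightarrow> (\<exists>(m::nat) s. \<forall>i\<in>I. \<forall>j\<in>I. H i j = (\<Sum>k<m. star (s k i) * s k j))"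

section \<open>Gram matrices and the norm of a matrix\<close>

lemma sum_swap3:
  "(\<Sum>p\<in>A. \<Sum>q\<in>B. \<Sum>k\<in>C. g p q k) = (\<Sum>k\<in>C. \<Sum>p\<in>A. \<Sum>q\<in>B. g p q k)"
proof -
  have "(\<Sum>p\<in>A. \<Sum>q\<in>B. \<Sum>k\<in>C. g p q k) = (\<Sum>p\<in>A. \<Sum>k\<in>C. \<Sum>q\<in>B. g p q k)"
    by (intro sum.cong refl sum.swap)
  also have "\<dots> = (\<Sum>k\<in>C. \<Sum>p\<in>A. \<Sum>q\<in>B. g p q k)" by (rule sum.swap)
  finally show ?thesis .
qed

lemma scaleR_double: "(2 * r) *\<^sub>R x = r *\<^sub>R x + r *\<^sub>R (x :: 'a::real_vector)"
  by (metis mult_2 scaleR_left_distrib)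

lemma gramE:
  assumes "gram I H"
  obtains m :: nat and s where "\<And>i j. i \<in> I \<Longrightarrow> j \<in> I \<Longrightarrow> H i j = (\<Sum>k<m. star (s k i) * s k j)"
  using assms unfolding gram_def by blast

lemma gram_cong: "gram I H \<Longrightarrow> (\<And>i j. i \<in> I \<Longrightarrow> j \<in> I \<Longrightarrow> H i j = G i j) \<Longrightarrow> gram I G"
  unfolding gram_def by metis

lemma gram_row: "gram I (\<lambda>i j. star (r i) * r j)"
  unfolding gram_def by (intro exI[of _ 1] exI[of _ "\<lambda>_. r"]) simp

lemma gram_zero: "gram I (\<lambda>i j. 0)"
  unfolding gram_def by (intro exI[of _ 0]) simp

lemma gram_add:
  assumes "gram I G" "gram I H" shows "gram I (\<lambda>i j. G i j + H i j)"
proof -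
  from assms(1) obtain m :: nat and s where
    s: "\<And>i j. i \<in> I \<Longrightarrow> j \<in> I \<Longrightarrow> G i j = (\<Sum>k<m. star (s k i) * s k j)" by (rule gramE) (rule that)
  from assms(2) obtain n :: nat and t where
    t: "\<And>i j. i \<in> I \<Longrightarrow> j \<in> I \<Longrightarrow> H i j = (\<Sum>k<n. star (t k i) * t k j)" by (rule gramE) (rule that)
  define u where "u k = (if k < m then s k else t (k - m))" for k
  have "(\<Sum>k<m + n. star (u k i) * u k j) = (\<Sum>k<m. star (s k i) * s k j) + (\<Sum>k<n. star (t k i) * t k j)" for i j
    by (induction n) (auto simp: u_def add.assoc)
  with s t show ?thesis unfolding gram_def by (intro exI[of _ "m + n"] exI[of _ u]) simp
qed

lemma gram_sum: "(\<And>k. k \<in> K \<Longrightarrow> gram I (H k)) \<Longrightarrow> gram I (\<lambda>i j. \<Sum>k\<in>K. H k i j)"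
  by (induction K rule: infinite_finite_induct) (auto intro: gram_zero gram_add)

text \<open>The substitution of \<open>\<Sum>\<^sub>i c p i y\<^sub>i\<close> for the variable \<open>x\<^sub>p\<close> of the quadratic form.\<close>

lemma gram_pullback:
  assumes "gram J H"
  shows "gram I (\<lambda>i j. \<Sum>p\<in>J. \<Sum>q\<in>J. star (c p i) * H p q * c q j)"
proof -
  obtain m :: nat and s where s: "\<And>i j. i \<in> J \<Longrightarrow> j \<in> J \<Longrightarrow> H i j = (\<Sum>k<m. star (s k i) * s k j)"
    using assms(1) by (rule gramE) (rule that)
  have "(\<Sum>p\<in>J. \<Sum>q\<in>J. star (c p i) * H p q * c q j) =
        (\<Sum>k<m. star (\<Sum>p\<in>J. s k p * c p i) * (\<Sum>q\<in>J. s k q * c q j))" for i j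
  proof -
    have "(\<Sum>p\<in>J. \<Sum>q\<in>J. star (c p i) * H p q * c q j) =
      (\<Sum>p\<in>J. \<Sum>q\<in>J. \<Sum>k<m. star (s k p * c p i) * (s k q * c q j))"
      by (intro sum.cong refl)
        (simp add: s sum_distrib_left sum_distrib_right star_mult mult.assoc)
    also have "\<dots> = (\<Sum>k<m. \<Sum>p\<in>J. \<Sum>q\<in>J. star (s k p * c p i) * (s k q * c q j))"
      by (rule sum_swap3)
    also have "\<dots> = (\<Sum>k<m. star (\<Sum>p\<in>J. s k p * c p i) * (\<Sum>q\<in>J. s k q * c q j))"
      by (simp add: sum_product star_sum)
    finally show ?thesis .
  qed
  then show ?thesis unfolding gram_def
    by (intro exI[of _ m] exI[of _ "\<lambda>k i. \<Sum>p\<in>J. s k p * c p i"]) blast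
qed

lemma gram_scale: assumes "gram I H" "r \<ge> 0" shows "gram I (\<lambda>i j. r *\<^sub>R H i j)"
proof -
  obtain m :: nat and s where s: "\<And>i j. i \<in> I \<Longrightarrow> j \<in> I \<Longrightarrow> H i j = (\<Sum>k<m. star (s k i) * s k j)"
    using assms(1) by (rule gramE) (rule that)
  show ?thesis unfolding gram_def
    by (intro exI[of _ m] exI[of _ "\<lambda>k i. sqrt r *\<^sub>R s k i"])
      (use assms in \<open>simp add: s star_scaleR scaleR_sum_right\<close>)
qed

lemma gram_herm: assumes "gram I H" "i \<in> I" "j \<in> I" shows "star (H i j) = H j i"
proof -
  obtain m :: nat and s where s: "\<And>i j. i \<in> I \<Longrightarrow> j \<in> I \<Longrightarrow> H i j = (\<Sum>k<m. star (s k i) * s k j)"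
    using assms(1) by (rule gramE) (rule that)
  show ?thesis using assms by (simp add: s star_sum star_mult)
qed

lemma gram_diag_pos: assumes "gram I H" "i \<in> I" shows "pos (H i i)"
proof -
  obtain m :: nat and s where s: "\<And>i j. i \<in> I \<Longrightarrow> j \<in> I \<Longrightarrow> H i j = (\<Sum>k<m. star (s k i) * s k j)"
    using assms(1) by (rule gramE) (rule that)
  show ?thesis using assms by (simp add: s pos_sum pos_star_mult_self)
qed

definition scalar :: "real \<Rightarrow> 'i \<Rightarrow> 'i \<Rightarrow> 'a::cstar_algebra" where
  "scalar r i j = (if i = j then r *\<^sub>R 1 else 0)"

lemma gram_scalar:
  assumes "finite I" "r \<ge> 0" shows "gram I (scalar r)"
proof -
  have "gram I (\<lambda>i j. \<Sum>k\<in>I. star (scalar (sqrt r) k i) * scalar (sqrt r) k j)"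
    by (intro gram_sum gram_row)
  then show ?thesis
  proof (rule gram_cong)
    fix i j assume "i \<in> I" "j \<in> I"
    have "(\<Sum>k\<in>I. star (scalar (sqrt r) k i) * scalar (sqrt r) k j :: 'b) = (\<Sum>k\<in>I. if k = i then scalar r i j else 0)"
      using assms by (intro sum.cong) (auto simp: scalar_def star_scaleR)
    then show "(\<Sum>k\<in>I. star (scalar (sqrt r) k i) * scalar (sqrt r) k j :: 'b) = scalar r i j"
      using assms \<open>i \<in> I\<close> by simp
  qed
qed

lemma sum_scalar_left:
  assumes "finite I" "i \<in> I" shows "(\<Sum>k\<in>I. scalar r i k * f k) = r *\<^sub>R f i"
proof -
  have "(\<Sum>k\<in>I. scalar r i k * f k) = (\<Sum>k\<in>I. if k = i then r *\<^sub>R f i else 0)"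
    by (intro sum.cong) (auto simp: scalar_def)
  then show ?thesis using assms by simp
qed

lemma sum_scalar_right:
  assumes "finite I" "i \<in> I" shows "(\<Sum>k\<in>I. f k * scalar r k i) = r *\<^sub>R f i"
proof -
  have "(\<Sum>k\<in>I. f k * scalar r k i) = (\<Sum>k\<in>I. if k = i then r *\<^sub>R f i else 0)"
    by (intro sum.cong) (auto simp: scalar_def)
  then show ?thesis using assms by simp
qed

lemma star_scalar: "star (scalar r i j) = scalar r j i"
  by (simp add: scalar_def star_scaleR)

abbreviation hermitian_square :: "'k set \<Rightarrow> ('k \<Rightarrow> 'i \<Rightarrow> 'a::cstar_algebra) \<Rightarrow> 'i \<Rightarrow> 'i \<Rightarrow> 'a" where
  "hermitian_square K X i j \<equiv> \<Sum>k\<in>K. star (X k i) * X k j"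

text \<open>A certificate that \<open>X\<close>, as a matrix over \<open>I\<close>, has norm at most the square root of \<open>r\<close>.\<close>

definition mbound :: "'i set \<Rightarrow> real \<Rightarrow> ('i \<Rightarrow> 'i \<Rightarrow> 'a::cstar_algebra) \<Rightarrow> bool" where
  "mbound I r X \<longleftrightarrow> gram I (\<lambda>i j. scalar r i j - (hermitian_square I X i j))"

lemma mbound_cong:
  assumes "mbound I r X" "\<And>i j. i \<in> I \<Longrightarrow> j \<in> I \<Longrightarrow> X i j = Y i j" shows "mbound I r Y"
  using assms(1) unfolding mbound_def
  by (rule gram_cong) (simp add: assms(2) cong: sum.cong)

lemma mbound_mono: assumes "mbound I r X" "r \<le> s" "finite I" shows "mbound I s X"
  unfolding mbound_def
proof (rule gram_cong)
  show "gram I (\<lambda>i j. (scalar r i j - (hermitian_square I X i j)) + scalar (s - r) i j)"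
    using assms by (intro gram_add gram_scalar) (auto simp: mbound_def)
qed (auto simp: scalar_def scaleR_left_diff_distrib)

lemma mbound_zero: "finite I \<Longrightarrow> r \<ge> 0 \<Longrightarrow> mbound I r (\<lambda>i j. 0)"
  unfolding mbound_def using gram_scalar by (rule gram_cong) auto

text \<open>The substitution of \<open>c\<close> into \<open>r - X\<^sup>*X\<close> gives \<open>r c\<^sup>*c - (X c)\<^sup>*(X c)\<close>.\<close>

lemma sum_pull_diff:
  assumes "finite J"
  shows "(\<Sum>p\<in>J. \<Sum>q\<in>J. star (c p i) * (scalar r p q - (hermitian_square K X p q)) * c q j) =
    r *\<^sub>R (\<Sum>p\<in>J. star (c p i) * c p j) - (\<Sum>k\<in>K. star (\<Sum>p\<in>J. X k p * c p i) * (\<Sum>q\<in>J. X k q * c q j))"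
proof -
  have 1: "(\<Sum>q\<in>J. star (c p i) * scalar r p q * c q j) = r *\<^sub>R (star (c p i) * c p j)" if "p \<in> J" for p
    using sum_scalar_left[OF assms that, of r "\<lambda>q. c q j"] by (simp add: mult.assoc sum_distrib_left[symmetric])
  have "(\<Sum>p\<in>J. \<Sum>q\<in>J. star (c p i) * (hermitian_square K X p q) * c q j) =
      (\<Sum>p\<in>J. \<Sum>q\<in>J. \<Sum>k\<in>K. star (X k p * c p i) * (X k q * c q j))"
    by (intro sum.cong refl)
        (simp add: sum_distrib_left sum_distrib_right star_mult mult.assoc)
  also have "\<dots> = (\<Sum>k\<in>K. \<Sum>p\<in>J. \<Sum>q\<in>J. star (X k p * c p i) * (X k q * c q j))"
    by (rule sum_swap3)
  also have "\<dots> = (\<Sum>k\<in>K. star (\<Sum>p\<in>J. X k p * c p i) * (\<Sum>q\<in>J. X k q * c q j))"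
    by (simp add: sum_product star_sum)
  finally show ?thesis
    by (simp add: left_diff_distrib right_diff_distrib sum_subtractf 1 scaleR_sum_right cong: sum.cong)
qed

lemma gram_pull_diff:
  assumes "gram J (\<lambda>i j. scalar r i j - (hermitian_square K X i j))" "finite J"
  shows "gram I (\<lambda>i j. r *\<^sub>R (\<Sum>p\<in>J. star (c p i) * c p j) - (\<Sum>k\<in>K. star (\<Sum>p\<in>J. X k p * c p i) * (\<Sum>q\<in>J. X k q * c q j)))"
  using gram_pullback[OF assms(1), of I c] unfolding sum_pull_diff[OF assms(2)] .

lemma mbound_mult:
  assumes "mbound I r X" "mbound I s Y" "r \<ge> 0" "finite I"
  shows "mbound I (r * s) (\<lambda>i j. \<Sum>k\<in>I. X i k * Y k j)"
  unfolding mbound_def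
proof (rule gram_cong)
  show "gram I (\<lambda>i j. (r *\<^sub>R (\<Sum>p\<in>I. star (Y p i) * Y p j) - (\<Sum>k\<in>I. star (\<Sum>p\<in>I. X k p * Y p i) * (\<Sum>q\<in>I. X k q * Y q j)))
     + r *\<^sub>R (scalar s i j - (hermitian_square I Y i j)))"
    using assms unfolding mbound_def by (intro gram_add gram_pull_diff gram_scale) auto
qed (simp add: scaleR_right_diff_distrib scalar_def)

lemma gram_square_diff:
  assumes "finite I" "\<And>i j. i \<in> I \<Longrightarrow> j \<in> I \<Longrightarrow> star (K i j) = K j i"
  shows "gram I (\<lambda>i j. scalar (r\<^sup>2) i j - (2 * r) *\<^sub>R K i j + (hermitian_square I K i j))"
proof (rule gram_cong)
  show "gram I (\<lambda>i j. \<Sum>k\<in>I. star (scalar r k i - K k i) * (scalar r k j - K k j))"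
    by (intro gram_sum gram_row)
next
  fix i j assume ij: "i \<in> I" "j \<in> I"
  have "(\<Sum>k\<in>I. star (scalar r k i - K k i) * (scalar r k j - K k j)) =
    (\<Sum>k\<in>I. scalar r i k * scalar r k j) - (\<Sum>k\<in>I. scalar r i k * K k j)
     - (\<Sum>k\<in>I. star (K k i) * scalar r k j) + (hermitian_square I K i j)"
    by (simp add: star_diff star_scalar left_diff_distrib right_diff_distrib sum_subtractf sum.distrib algebra_simps)
  also have "\<dots> = scalar (r\<^sup>2) i j - (2 * r) *\<^sub>R K i j + (hermitian_square I K i j)"
    using ij assms by (simp add: sum_scalar_left sum_scalar_right)
      (simp add: scalar_def power2_eq_square scaleR_double)
  finally show "(\<Sum>k\<in>I. star (scalar r k i - K k i) * (scalar r k j - K k j)) = \<dots>" .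
qed

text \<open>\<open>2r (r - K) = (r - K)\<^sup>2 + (r\<^sup>2 - K\<^sup>2)\<close>.\<close>

lemma gram_of_mbound_herm:
  fixes K :: "'i \<Rightarrow> 'i \<Rightarrow> 'b::cstar_algebra"
  assumes "finite I" "\<And>i j. i \<in> I \<Longrightarrow> j \<in> I \<Longrightarrow> star (K i j) = K j i" "mbound I (r\<^sup>2) K" "r > 0"
  shows "gram I (\<lambda>i j. scalar r i j - K i j)"
proof (rule gram_cong)
  show "gram I (\<lambda>i j. (1 / (2 * r)) *\<^sub>R ((scalar (r\<^sup>2) i j - (2 * r) *\<^sub>R K i j + (hermitian_square I K i j))
    + (scalar (r\<^sup>2) i j - (hermitian_square I K i j))))"
    using assms unfolding mbound_def by (intro gram_scale gram_add gram_square_diff) auto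
next
  fix i j :: 'i
  have "scalar (r\<^sup>2) i j = r *\<^sub>R (scalar r i j :: 'b)" by (simp add: scalar_def power2_eq_square)
  then have "(scalar (r\<^sup>2) i j - (2 * r) *\<^sub>R K i j + (hermitian_square I K i j)) + (scalar (r\<^sup>2) i j - (hermitian_square I K i j))
    = (2 * r) *\<^sub>R (scalar r i j - K i j)"
    by (simp add: scaleR_right_diff_distrib scaleR_double)
  then show "(1 / (2 * r)) *\<^sub>R ((scalar (r\<^sup>2) i j - (2 * r) *\<^sub>R K i j + (hermitian_square I K i j))
    + (scalar (r\<^sup>2) i j - (hermitian_square I K i j))) = scalar r i j - K i j"
    using assms(4) by simp
qed

text \<open>\<open>c K (c - K) = K (c - K) K + (c - K) K (c - K)\<close> is a sum of two pullbacks, and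
\<open>c\<^sup>2 - K\<^sup>2 = c (c - K) + K (c - K)\<close>.\<close>

lemma mbound_of_gram_herm:
  assumes fin: "finite I" and K: "gram I K" "gram I (\<lambda>i j. scalar c i j - K i j)" and c: "c > 0"
  shows "mbound I (c\<^sup>2) K"
proof -
  have h: "star (K i j) = K j i" if "i \<in> I" "j \<in> I" for i j using gram_herm[OF K(1)] that by auto
  define K2 where "K2 i j = (\<Sum>k\<in>I. K i k * K k j)" for i j
  define K3 where "K3 i j = (\<Sum>p\<in>I. \<Sum>q\<in>I. K i p * K p q * K q j)" for i j
  have 1: "gram I (\<lambda>i j. c *\<^sub>R K2 i j - K3 i j)"
  proof (rule gram_cong[OF gram_pullback[OF K(2), of _ K]])
    fix i j assume ij: "i \<in> I" "j \<in> I"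
    have "(\<Sum>p\<in>I. \<Sum>q\<in>I. star (K p i) * (scalar c p q - K p q) * K q j) =
       (\<Sum>p\<in>I. K i p * (\<Sum>q\<in>I. scalar c p q * K q j)) - K3 i j"
      using ij by (simp add: h K3_def left_diff_distrib right_diff_distrib sum_subtractf sum_distrib_left mult.assoc cong: sum.cong)
    also have "(\<Sum>p\<in>I. K i p * (\<Sum>q\<in>I. scalar c p q * K q j)) = c *\<^sub>R K2 i j"
      using fin by (simp add: sum_scalar_left K2_def scaleR_sum_right cong: sum.cong)
    finally show "(\<Sum>p\<in>I. \<Sum>q\<in>I. star (K p i) * (scalar c p q - K p q) * K q j) = c *\<^sub>R K2 i j - K3 i j" .
  qed
  have 2: "gram I (\<lambda>i j. c\<^sup>2 *\<^sub>R K i j - (2 * c) *\<^sub>R K2 i j + K3 i j)"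
  proof (rule gram_cong[OF gram_pullback[OF K(1), of _ "\<lambda>i j. scalar c i j - K i j"]])
    fix i j assume ij: "i \<in> I" "j \<in> I"
    have "(\<Sum>p\<in>I. \<Sum>q\<in>I. star (scalar c p i - K p i) * K p q * (scalar c q j - K q j)) =
      (\<Sum>p\<in>I. (scalar c i p - K i p) * (\<Sum>q\<in>I. K p q * scalar c q j - K p q * K q j))"
      using ij by (simp add: h star_diff star_scalar right_diff_distrib mult.assoc sum_distrib_left cong: sum.cong)
    also have "\<dots> = (\<Sum>p\<in>I. (scalar c i p - K i p) * (c *\<^sub>R K p j - K2 p j))"
      using ij fin by (simp add: sum_subtractf sum_scalar_right K2_def cong: sum.cong)
    also have "\<dots> = c *\<^sub>R (c *\<^sub>R K i j - K2 i j) - (\<Sum>p\<in>I. K i p * (c *\<^sub>R K p j - K2 p j))"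
      using ij fin by (simp only: left_diff_distrib sum_subtractf sum_scalar_left)
    also have "(\<Sum>p\<in>I. K i p * (c *\<^sub>R K p j - K2 p j)) = c *\<^sub>R K2 i j - K3 i j"
      by (simp add: right_diff_distrib sum_subtractf K2_def K3_def scaleR_sum_right sum_distrib_left mult.assoc)
    finally show "(\<Sum>p\<in>I. \<Sum>q\<in>I. star (scalar c p i - K p i) * K p q * (scalar c q j - K q j)) =
       c\<^sup>2 *\<^sub>R K i j - (2 * c) *\<^sub>R K2 i j + K3 i j"
      by (simp add: scaleR_right_diff_distrib power2_eq_square scaleR_double)
  qed
  show ?thesis unfolding mbound_def
  proof (rule gram_cong)
    show "gram I (\<lambda>i j. c *\<^sub>R (scalar c i j - K i j) + (1 / c) *\<^sub>R ((c *\<^sub>R K2 i j - K3 i j) + (c\<^sup>2 *\<^sub>R K i j - (2 * c) *\<^sub>R K2 i j + K3 i j)))"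
      using c K by (intro gram_add gram_scale 1 2) auto
    fix i j assume ij: "i \<in> I" "j \<in> I"
    have "c *\<^sub>R scalar c i j = (scalar (c\<^sup>2) i j :: 'b)" by (simp add: scalar_def power2_eq_square)
    moreover have "(hermitian_square I K i j) = K2 i j" using ij by (simp add: h K2_def cong: sum.cong)
    ultimately show "c *\<^sub>R (scalar c i j - K i j) + (1 / c) *\<^sub>R ((c *\<^sub>R K2 i j - K3 i j) + (c\<^sup>2 *\<^sub>R K i j - (2 * c) *\<^sub>R K2 i j + K3 i j))
      = scalar (c\<^sup>2) i j - (hermitian_square I K i j)"
      using c by (simp add: scaleR_right_diff_distrib scaleR_right_distrib power2_eq_square scaleR_double)
  qed
qed

text \<open>With \<open>K = X X\<^sup>*\<close>, the pullback \<open>X (r - X\<^sup>*X) X\<^sup>* = r K - K\<^sup>2\<close> and the square \<open>(r - K)\<^sup>2\<close> add up to \<open>r (r - K)\<close>.\<close>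

lemma mbound_adj:
  fixes X :: "'i \<Rightarrow> 'i \<Rightarrow> 'b::cstar_algebra"
  assumes "mbound I r X" "r > 0" "finite I" shows "mbound I r (\<lambda>i j. star (X j i))"
proof -
  define K where "K i j = (\<Sum>p\<in>I. X i p * star (X j p))" for i j
  have K: "star (K i j) = K j i" for i j by (simp add: K_def star_sum star_mult)
  have "gram I (\<lambda>i j. r *\<^sub>R K i j - (hermitian_square I K i j))"
    using gram_pull_diff[OF assms(1)[unfolded mbound_def] assms(3), of I "\<lambda>i j. star (X j i)"]
    by (simp add: K_def[symmetric])
  from gram_scale[OF gram_add[OF this gram_square_diff[OF assms(3), of K r]], of "1 / r"] K assms(2)
  have "gram I (\<lambda>i j. (1 / r) *\<^sub>R (r *\<^sub>R K i j - (hermitian_square I K i j) +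
               (scalar (r\<^sup>2) i j - (2 * r) *\<^sub>R K i j + (hermitian_square I K i j))))" by simp
  then show ?thesis unfolding mbound_def
  proof (rule gram_cong)
    fix i j :: 'i
    have "scalar (r\<^sup>2) i j = r *\<^sub>R (scalar r i j :: 'b)" by (simp add: scalar_def power2_eq_square)
    then show "(1 / r) *\<^sub>R (r *\<^sub>R K i j - (hermitian_square I K i j) +
               (scalar (r\<^sup>2) i j - (2 * r) *\<^sub>R K i j + (hermitian_square I K i j))) =
         scalar r i j - (\<Sum>k\<in>I. star (star (X i k)) * star (X j k))"
      using assms(2) by (simp add: K_def[symmetric] scaleR_double scaleR_right_diff_distrib)
  qed
qed

lemma mbound_of_mbound_square:
  assumes "mbound I (r\<^sup>2) (\<lambda>i j. hermitian_square I X i j)" "r > 0" "finite I"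
  shows "mbound I r X"
  unfolding mbound_def
  by (rule gram_of_mbound_herm) (use assms in \<open>auto simp: star_sum star_mult\<close>)

text \<open>The difference of \<open>(1 + c) X\<^sup>*X + (1 + 1/c) Y\<^sup>*Y\<close> and \<open>(X + Y)\<^sup>*(X + Y)\<close> is \<open>(c X - Y)\<^sup>*(c X - Y) / c\<close>. The
choice \<open>c = \<parallel>Y\<parallel> / \<parallel>X\<parallel>\<close> gives the triangle inequality of the norm.\<close>

lemma mbound_triangle:
  assumes "mbound I r X" "mbound I s Y" "c > 0"
  shows "mbound I ((1 + c) * r + (1 + 1 / c) * s) (\<lambda>i j. X i j + Y i j)"
  unfolding mbound_def
proof (rule gram_cong)
  show "gram I (\<lambda>i j. (1 + c) *\<^sub>R (scalar r i j - (hermitian_square I X i j))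
    + (1 + 1 / c) *\<^sub>R (scalar s i j - (hermitian_square I Y i j))
    + (1 / c) *\<^sub>R (\<Sum>k\<in>I. star (c *\<^sub>R X k i - Y k i) * (c *\<^sub>R X k j - Y k j)))"
    using assms unfolding mbound_def by (intro gram_add gram_scale gram_sum gram_row) auto
  fix i j
  have e: "(1 + c) *\<^sub>R (star (X k i) * X k j) + (1 + 1 / c) *\<^sub>R (star (Y k i) * Y k j)
    - (1 / c) *\<^sub>R (star (c *\<^sub>R X k i - Y k i) * (c *\<^sub>R X k j - Y k j)) =
    star (X k i + Y k i) * (X k j + Y k j)" for k
    using assms(3) by (simp add: star_diff star_add star_scaleR algebra_simps)
  have "(\<Sum>k\<in>I. star (X k i + Y k i) * (X k j + Y k j)) =
    (1 + c) *\<^sub>R (hermitian_square I X i j) + (1 + 1 / c) *\<^sub>R (hermitian_square I Y i j)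
    - (1 / c) *\<^sub>R (\<Sum>k\<in>I. star (c *\<^sub>R X k i - Y k i) * (c *\<^sub>R X k j - Y k j))"
    unfolding e[symmetric] by (simp only: sum_subtractf sum.distrib scaleR_sum_right)
  moreover have "scalar ((1 + c) * r + (1 + 1 / c) * s) i j = (1 + c) *\<^sub>R scalar r i j + (1 + 1 / c) *\<^sub>R (scalar s i j :: 'b)"
    by (simp only: scalar_def scaleR_left_distrib[of "(1 + c) * r"] scaleR_scaleR[symmetric] split: if_splits) simp
  ultimately show "(1 + c) *\<^sub>R (scalar r i j - (hermitian_square I X i j))
    + (1 + 1 / c) *\<^sub>R (scalar s i j - (hermitian_square I Y i j))
    + (1 / c) *\<^sub>R (\<Sum>k\<in>I. star (c *\<^sub>R X k i - Y k i) * (c *\<^sub>R X k j - Y k j)) =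
    scalar ((1 + c) * r + (1 + 1 / c) * s) i j - (\<Sum>k\<in>I. star (X k i + Y k i) * (X k j + Y k j))"
    by (simp only: scaleR_right_diff_distrib) (simp only: diff_add_eq add_diff_eq diff_diff_eq2 diff_diff_eq add.assoc)
qed

text \<open>The diagonal entry \<open>j\<close> of the certificate writes \<open>r - X\<^sub>i\<^sub>j\<^sup>*X\<^sub>i\<^sub>j\<close> as a sum of hermitian squares.\<close>

lemma norm_entry_le_of_mbound:
  assumes "mbound I r X" "r \<ge> 0" "i \<in> I" "j \<in> I" "finite I"
  shows "(norm (X i j))\<^sup>2 \<le> r"
proof (rule norm_le_of_complement_pos)
  have "pos (scalar r j j - (\<Sum>k\<in>I. star (X k j) * X k j))"
    using gram_diag_pos[OF assms(1)[unfolded mbound_def] assms(4)] by simp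
  then show "pos ((scalar r j j - (\<Sum>k\<in>I. star (X k j) * X k j)) + (\<Sum>k\<in>I - {i}. star (X k j) * X k j))"
    by (intro pos_add pos_sum pos_star_mult_self)
  show "star (X i j) * X i j + ((scalar r j j - (\<Sum>k\<in>I. star (X k j) * X k j)) + (\<Sum>k\<in>I - {i}. star (X k j) * X k j)) = r *\<^sub>R 1"
    using assms by (simp add: sum.remove[of I i] scalar_def)
qed (use assms in auto)

lemma mbound_single:
  assumes "(norm x)\<^sup>2 < r" "finite I" "a \<in> I"
  shows "mbound I r (\<lambda>i j. if i = a \<and> j = b then x else 0)"
proof -
  obtain s where s: "star x * x + star s * s = r *\<^sub>R 1" using complement_square[OF assms(1)] .
  have r: "r > 0" using assms(1) zero_le_power2 le_less_trans by blast
  show ?thesis unfolding mbound_def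
  proof (rule gram_cong)
    show "gram I (\<lambda>i j. star (if i = b then s else 0) * (if j = b then s else 0) +
       (\<Sum>k\<in>I - {b}. star (scalar (sqrt r) k i) * scalar (sqrt r) k j))"
      by (intro gram_add gram_row gram_sum)
    fix i j assume ij: "i \<in> I" "j \<in> I"
    have "(\<Sum>k\<in>I - {b}. star (scalar (sqrt r) k i) * scalar (sqrt r) k j) = (\<Sum>k\<in>I - {b}. if k = i then (scalar r i j :: 'a) else 0)"
      using r by (intro sum.cong) (auto simp: scalar_def star_scaleR)
    also have "\<dots> = (if i = b then 0 else scalar r i j)" using ij assms by simp
    finally have 1: "(\<Sum>k\<in>I - {b}. star (scalar (sqrt r) k i) * scalar (sqrt r) k j) = (if i = b then 0 else (scalar r i j :: 'a))" .
    have "(\<Sum>k\<in>I. star (if k = a \<and> i = b then x else 0) * (if k = a \<and> j = b then x else 0)) =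
        (\<Sum>k\<in>I. if k = a then (if i = b \<and> j = b then star x * x else 0) else 0)" by (intro sum.cong) auto
    then have 2: "(\<Sum>k\<in>I. star (if k = a \<and> i = b then x else 0) * (if k = a \<and> j = b then x else 0)) =
        (if i = b \<and> j = b then star x * x else 0)" using assms by simp
    show "star (if i = b then s else 0) * (if j = b then s else 0) +
       (\<Sum>k\<in>I - {b}. star (scalar (sqrt r) k i) * scalar (sqrt r) k j) =
       scalar r i j - (\<Sum>k\<in>I. star (if k = a \<and> i = b then x else 0) * (if k = a \<and> j = b then x else 0))"
      unfolding 1 2 using s by (auto simp: scalar_def algebra_simps)
  qed
qed

text \<open>The C*-norm of matrices over \<open>I\<close>. Excluding \<open>r = 0\<close> does not change the infimum and allows
division by \<open>r\<close>.\<close>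

definition mnorm :: "'i set \<Rightarrow> ('i \<Rightarrow> 'i \<Rightarrow> 'a::cstar_algebra) \<Rightarrow> real" where
  "mnorm I X = Inf {r. r > 0 \<and> mbound I (r\<^sup>2) X}"

lemma mnorm_le: assumes "r \<ge> 0" "\<And>s. s > r \<Longrightarrow> mbound I (s\<^sup>2) X" shows "mnorm I X \<le> r"
proof (rule field_le_epsilon)
  fix e :: real assume "e > 0"
  then show "mnorm I X \<le> r + e" unfolding mnorm_def
    using assms by (intro cInf_lower) (auto intro!: bdd_belowI[of _ 0])
qed

lemma mnorm_le_of_mbound: "s > 0 \<Longrightarrow> mbound I (s\<^sup>2) X \<Longrightarrow> mnorm I X \<le> s"
  unfolding mnorm_def by (rule cInf_lower) (auto intro: bdd_belowI[of _ 0])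

lemma mbound_add:
  assumes "mbound I (a\<^sup>2) X" "mbound I (b\<^sup>2) Y" "a > 0" "b > 0"
  shows "mbound I ((a + b)\<^sup>2) (\<lambda>i j. X i j + Y i j)"
proof -
  have "(1 + b / a) * a\<^sup>2 + (1 + 1 / (b / a)) * b\<^sup>2 = (a + b)\<^sup>2"
    using assms by (simp add: field_simps power2_eq_square)
  with mbound_triangle[OF assms(1,2), of "b / a"] assms show ?thesis by simp
qed

lemma mbound_sum:
  assumes "finite K" "finite I" "\<And>k. k \<in> K \<Longrightarrow> c k \<ge> 0" "\<And>k s. k \<in> K \<Longrightarrow> s > c k \<Longrightarrow> mbound I (s\<^sup>2) (X k)" "s > sum c K"
  shows "mbound I (s\<^sup>2) (\<lambda>i j. \<Sum>k\<in>K. X k i j)"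
  using assms(1,3,4,5)
proof (induction K arbitrary: s rule: finite_induct)
  case empty then show ?case using assms by (auto intro: mbound_zero)
next
  case (insert k K)
  define e where "e = (s - sum c (insert k K)) / 2"
  have e: "e > 0" using insert by (simp add: e_def)
  have "mbound I ((c k + e)\<^sup>2) (X k)" using insert.prems e by auto
  moreover have "mbound I ((sum c K + e)\<^sup>2) (\<lambda>i j. \<Sum>k\<in>K. X k i j)"
    using insert.prems e by (intro insert.IH) auto
  moreover have "c k + e > 0" "sum c K + e > 0" using insert e by (auto intro!: add_nonneg_pos sum_nonneg)
  ultimately have "mbound I ((c k + e + (sum c K + e))\<^sup>2) (\<lambda>i j. X k i j + (\<Sum>k\<in>K. X k i j))"
    by (intro mbound_add)
  moreover have "c k + e + (sum c K + e) = s" using insert by (simp add: e_def field_simps)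
  ultimately show ?case using insert by simp
qed

lemma mbound_entries:
  assumes "finite I" "s > (\<Sum>(a,b)\<in>I \<times> I. norm (X a b))"
  shows "mbound I (s\<^sup>2) X"
proof (rule mbound_cong)
  show "mbound I (s\<^sup>2) (\<lambda>i j. \<Sum>ab\<in>I \<times> I. if i = fst ab \<and> j = snd ab then X (fst ab) (snd ab) else 0)"
  proof (rule mbound_sum[where c = "\<lambda>ab. norm (X (fst ab) (snd ab))"])
    fix ab :: "'a \<times> 'a" and s :: real assume "ab \<in> I \<times> I" "norm (X (fst ab) (snd ab)) < s"
    then show "mbound I (s\<^sup>2) (\<lambda>i j. if i = fst ab \<and> j = snd ab then X (fst ab) (snd ab) else 0)"
      using assms by (intro mbound_single power_strict_mono) auto
  qed (use assms in \<open>auto simp: case_prod_beta\<close>)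
  fix i j assume "i \<in> I" "j \<in> I"
  have "(\<Sum>ab\<in>I \<times> I. if i = fst ab \<and> j = snd ab then X (fst ab) (snd ab) else 0) = (\<Sum>ab\<in>I \<times> I. if ab = (i, j) then X i j else 0)"
    by (intro sum.cong) auto
  then show "(\<Sum>ab\<in>I \<times> I. if i = fst ab \<and> j = snd ab then X (fst ab) (snd ab) else 0) = X i j"
    using \<open>i \<in> I\<close> \<open>j \<in> I\<close> assms by simp
qed

lemma mnorm_le_entries: "finite I \<Longrightarrow> mnorm I X \<le> (\<Sum>(a,b)\<in>I \<times> I. norm (X a b))"
  by (rule mnorm_le) (auto intro!: sum_nonneg mbound_entries)

lemma mbound_nonempty: assumes "finite I" shows "{r. r > 0 \<and> mbound I (r\<^sup>2) X} \<noteq> {}"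
proof -
  define s where "s = (\<Sum>(a,b)\<in>I \<times> I. norm (X a b)) + 1"
  have "s > 0" unfolding s_def by (intro add_nonneg_pos sum_nonneg) auto
  moreover have "mbound I (s\<^sup>2) X" using assms by (intro mbound_entries) (auto simp: s_def)
  ultimately show ?thesis by blast
qed

lemma mnorm_nonneg: "finite I \<Longrightarrow> mnorm I X \<ge> 0"
  unfolding mnorm_def using mbound_nonempty by (intro cInf_greatest) auto

lemma mbound_of_mnorm_less: assumes "mnorm I X < r" "finite I" shows "mbound I (r\<^sup>2) X"
proof -
  obtain s where "s < r" "s > 0" "mbound I (s\<^sup>2) X"
    using assms cInf_lessD[OF mbound_nonempty[OF assms(2)]] unfolding mnorm_def by auto
  then show ?thesis using assms by (elim mbound_mono) (auto intro!: power_mono)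
qed

lemma mnorm_cong: "(\<And>i j. i \<in> I \<Longrightarrow> j \<in> I \<Longrightarrow> X i j = Y i j) \<Longrightarrow> mnorm I X = mnorm I Y"
  unfolding mnorm_def using mbound_cong[of I _ X Y] mbound_cong[of I _ Y X] by metis

lemma norm_entry_le_mnorm:
  assumes "finite I" "i \<in> I" "j \<in> I" shows "norm (X i j) \<le> mnorm I X"
proof (rule dense_ge)
  fix s assume s: "mnorm I X < s"
  then have "s \<ge> 0" using mnorm_nonneg assms by (meson le_less_trans less_imp_le)
  moreover have "(norm (X i j))\<^sup>2 \<le> s\<^sup>2"
    using mbound_of_mnorm_less[OF s] assms by (intro norm_entry_le_of_mbound) auto
  ultimately show "norm (X i j) \<le> s" using power2_le_imp_le by blast
qed

lemma mnorm_triangle: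
  assumes "finite I" shows "mnorm I (\<lambda>i j. X i j + Y i j) \<le> mnorm I X + mnorm I Y"
proof (rule mnorm_le)
  show "0 \<le> mnorm I X + mnorm I Y" using mnorm_nonneg[OF assms] by (intro add_nonneg_nonneg)
  fix s assume "s > mnorm I X + mnorm I Y"
  define e where "e = (s - mnorm I X - mnorm I Y) / 2"
  have e: "e > 0" using \<open>s > _\<close> by (simp add: e_def)
  have "mbound I ((mnorm I X + e + (mnorm I Y + e))\<^sup>2) (\<lambda>i j. X i j + Y i j)"
    using e mnorm_nonneg[OF assms] by (intro mbound_add mbound_of_mnorm_less assms add_nonneg_pos) auto
  moreover have "mnorm I X + e + (mnorm I Y + e) = s" by (simp add: e_def field_simps)
  ultimately show "mbound I (s\<^sup>2) (\<lambda>i j. X i j + Y i j)" by simp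
qed

lemma mnorm_mult:
  assumes "finite I" shows "mnorm I (\<lambda>i j. \<Sum>k\<in>I. X i k * Y k j) \<le> mnorm I X * mnorm I Y"
proof -
  have *: "mnorm I (\<lambda>i j. \<Sum>k\<in>I. X i k * Y k j) \<le> a * b" if "a > mnorm I X" "b > mnorm I Y" for a b
  proof -
    have ab: "a > 0" "b > 0" using that mnorm_nonneg[OF assms] le_less_trans by blast+
    have "mbound I (a\<^sup>2 * b\<^sup>2) (\<lambda>i j. \<Sum>k\<in>I. X i k * Y k j)"
      using that assms by (intro mbound_mult mbound_of_mnorm_less) auto
    then have m: "mbound I ((a * b)\<^sup>2) (\<lambda>i j. \<Sum>k\<in>I. X i k * Y k j)" by (simp add: power_mult_distrib)
    show ?thesis
    proof (rule mnorm_le)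
      fix s assume "s > a * b"
      then have "(a * b)\<^sup>2 \<le> s\<^sup>2" using ab by (intro power_mono) auto
      then show "mbound I (s\<^sup>2) (\<lambda>i j. \<Sum>k\<in>I. X i k * Y k j)" using m assms by (intro mbound_mono[OF m])
    qed (use ab in simp)
  qed
  have "(\<lambda>n. (mnorm I X + inverse (real (Suc n))) * (mnorm I Y + inverse (real (Suc n)))) \<longlonglongrightarrow> (mnorm I X + 0) * (mnorm I Y + 0)"
    by (intro tendsto_intros LIMSEQ_inverse_real_of_nat)
  then have "mnorm I (\<lambda>i j. \<Sum>k\<in>I. X i k * Y k j) \<le> (mnorm I X + 0) * (mnorm I Y + 0)"
    by (rule LIMSEQ_le_const) (intro exI[of _ 0] allI impI *, simp_all)
  then show ?thesis by simp
qed

lemma mnorm_adj_le: assumes "finite I" shows "mnorm I (\<lambda>i j. star (X j i)) \<le> mnorm I X"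
proof (rule mnorm_le)
  fix s assume s: "s > mnorm I X"
  then have "s > 0" using mnorm_nonneg[OF assms] le_less_trans by blast
  then show "mbound I (s\<^sup>2) (\<lambda>i j. star (X j i))"
    using mbound_of_mnorm_less[OF s assms] assms by (intro mbound_adj) auto
qed (use mnorm_nonneg assms in auto)

lemma mnorm_cstar:
  assumes "finite I" shows "mnorm I (\<lambda>i j. hermitian_square I X i j) = (mnorm I X)\<^sup>2"
proof (rule antisym)
  have "mnorm I (\<lambda>i j. hermitian_square I X i j) \<le> mnorm I (\<lambda>i j. star (X j i)) * mnorm I X"
    by (rule mnorm_mult[OF assms])
  also have "\<dots> \<le> mnorm I X * mnorm I X"
    using assms by (intro mult_right_mono mnorm_adj_le mnorm_nonneg)
  finally show "mnorm I (\<lambda>i j. hermitian_square I X i j) \<le> (mnorm I X)\<^sup>2" by (simp add: power2_eq_square)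
  let ?h = "mnorm I (\<lambda>i j. hermitian_square I X i j)"
  have "mnorm I X \<le> sqrt ?h"
  proof (rule mnorm_le)
    fix s assume s: "s > sqrt ?h"
    have h: "?h \<ge> 0" using assms by (rule mnorm_nonneg)
    have s0: "s > 0" using s h by (meson le_less_trans real_sqrt_ge_zero)
    have "(sqrt ?h)\<^sup>2 < s\<^sup>2" using s h by (intro power_strict_mono) auto
    then have "?h < s\<^sup>2" using h by simp
    then have "mbound I ((s\<^sup>2)\<^sup>2) (\<lambda>i j. hermitian_square I X i j)" by (rule mbound_of_mnorm_less[OF _ assms])
    then show "mbound I (s\<^sup>2) X" by (rule mbound_of_mbound_square) (use s0 assms in simp_all)
  qed (simp add: mnorm_nonneg assms)
  then have "(mnorm I X)\<^sup>2 \<le> (sqrt ?h)\<^sup>2" using mnorm_nonneg[OF assms] by (intro power_mono) auto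
  then show "(mnorm I X)\<^sup>2 \<le> ?h"
    using mnorm_nonneg[OF assms, of "\<lambda>i j. \<Sum>k\<in>I. star (X k i) * X k j"] by (simp only: real_sqrt_pow2)
qed

lemma mnorm_scale_le: assumes "finite I" shows "mnorm I (\<lambda>i j. cplx c * X i j) \<le> cmod c * mnorm I X"
proof (cases "c = 0")
  case True
  have "mnorm I (\<lambda>i j. 0 :: 'b) \<le> 0" by (rule mnorm_le) (auto intro: mbound_zero[OF assms])
  with True show ?thesis by simp
next
  case False
  show ?thesis
  proof (rule mnorm_le)
    show "cmod c * mnorm I X \<ge> 0" by (intro mult_nonneg_nonneg mnorm_nonneg assms norm_ge_zero)
    fix s assume s: "s > cmod c * mnorm I X"
    then have "mnorm I X < s / cmod c" using False by (simp add: pos_less_divide_eq mult.commute)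
    then have "mbound I ((s / cmod c)\<^sup>2) X" using assms by (intro mbound_of_mnorm_less)
    then have "gram I (\<lambda>i j. (cmod c)\<^sup>2 *\<^sub>R (scalar ((s / cmod c)\<^sup>2) i j - (hermitian_square I X i j)))"
      unfolding mbound_def by (intro gram_scale) auto
    then show "mbound I (s\<^sup>2) (\<lambda>i j. cplx c * X i j)" unfolding mbound_def
    proof (rule gram_cong)
      fix i j
      show "(cmod c)\<^sup>2 *\<^sub>R (scalar ((s / cmod c)\<^sup>2) i j - (hermitian_square I X i j)) =
        scalar (s\<^sup>2) i j - (\<Sum>k\<in>I. star (cplx c * X k i) * (cplx c * X k j))"
        using False by (simp add: scaleR_right_diff_distrib scaleR_sum_right scalar_def power_divide star_cplx_mult)
    qed
  qed
qed

lemma mnorm_scale: assumes "finite I" shows "mnorm I (\<lambda>i j. cplx c * X i j) = cmod c * mnorm I X"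
proof (cases "c = 0")
  case True
  then show ?thesis using mnorm_scale_le[OF assms, of 0 X] mnorm_nonneg[OF assms, of "\<lambda>i j. cplx 0 * X i j"] by simp
next
  case False
  have "mnorm I X = mnorm I (\<lambda>i j. cplx (1 / c) * (cplx c * X i j))"
    using False by (simp add: mult.assoc[symmetric] cplx_mult[symmetric])
  also have "\<dots> \<le> cmod (1 / c) * mnorm I (\<lambda>i j. cplx c * X i j)" by (rule mnorm_scale_le[OF assms])
  finally have "cmod c * mnorm I X \<le> mnorm I (\<lambda>i j. cplx c * X i j)"
    using False by (simp add: norm_divide pos_le_divide_eq mult.commute)
  with mnorm_scale_le[OF assms, of c X] show ?thesis by simp
qed

lemma gram_reindex:
  assumes "inj_on f I" shows "gram (f ` I) H \<longleftrightarrow> gram I (\<lambda>i j. H (f i) (f j))"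
proof
  assume "gram (f ` I) H"
  then obtain m :: nat and s where s: "\<And>i j. i \<in> f ` I \<Longrightarrow> j \<in> f ` I \<Longrightarrow> H i j = (\<Sum>k<m. star (s k i) * s k j)"
    by (rule gramE) (rule that)
  show "gram I (\<lambda>i j. H (f i) (f j))" unfolding gram_def
    by (intro exI[of _ m] exI[of _ "\<lambda>k i. s k (f i)"]) (simp add: s)
next
  assume "gram I (\<lambda>i j. H (f i) (f j))"
  then obtain m :: nat and s where s: "\<And>i j. i \<in> I \<Longrightarrow> j \<in> I \<Longrightarrow> H (f i) (f j) = (\<Sum>k<m. star (s k i) * s k j)"
    by (rule gramE) (rule that)
  show "gram (f ` I) H" unfolding gram_def
    by (intro exI[of _ m] exI[of _ "\<lambda>k i. s k (inv_into I f i)"]) (simp add: s assms)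
qed

lemma mnorm_reindex:
  assumes "inj_on f I" shows "mnorm (f ` I) X = mnorm I (\<lambda>i j. X (f i) (f j))"
proof -
  have "mbound (f ` I) r X \<longleftrightarrow> mbound I r (\<lambda>i j. X (f i) (f j))" for r
  proof -
    have 1: "(\<Sum>k\<in>f ` I. star (X k i) * X k j) = (\<Sum>k\<in>I. star (X (f k) i) * X (f k) j)" for i j
      using assms by (simp add: sum.reindex)
    have 2: "scalar r (f i) (f j) = (scalar r i j :: 'c)" if "i \<in> I" "j \<in> I" for i j
      using assms that by (auto simp: scalar_def inj_on_def)
    show ?thesis unfolding mbound_def gram_reindex[OF assms] 1
      using gram_cong[of I _ "\<lambda>i j. scalar r i j - (\<Sum>k\<in>I. star (X (f k) (f i)) * X (f k) (f j))"]
        gram_cong[of I "\<lambda>i j. scalar r i j - (\<Sum>k\<in>I. star (X (f k) (f i)) * X (f k) (f j))"] 2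
      by fastforce
  qed
  then show ?thesis by (simp add: mnorm_def)
qed

section \<open>The product of all C*-algebras on a type\<close>

context unital_star_algebra begin

lemma smult_zero_left: assumes "x \<in> carrier A" shows "0 \<odot> x = \<zero>"
proof -
  have c: "0 \<odot> x \<in> carrier A" using assms by (rule smult_closed)
  show ?thesis using smult_l_distr[OF assms, of 0 0] add.l_cancel_one[OF c c] by simp
qed

lemma smult_minus_one: assumes "x \<in> carrier A" shows "(- 1) \<odot> x = \<ominus> x"
proof -
  have "(- 1) \<odot> x \<oplus> x = \<zero>"
    using smult_l_distr[OF assms, of "- 1" 1] smult_1[OF assms] smult_zero_left[OF assms] by simp
  then show ?thesis using assms by (simp add: smult_closed minus_equality)
qed

lemma adj_zero: "adj A \<zero> = \<zero>"
proof -
  have c: "adj A \<zero> \<in> carrier A" by (simp add: adj_closed)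
  show ?thesis using adj_add[of \<zero> \<zero>] add.l_cancel_one[OF c c] by simp
qed

lemma adj_one: "adj A \<one> = \<one>"
proof -
  have "adj A \<one> = adj A (adj A (adj A \<one>) \<otimes> adj A \<one>)"
    using adj_mult[of "adj A \<one>" \<one>] by (simp add: adj_closed adj_adj)
  also have "\<dots> = \<one>" by (simp add: adj_closed adj_adj)
  finally show ?thesis .
qed

lemma smult_zero_right: "c \<odot> \<zero> = \<zero>"
proof -
  have c: "c \<odot> \<zero> \<in> carrier A" by (simp add: smult_closed)
  show ?thesis using smult_r_distr[of \<zero> \<zero> c] add.l_cancel_one[OF c c] by simp
qed

end

context cstar_norm begin

lemma norm_minus: "x \<in> carrier A \<Longrightarrow> N (\<ominus> x) = N x"
  using norm_smult[of x "-1"] smult_minus_one[of x] by simp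

lemma norm_adj_le: assumes "x \<in> carrier A" shows "N (adj A x) \<le> N x"
proof (cases "N (adj A x) = 0")
  case False
  have x: "adj A x \<in> carrier A" using assms by (rule adj_closed)
  have "(N (adj A x))\<^sup>2 \<le> N x * N (adj A x)"
    using norm_cstar[OF x] norm_mult[OF assms x] by (simp add: adj_adj assms)
  moreover have "N (adj A x) > 0" using False norm_nonneg[OF x] by simp
  ultimately show ?thesis by (simp add: power2_eq_square)
qed (use norm_nonneg assms in simp)

lemma norm_one_le_1: "N \<one> \<le> 1"
proof -
  have "N \<one> = (N \<one>)\<^sup>2" using norm_cstar[of \<one>] by (simp add: adj_one)
  then have "N \<one> = 0 \<or> N \<one> = 1" by (simp add: power2_eq_square)
  then show ?thesis by auto
qed

end

text \<open>A C*-algebra with an explicit carrier is not a type, and a type cannot depend on it. However, all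
C*-algebras with elements in \<open>'a\<close> have a bounded product, whose elements are the bounded families
with one component for each algebra, and that product is a type.\<close>

type_synonym ('a, 'b) normed_pair = "('a, 'b) star_algebra_scheme \<times> ('a \<Rightarrow> real)"

abbreviation is_cstar :: "('a, 'b) normed_pair \<Rightarrow> bool" where
  "is_cstar p \<equiv> cstar_norm (fst p) (snd p)"

definition bounded_family :: "(('a, 'b) normed_pair \<Rightarrow> 'a) \<Rightarrow> bool" where
  "bounded_family f \<longleftrightarrow> (\<forall>p. is_cstar p \<longrightarrow> f p \<in> carrier (fst p)) \<and>
     (\<exists>B. \<forall>p. is_cstar p \<longrightarrow> snd p (f p) \<le> B)"

lemma bounded_familyI:
  "(\<And>p. is_cstar p \<Longrightarrow> f p \<in> carrier (fst p)) \<Longrightarrow> (\<And>p. is_cstar p \<Longrightarrow> snd p (f p) \<le> B) \<Longrightarrow> bounded_family f"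
  unfolding bounded_family_def by (intro conjI allI impI exI)

lemma is_cstar_algebra [simp]: "is_cstar p \<Longrightarrow> unital_star_algebra (fst p)"
  and is_cstar_ring [simp]: "is_cstar p \<Longrightarrow> ring (fst p)"
  by (simp_all add: cstar_norm.axioms(1) unital_star_algebra.axioms(1))

lemmas ring_rules = ring.ring_simprules monoid.r_one[OF ring.is_monoid]

lemma is_cstar_zero: assumes "is_cstar p" shows "snd p \<zero>\<^bsub>fst p\<^esub> = 0" "\<zero>\<^bsub>fst p\<^esub> \<in> carrier (fst p)"
proof -
  interpret cstar_norm "fst p" "snd p" by fact
  show "snd p \<zero>\<^bsub>fst p\<^esub> = 0" by (subst norm_eq_0_iff) auto
  show "\<zero>\<^bsub>fst p\<^esub> \<in> carrier (fst p)" by simp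
qed

text \<open>Components at indices that are not C*-algebras are fixed, so that equality is equality of the others.\<close>

typedef ('a, 'b) cstar_product =
  "{f :: ('a, 'b) normed_pair \<Rightarrow> 'a. bounded_family f \<and> (\<forall>p. \<not> is_cstar p \<longrightarrow> f p = undefined)}"
proof -
  have "bounded_family (\<lambda>p. if is_cstar p then \<zero>\<^bsub>fst p\<^esub> else undefined)"
    by (rule bounded_familyI[where B = 0]) (simp_all add: is_cstar_zero)
  then show ?thesis by (intro exI[of _ "\<lambda>p. if is_cstar p then \<zero>\<^bsub>fst p\<^esub> else undefined"]) simp
qed

text \<open>Evaluation of a family at one of its indices.\<close>

definition ev :: "('a, 'b) normed_pair \<Rightarrow> ('a, 'b) cstar_product \<Rightarrow> 'a" where
  "ev p X = Rep_cstar_product X p"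

definition family :: "(('a, 'b) normed_pair \<Rightarrow> 'a) \<Rightarrow> ('a, 'b) cstar_product" where
  "family f = Abs_cstar_product (\<lambda>p. if is_cstar p then f p else undefined)"

lemma ev_family: assumes "bounded_family f" "is_cstar p" shows "ev p (family f) = f p"
proof -
  have "bounded_family (\<lambda>p. if is_cstar p then f p else undefined)"
    using assms(1) unfolding bounded_family_def by simp
  then show ?thesis unfolding ev_def family_def
    by (subst Abs_cstar_product_inverse) (use assms in auto)
qed

lemma bounded_family_ev: "bounded_family (\<lambda>p. ev p X)"
  using Rep_cstar_product[of X] by (simp add: ev_def)

lemma ev_closed: "is_cstar p \<Longrightarrow> ev p X \<in> carrier (fst p)"
  by (rule bounded_family_ev[of X, unfolded bounded_family_def, THEN conjunct1, rule_format])

lemma cstar_product_eqI: assumes "\<And>p. is_cstar p \<Longrightarrow> ev p X = ev p Y" shows "X = Y"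
proof -
  have "Rep_cstar_product X p = Rep_cstar_product Y p" for p
    using assms[of p] Rep_cstar_product[of X] Rep_cstar_product[of Y] by (cases "is_cstar p") (simp_all add: ev_def del: split_paired_All)
  then show ?thesis by (metis Rep_cstar_product_inject ext)
qed

lemma ev_bounded: obtains B where "B \<ge> 0" "\<And>p. is_cstar p \<Longrightarrow> snd p (ev p X) \<le> B"
proof -
  obtain B where "\<And>p. is_cstar p \<Longrightarrow> snd p (ev p X) \<le> B"
    using bounded_family_ev[of X] unfolding bounded_family_def by blast
  then show ?thesis by (intro that[of "max B 0"]) (auto simp: le_max_iff_disj)
qed

instantiation cstar_product :: (type, type) ab_group_add begin

definition "0 = family (\<lambda>p. \<zero>\<^bsub>fst p\<^esub>)"
definition "X + Y = family (\<lambda>p. ev p X \<oplus>\<^bsub>fst p\<^esub> ev p Y)"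
definition "- X = family (\<lambda>p. \<ominus>\<^bsub>fst p\<^esub> ev p X)"
definition "X - Y = X + - (Y :: ('a, 'b) cstar_product)"

lemma ev_zero: "is_cstar p \<Longrightarrow> ev p 0 = \<zero>\<^bsub>fst p\<^esub>"
  unfolding zero_cstar_product_def
  by (rule ev_family, rule bounded_familyI[where B = 0]) (simp_all add: is_cstar_zero)

lemma ev_plus: assumes "is_cstar p" shows "ev p (X + Y) = ev p X \<oplus>\<^bsub>fst p\<^esub> ev p Y"
  unfolding plus_cstar_product_def
proof (rule ev_family[OF _ assms])
  obtain B C where B: "\<And>p. is_cstar p \<Longrightarrow> snd p (ev p X) \<le> B" and C: "\<And>p. is_cstar p \<Longrightarrow> snd p (ev p Y) \<le> C"
    using ev_bounded[of X] ev_bounded[of Y] by metis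
  show "bounded_family (\<lambda>p. ev p X \<oplus>\<^bsub>fst p\<^esub> ev p Y)"
    by (rule bounded_familyI[where B = "B + C"], simp add: ev_closed ring.ring_simprules(1),
        rule order_trans[OF cstar_norm.norm_triangle], simp_all add: ev_closed B C add_mono)
qed

lemma ev_uminus: assumes "is_cstar p" shows "ev p (- X) = \<ominus>\<^bsub>fst p\<^esub> ev p X"
  unfolding uminus_cstar_product_def
proof (rule ev_family[OF _ assms])
  obtain B where B: "\<And>p. is_cstar p \<Longrightarrow> snd p (ev p X) \<le> B" using ev_bounded[of X] by metis
  show "bounded_family (\<lambda>p. \<ominus>\<^bsub>fst p\<^esub> ev p X)"
    by (rule bounded_familyI[where B = B])
      (simp_all add: ev_closed ring.ring_simprules(3) cstar_norm.norm_minus B)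
qed

instance
proof
  fix X Y Z :: "('a, 'b) cstar_product"
  show "X + Y + Z = X + (Y + Z)"
    by (rule cstar_product_eqI)
      (simp add: ev_plus ev_closed ring_rules)
  show "X + Y = Y + X"
    by (rule cstar_product_eqI)
      (simp add: ev_plus ev_closed ring_rules)
  show "0 + X = X"
    by (rule cstar_product_eqI)
      (simp add: ev_plus ev_closed ev_zero ring_rules)
  show "- X + X = 0"
    by (rule cstar_product_eqI)
      (simp add: ev_plus ev_closed ev_zero ev_uminus ring_rules)
  show "X - Y = X + - Y" by (simp add: minus_cstar_product_def)
qed

end

lemma ev_minus: assumes "is_cstar p" shows "ev p (X - Y) = ev p X \<ominus>\<^bsub>fst p\<^esub> ev p Y"
  by (simp only: minus_cstar_product_def ev_plus[OF assms] ev_uminus[OF assms] a_minus_def)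

instantiation cstar_product :: (type, type) real_normed_vector begin

definition "scaleR r X = family (\<lambda>p. complex_of_real r \<odot>\<^bsub>fst p\<^esub> ev p X)"
definition "norm X = Sup (insert 0 {snd p (ev p X) | p. is_cstar p})" for X :: "('a, 'b) cstar_product"
definition "sgn X = inverse (norm X) *\<^sub>R X" for X :: "('a, 'b) cstar_product"
definition "dist X Y = norm (X - Y)" for X Y :: "('a, 'b) cstar_product"
definition [code del]: "(uniformity :: (('a, 'b) cstar_product \<times> ('a, 'b) cstar_product) filter) = (INF e\<in>{0<..}. principal {(x, y). dist x y < e})"
definition [code del]: "open (U :: ('a, 'b) cstar_product set) \<longleftrightarrow> (\<forall>x\<in>U. eventually (\<lambda>(x', y). x' = x \<longrightarrow> y \<in> U) uniformity)"

lemma ev_scaleR: assumes "is_cstar p" shows "ev p (r *\<^sub>R X) = complex_of_real r \<odot>\<^bsub>fst p\<^esub> ev p X"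
  unfolding scaleR_cstar_product_def
proof (rule ev_family[OF _ assms])
  obtain B where B: "\<And>p. is_cstar p \<Longrightarrow> snd p (ev p X) \<le> B" using ev_bounded[of X] by metis
  show "bounded_family (\<lambda>p. complex_of_real r \<odot>\<^bsub>fst p\<^esub> ev p X)"
    by (rule bounded_familyI[where B = "\<bar>r\<bar> * B"])
      (simp_all add: ev_closed unital_star_algebra.smult_closed cstar_norm.norm_smult mult_left_mono B)
qed

lemma bdd_norms: "bdd_above (insert 0 {snd p (ev p X) | p. is_cstar p})"
proof -
  obtain B where "B \<ge> 0" "\<And>p. is_cstar p \<Longrightarrow> snd p (ev p X) \<le> B" by (rule ev_bounded[of X]) (rule that)
  then show ?thesis by (intro bdd_aboveI[of _ B]) auto
qed

lemma norm_ev_le: assumes "is_cstar p" shows "snd p (ev p X) \<le> norm X"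
  unfolding norm_cstar_product_def by (rule cSup_upper[OF _ bdd_norms]) (use assms in auto)

lemma norm_product_nonneg: "norm (X :: ('a, 'b) cstar_product) \<ge> 0"
  unfolding norm_cstar_product_def by (rule cSup_upper[OF _ bdd_norms]) auto

lemma norm_product_le:
  assumes "B \<ge> 0" "\<And>p. is_cstar p \<Longrightarrow> snd p (ev p X) \<le> B" shows "norm X \<le> B"
  unfolding norm_cstar_product_def by (rule cSup_least) (use assms in auto)

instance
proof
  fix X Y :: "('a, 'b) cstar_product" and a b :: real
  show "dist X Y = norm (X - Y)" by (simp add: dist_cstar_product_def)
  show "sgn X = inverse (norm X) *\<^sub>R X" by (simp add: sgn_cstar_product_def)
  show "(uniformity :: (('a, 'b) cstar_product \<times> ('a, 'b) cstar_product) filter) = (INF e\<in>{0<..}. principal {(x, y). dist x y < e})"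
    by (rule uniformity_cstar_product_def)
  show "open U \<longleftrightarrow> (\<forall>x\<in>U. eventually (\<lambda>(x', y). x' = x \<longrightarrow> y \<in> U) uniformity)" for U :: "('a, 'b) cstar_product set"
    by (rule open_cstar_product_def)
  show "a *\<^sub>R (X + Y) = a *\<^sub>R X + a *\<^sub>R Y"
    by (rule cstar_product_eqI)
      (simp add: ev_plus ev_closed ev_scaleR unital_star_algebra.smult_r_distr ring_rules)
  show "(a + b) *\<^sub>R X = a *\<^sub>R X + b *\<^sub>R X"
    by (rule cstar_product_eqI)
      (simp add: ev_plus ev_closed ev_scaleR unital_star_algebra.smult_l_distr ring_rules)
  show "a *\<^sub>R b *\<^sub>R X = (a * b) *\<^sub>R X"
    by (rule cstar_product_eqI)
      (simp add: ev_closed ev_scaleR unital_star_algebra.smult_assoc ring_rules)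
  show "1 *\<^sub>R X = X"
    by (rule cstar_product_eqI)
      (simp add: ev_closed ev_scaleR unital_star_algebra.smult_1 ring_rules)
  show "norm X = 0 \<longleftrightarrow> X = 0"
  proof
    assume n: "norm X = 0"
    show "X = 0"
    proof (rule cstar_product_eqI)
      fix p :: "('a, 'b) normed_pair" assume p: "is_cstar p"
      then interpret cstar_norm "fst p" "snd p" .
      have "snd p (ev p X) = 0" using norm_ev_le[OF p, of X] n norm_nonneg[OF ev_closed[OF p, of X]] by simp
      then show "ev p X = ev p 0" using p ev_closed[OF p] by (simp add: norm_eq_0_iff ev_zero)
    qed
  next
    assume "X = 0"
    then have "norm X \<le> 0" by (intro norm_product_le) (simp_all add: ev_zero is_cstar_zero)
    then show "norm X = 0" using norm_product_nonneg[of X] by simp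
  qed
  show "norm (X + Y) \<le> norm X + norm Y"
  proof (rule norm_product_le)
    fix p :: "('a, 'b) normed_pair" assume p: "is_cstar p"
    then interpret cstar_norm "fst p" "snd p" .
    have "snd p (ev p (X + Y)) \<le> snd p (ev p X) + snd p (ev p Y)" using p by (simp add: ev_plus norm_triangle ev_closed)
    also have "\<dots> \<le> norm X + norm Y" by (intro add_mono norm_ev_le p)
    finally show "snd p (ev p (X + Y)) \<le> norm X + norm Y" .
  qed (simp add: norm_product_nonneg)
  have le: "norm (c *\<^sub>R Z) \<le> \<bar>c\<bar> * norm Z" for c and Z :: "('a, 'b) cstar_product"
  proof (rule norm_product_le)
    fix p :: "('a, 'b) normed_pair" assume p: "is_cstar p"
    then interpret cstar_norm "fst p" "snd p" .
    show "snd p (ev p (c *\<^sub>R Z)) \<le> \<bar>c\<bar> * norm Z"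
      using p by (simp add: ev_scaleR norm_smult ev_closed norm_ev_le mult_left_mono)
  qed (simp add: norm_product_nonneg)
  show "norm (a *\<^sub>R X) = \<bar>a\<bar> * norm X"
  proof (cases "a = 0")
    case True
    then show ?thesis using le[of a X] norm_product_nonneg[of "a *\<^sub>R X"] by simp
  next
    case False
    have "X = (1 / a) *\<^sub>R a *\<^sub>R X"
    proof (rule cstar_product_eqI)
      fix p :: "('a, 'b) normed_pair" assume p: "is_cstar p"
      then interpret cstar_norm "fst p" "snd p" .
      show "ev p X = ev p ((1 / a) *\<^sub>R a *\<^sub>R X)"
        using False smult_assoc[OF ev_closed[OF p, of X], of "complex_of_real (1 / a)" "complex_of_real a"]
        by (simp add: ev_closed[OF p] ev_scaleR[OF p] smult_1)
    qed
    then have "norm X \<le> \<bar>1 / a\<bar> * norm (a *\<^sub>R X)" using le[of "1 / a" "a *\<^sub>R X"] by simp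
    then have "\<bar>a\<bar> * norm X \<le> norm (a *\<^sub>R X)" using False by (simp add: abs_divide pos_le_divide_eq mult.commute)
    with le[of a X] show ?thesis by simp
  qed
qed

end

instance cstar_product :: (type, type) banach
proof
  fix X :: "nat \<Rightarrow> ('a, 'b) cstar_product" assume X: "Cauchy X"
  have C: "\<exists>K. \<forall>m\<ge>K. \<forall>n\<ge>K. norm (X m - X n) < e" if "e > 0" for e
    using X that unfolding Cauchy_def dist_norm by blast
  have lim: "\<exists>x\<in>carrier (fst p). norm_converges (fst p) (snd p) (\<lambda>n. ev p (X n)) x" if p: "is_cstar p" for p
  proof -
    interpret cstar_norm "fst p" "snd p" using p .
    show ?thesis
    proof (rule complete)
      show "norm_Cauchy (fst p) (snd p) (\<lambda>n. ev p (X n))" unfolding norm_Cauchy_def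
      proof (intro allI impI)
        fix e :: real assume "e > 0"
        then obtain K where "\<forall>m\<ge>K. \<forall>n\<ge>K. norm (X m - X n) < e" using C by blast
        then show "\<exists>K. \<forall>j\<ge>K. \<forall>k\<ge>K. snd p (ev p (X j) \<ominus>\<^bsub>fst p\<^esub> ev p (X k)) < e"
          using norm_ev_le[OF p] by (metis ev_minus[OF p] le_less_trans)
      qed
    qed (rule ev_closed[OF p])
  qed
  define x where "x p = (SOME y. y \<in> carrier (fst p) \<and> norm_converges (fst p) (snd p) (\<lambda>n. ev p (X n)) y)" for p
  have x: "x p \<in> carrier (fst p)" "norm_converges (fst p) (snd p) (\<lambda>n. ev p (X n)) (x p)" if "is_cstar p" for p
    using someI_ex[of "\<lambda>y. y \<in> carrier (fst p) \<and> norm_converges (fst p) (snd p) (\<lambda>n. ev p (X n)) y"] lim[OF that]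
    unfolding x_def by auto
  have near: "snd p (ev p (X m) \<ominus>\<^bsub>fst p\<^esub> x p) \<le> e"
    if K: "\<forall>m\<ge>K. \<forall>n\<ge>K. norm (X m - X n) < e" and "m \<ge> K" and p: "is_cstar p" for K m e p
  proof -
    interpret cstar_norm "fst p" "snd p" using p .
    have c: "ev p (X k) \<in> carrier (fst p)" for k by (rule ev_closed[OF p])
    have "(\<lambda>n. e + snd p (ev p (X n) \<ominus>\<^bsub>fst p\<^esub> x p)) \<longlonglongrightarrow> e + 0"
      using x(2)[OF p] unfolding norm_converges_def by (intro tendsto_intros)
    moreover have "snd p (ev p (X m) \<ominus>\<^bsub>fst p\<^esub> x p) \<le> e + snd p (ev p (X n) \<ominus>\<^bsub>fst p\<^esub> x p)" if "n \<ge> K" for n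
    proof -
      have "ev p (X m) \<ominus>\<^bsub>fst p\<^esub> x p = (ev p (X m) \<ominus>\<^bsub>fst p\<^esub> ev p (X n)) \<oplus>\<^bsub>fst p\<^esub> (ev p (X n) \<ominus>\<^bsub>fst p\<^esub> x p)"
        using c x(1)[OF p] by (simp add: a_minus_def a_assoc r_neg1 r_neg2)
      then have "snd p (ev p (X m) \<ominus>\<^bsub>fst p\<^esub> x p) \<le> snd p (ev p (X m) \<ominus>\<^bsub>fst p\<^esub> ev p (X n)) + snd p (ev p (X n) \<ominus>\<^bsub>fst p\<^esub> x p)"
        using c x(1)[OF p] by (simp add: norm_triangle)
      moreover have "snd p (ev p (X m) \<ominus>\<^bsub>fst p\<^esub> ev p (X n)) \<le> norm (X m - X n)"
        using norm_ev_le[OF p, of "X m - X n"] by (simp add: ev_minus[OF p])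
      moreover have "norm (X m - X n) < e" using K \<open>m \<ge> K\<close> that by blast
      ultimately show ?thesis by simp
    qed
    ultimately have "snd p (ev p (X m) \<ominus>\<^bsub>fst p\<^esub> x p) \<le> e + 0" by (intro LIMSEQ_le_const) blast+
    then show ?thesis by simp
  qed
  obtain K0 where K0: "\<forall>m\<ge>K0. \<forall>n\<ge>K0. norm (X m - X n) < 1" using C[of 1] by auto
  have bf: "bounded_family x"
  proof (rule bounded_familyI)
    fix p :: "('a, 'b) normed_pair" assume p: "is_cstar p"
    then interpret cstar_norm "fst p" "snd p" .
    show "x p \<in> carrier (fst p)" by (rule x(1)[OF p])
    have c: "ev p (X K0) \<in> carrier (fst p)" by (rule ev_closed[OF p])
    have "x p = ev p (X K0) \<ominus>\<^bsub>fst p\<^esub> (ev p (X K0) \<ominus>\<^bsub>fst p\<^esub> x p)"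
      using c x(1)[OF p] by (simp add: a_minus_def minus_add r_neg1 r_neg2)
    then have "snd p (x p) \<le> snd p (ev p (X K0)) + snd p (\<ominus>\<^bsub>fst p\<^esub> (ev p (X K0) \<ominus>\<^bsub>fst p\<^esub> x p))"
      using norm_triangle[of "ev p (X K0)" "\<ominus>\<^bsub>fst p\<^esub> (ev p (X K0) \<ominus>\<^bsub>fst p\<^esub> x p)"] c x(1)[OF p] by (simp add: a_minus_def)
    also have "\<dots> \<le> norm (X K0) + 1"
      using near[OF K0 order_refl p] norm_ev_le[OF p, of "X K0"] c x(1)[OF p] by (simp add: norm_minus)
    finally show "snd p (x p) \<le> norm (X K0) + 1" .
  qed
  have "X \<longlonglongrightarrow> family x"
  proof (rule LIMSEQ_I)
    fix r :: real assume r: "r > 0"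
    then obtain K where K: "\<forall>m\<ge>K. \<forall>n\<ge>K. norm (X m - X n) < r / 2" using C[of "r / 2"] by auto
    have "norm (X m - family x) < r" if "m \<ge> K" for m
    proof -
      have "norm (X m - family x) \<le> r / 2"
        using near[OF K that] r by (intro norm_product_le) (simp_all add: ev_minus ev_family[OF bf])
      then show ?thesis using r by simp
    qed
    then show "\<exists>K. \<forall>m\<ge>K. norm (X m - family x) < r" by blast
  qed
  then show "convergent X" by (rule convergentI)
qed

instantiation cstar_product :: (type, type) cstar_algebra begin

definition "1 = family (\<lambda>p. \<one>\<^bsub>fst p\<^esub>)"
definition "X * Y = family (\<lambda>p. ev p X \<otimes>\<^bsub>fst p\<^esub> ev p Y)"
definition "star X = family (\<lambda>p. adj (fst p) (ev p X))"
definition "imag = family (\<lambda>p. \<i> \<odot>\<^bsub>fst p\<^esub> \<one>\<^bsub>fst p\<^esub>)"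

lemma ev_one: assumes "is_cstar p" shows "ev p 1 = \<one>\<^bsub>fst p\<^esub>"
  unfolding one_cstar_product_def
  by (rule ev_family[OF _ assms], rule bounded_familyI[where B = 1])
    (simp_all add: cstar_norm.norm_one_le_1 ring.ring_simprules(6))

lemma ev_imag: assumes "is_cstar p" shows "ev p imag = \<i> \<odot>\<^bsub>fst p\<^esub> \<one>\<^bsub>fst p\<^esub>"
  unfolding imag_cstar_product_def
  by (rule ev_family[OF _ assms], rule bounded_familyI[where B = 1])
    (simp_all add: cstar_norm.norm_one_le_1 ring.ring_simprules(6) cstar_norm.norm_smult unital_star_algebra.smult_closed)

lemma ev_times: assumes "is_cstar p" shows "ev p (X * Y) = ev p X \<otimes>\<^bsub>fst p\<^esub> ev p Y"
  unfolding times_cstar_product_def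
proof (rule ev_family[OF _ assms], rule bounded_familyI)
  fix p :: "('a, 'b) normed_pair" assume p: "is_cstar p"
  then interpret cstar_norm "fst p" "snd p" .
  show "ev p X \<otimes>\<^bsub>fst p\<^esub> ev p Y \<in> carrier (fst p)" by (simp add: ev_closed p)
  have "snd p (ev p X \<otimes>\<^bsub>fst p\<^esub> ev p Y) \<le> snd p (ev p X) * snd p (ev p Y)"
    by (intro norm_mult ev_closed p)
  also have "\<dots> \<le> norm X * norm Y" by (intro mult_mono norm_ev_le p norm_nonneg ev_closed norm_ge_zero)
  finally show "snd p (ev p X \<otimes>\<^bsub>fst p\<^esub> ev p Y) \<le> norm X * norm Y" .
qed

lemma ev_star: assumes "is_cstar p" shows "ev p (star X) = adj (fst p) (ev p X)"
  unfolding star_cstar_product_def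
  by (rule ev_family[OF _ assms], rule bounded_familyI[where B = "norm X"],
     simp add: ev_closed unital_star_algebra.adj_closed,
     rule order_trans[OF cstar_norm.norm_adj_le], simp_all add: ev_closed norm_ev_le)

lemmas ev_simps = ev_zero ev_plus ev_uminus ev_minus ev_scaleR ev_one ev_imag ev_times ev_star

instance
proof
  fix X Y Z :: "('a, 'b) cstar_product" and r :: real
  show "X * Y * Z = X * (Y * Z)"
    by (rule cstar_product_eqI)
      (simp add: ev_simps ev_closed ring_rules)
  show "(X + Y) * Z = X * Z + Y * Z"
    by (rule cstar_product_eqI)
      (simp add: ev_simps ev_closed ring_rules)
  show "X * (Y + Z) = X * Y + X * Z"
    by (rule cstar_product_eqI)
      (simp add: ev_simps ev_closed ring_rules)
  show "r *\<^sub>R X * Y = r *\<^sub>R (X * Y)"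
    by (rule cstar_product_eqI)
      (simp add: ev_simps ev_closed unital_star_algebra.smult_mult_left ring_rules)
  show "X * r *\<^sub>R Y = r *\<^sub>R (X * Y)"
    by (rule cstar_product_eqI)
      (simp add: ev_simps ev_closed unital_star_algebra.smult_mult_right ring_rules)
  show "1 * X = X"
    by (rule cstar_product_eqI)
      (simp add: ev_simps ev_closed ring_rules)
  show "X * 1 = X"
    by (rule cstar_product_eqI)
      (simp add: ev_simps ev_closed ring_rules)
  show "star (X + Y) = star X + star Y"
    by (rule cstar_product_eqI)
      (simp add: ev_simps ev_closed unital_star_algebra.adj_add ring_rules)
  show "star (r *\<^sub>R X) = r *\<^sub>R star X"
    by (rule cstar_product_eqI)
      (simp add: ev_simps ev_closed unital_star_algebra.adj_smult ring_rules)
  show "star (X * Y) = star Y * star X"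
    by (rule cstar_product_eqI)
      (simp add: ev_simps ev_closed unital_star_algebra.adj_mult ring_rules)
  show "star (star X) = X"
    by (rule cstar_product_eqI)
      (simp add: ev_simps ev_closed unital_star_algebra.adj_adj ring_rules)
  show "imag * X = X * imag"
    by (rule cstar_product_eqI)
      (simp add: ev_simps ev_closed unital_star_algebra.smult_mult_left unital_star_algebra.smult_mult_right ring_rules)
  show "imag * imag = - (1 :: ('a, 'b) cstar_product)"
    by (rule cstar_product_eqI)
      (simp add: ev_simps unital_star_algebra.smult_mult_left unital_star_algebra.smult_mult_right unital_star_algebra.smult_closed unital_star_algebra.smult_assoc[symmetric] unital_star_algebra.smult_minus_one ring_rules)
  show "star imag = - (imag :: ('a, 'b) cstar_product)"
  proof (rule cstar_product_eqI)
    fix p :: "('a, 'b) normed_pair" assume p: "is_cstar p"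
    then interpret cstar_norm "fst p" "snd p" .
    have "(- \<i>) \<odot>\<^bsub>fst p\<^esub> \<one>\<^bsub>fst p\<^esub> = \<ominus>\<^bsub>fst p\<^esub> (\<i> \<odot>\<^bsub>fst p\<^esub> \<one>\<^bsub>fst p\<^esub>)"
      using smult_assoc[of "\<one>\<^bsub>fst p\<^esub>" "-1" \<i>] by (simp add: smult_minus_one smult_closed)
    then show "ev p (star imag) = ev p (- imag)" using p by (simp add: ev_simps adj_smult adj_one)
  qed
  show "norm (X * Y) \<le> norm X * norm Y"
  proof (rule norm_product_le)
    fix p :: "('a, 'b) normed_pair" assume p: "is_cstar p"
    then interpret cstar_norm "fst p" "snd p" .
    have "snd p (ev p (X * Y)) \<le> snd p (ev p X) * snd p (ev p Y)"
      using p by (simp add: ev_times norm_mult ev_closed)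
    also have "\<dots> \<le> norm X * norm Y" by (intro mult_mono norm_ev_le p norm_nonneg ev_closed norm_ge_zero)
    finally show "snd p (ev p (X * Y)) \<le> norm X * norm Y" .
  qed simp
  have sq: "snd p (ev p (star X * X)) = (snd p (ev p X))\<^sup>2" "snd p (ev p X) \<ge> 0" if p: "is_cstar p" for p
  proof -
    interpret cstar_norm "fst p" "snd p" using p .
    show "snd p (ev p (star X * X)) = (snd p (ev p X))\<^sup>2" "snd p (ev p X) \<ge> 0"
      using p by (simp_all add: ev_simps ev_closed norm_cstar norm_nonneg)
  qed
  show "norm (star X * X) = (norm X)\<^sup>2"
  proof (rule antisym)
    show "norm (star X * X) \<le> (norm X)\<^sup>2"
      by (rule norm_product_le) (auto simp: sq intro!: power_mono norm_ev_le)
    have "norm X \<le> sqrt (norm (star X * X))"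
    proof (rule norm_product_le)
      fix p :: "('a, 'b) normed_pair" assume p: "is_cstar p"
      have "(snd p (ev p X))\<^sup>2 \<le> norm (star X * X)" using sq[OF p] norm_ev_le[OF p, of "star X * X"] by simp
      then show "snd p (ev p X) \<le> sqrt (norm (star X * X))" by (rule real_le_rsqrt)
    qed simp
    then have "(norm X)\<^sup>2 \<le> (sqrt (norm (star X * X)))\<^sup>2" by (intro power_mono) auto
    then show "(norm X)\<^sup>2 \<le> norm (star X * X)" by simp
  qed
qed

end

section \<open>Matrix algebras over a C*-algebra\<close>

lemma ev_cplx_mult: assumes p: "is_cstar p" shows "ev p (cplx c * X) = c \<odot>\<^bsub>fst p\<^esub> ev p X"
proof -
  interpret cstar_norm "fst p" "snd p" by fact
  have c: "ev p X \<in> carrier (fst p)" by (rule ev_closed[OF p])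
  have "cplx c * X = Re c *\<^sub>R X + Im c *\<^sub>R (imag * X)"
    by (simp add: cplx_def distrib_right)
  then have "ev p (cplx c * X) = complex_of_real (Re c) \<odot>\<^bsub>fst p\<^esub> ev p X \<oplus>\<^bsub>fst p\<^esub>
     complex_of_real (Im c) \<odot>\<^bsub>fst p\<^esub> (\<i> \<odot>\<^bsub>fst p\<^esub> ev p X)"
    using c by (simp add: ev_simps[OF p] smult_mult_left)
  also have "\<dots> = (complex_of_real (Re c) + complex_of_real (Im c) * \<i>) \<odot>\<^bsub>fst p\<^esub> ev p X"
    using c by (simp add: smult_l_distr smult_assoc)
  also have "complex_of_real (Re c) + complex_of_real (Im c) * \<i> = c"
    using complex_eq[of c] by (simp add: mult.commute)
  finally show ?thesis .
qed

context cstar_norm begin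

lemma is_cstar_self: "is_cstar (A, N)"
  by (simp add: cstar_norm_axioms)

text \<open>The family with the single nonzero component \<open>x\<close>. This embedding of \<open>A\<close> is an isometric
*-homomorphism that maps the unit of \<open>A\<close> to a central projection.\<close>

definition lift :: "'a \<Rightarrow> ('a, 'b) cstar_product" where
  "lift x = family (\<lambda>q. if q = (A, N) then x else \<zero>\<^bsub>fst q\<^esub>)"

lemma ev_lift:
  assumes "x \<in> carrier A" "is_cstar q"
  shows "ev q (lift x) = (if q = (A, N) then x else \<zero>\<^bsub>fst q\<^esub>)"
  unfolding lift_def
  by (rule ev_family[OF _ assms(2)], rule bounded_familyI[where B = "N x"])
    (use assms in \<open>auto simp: is_cstar_zero norm_nonneg\<close>)

lemma ev_self_lift: "x \<in> carrier A \<Longrightarrow> ev (A, N) (lift x) = x"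
  using is_cstar_self by (simp add: ev_lift)

lemma lift_inject: "x \<in> carrier A \<Longrightarrow> y \<in> carrier A \<Longrightarrow> lift x = lift y \<Longrightarrow> x = y"
  by (metis ev_self_lift)

lemma lift_zero: "lift \<zero> = 0"
  by (rule cstar_product_eqI) (auto simp: ev_lift ev_zero)

lemma lift_eqI:
  assumes "x \<in> carrier A" "ev (A, N) X = x"
    "\<And>q. is_cstar q \<Longrightarrow> q \<noteq> (A, N) \<Longrightarrow> ev q X = \<zero>\<^bsub>fst q\<^esub>"
  shows "lift x = X"
  by (rule cstar_product_eqI) (use assms in \<open>simp add: ev_lift\<close>)

lemma lift_add: assumes "x \<in> carrier A" "y \<in> carrier A" shows "lift (x \<oplus> y) = lift x + lift y"
proof (rule lift_eqI)
  fix q :: "('a, 'b) normed_pair" assume q: "is_cstar q" "q \<noteq> (A, N)"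
  then interpret q: cstar_norm "fst q" "snd q" by simp
  show "ev q (lift x + lift y) = \<zero>\<^bsub>fst q\<^esub>" using q assms by (simp add: ev_simps ev_lift)
qed (use assms is_cstar_self in \<open>simp_all add: ev_simps ev_lift\<close>)

lemma lift_mult: assumes "x \<in> carrier A" "y \<in> carrier A" shows "lift (x \<otimes> y) = lift x * lift y"
proof (rule lift_eqI)
  fix q :: "('a, 'b) normed_pair" assume q: "is_cstar q" "q \<noteq> (A, N)"
  then interpret q: cstar_norm "fst q" "snd q" by simp
  show "ev q (lift x * lift y) = \<zero>\<^bsub>fst q\<^esub>" using q assms by (simp add: ev_simps ev_lift)
qed (use assms is_cstar_self in \<open>simp_all add: ev_simps ev_lift\<close>)

lemma lift_adj: assumes "x \<in> carrier A" shows "lift (adj A x) = star (lift x)"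
proof (rule lift_eqI)
  fix q :: "('a, 'b) normed_pair" assume q: "is_cstar q" "q \<noteq> (A, N)"
  then interpret q: cstar_norm "fst q" "snd q" by simp
  show "ev q (star (lift x)) = \<zero>\<^bsub>fst q\<^esub>" using q assms by (simp add: ev_simps ev_lift q.adj_zero)
qed (use assms is_cstar_self in \<open>simp_all add: ev_simps ev_lift adj_closed\<close>)

lemma lift_smult: assumes "x \<in> carrier A" shows "lift (c \<odot> x) = cplx c * lift x"
proof (rule lift_eqI)
  fix q :: "('a, 'b) normed_pair" assume q: "is_cstar q" "q \<noteq> (A, N)"
  then interpret q: cstar_norm "fst q" "snd q" by simp
  show "ev q (cplx c * lift x) = \<zero>\<^bsub>fst q\<^esub>" using q assms by (simp add: ev_cplx_mult ev_lift q.smult_zero_right)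
qed (use assms is_cstar_self in \<open>simp_all add: ev_cplx_mult ev_lift smult_closed\<close>)

lemma lift_finsum:
  assumes "\<And>k. k \<in> K \<Longrightarrow> f k \<in> carrier A" "finite K"
  shows "lift (\<Oplus>k\<in>K. f k) = (\<Sum>k\<in>K. lift (f k))"
  using assms(2,1) by (induction K rule: finite_induct) (auto simp: lift_zero lift_add finsum_closed)

lemma norm_lift: assumes "x \<in> carrier A" shows "norm (lift x) = N x"
proof (rule antisym)
  show "norm (lift x) \<le> N x"
    by (rule norm_product_le) (use assms in \<open>auto simp: norm_nonneg ev_lift is_cstar_zero\<close>)
  show "N x \<le> norm (lift x)"
    using norm_ev_le[OF is_cstar_self, of "lift x"] assms by (simp add: ev_self_lift)
qed

lemma lift_one_star: "star (lift \<one>) = lift \<one>"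
  by (simp add: lift_adj[symmetric] adj_one)

lemma lift_one_mult: "x \<in> carrier A \<Longrightarrow> lift \<one> * lift x = lift x" "x \<in> carrier A \<Longrightarrow> lift x * lift \<one> = lift x"
  by (simp_all add: lift_mult[symmetric])

lemma exists_complement_square:
  assumes x: "x \<in> carrier A" and r: "(N x)\<^sup>2 < r"
  shows "\<exists>s\<in>carrier A. adj A x \<otimes> x \<oplus> adj A s \<otimes> s = complex_of_real r \<odot> \<one>"
proof -
  have "(norm (lift x))\<^sup>2 < r" using assms by (simp add: norm_lift)
  then obtain S where S: "star (lift x) * lift x + star S * S = r *\<^sub>R 1" by (rule complement_square)
  have "ev (A, N) (star (lift x) * lift x + star S * S) = complex_of_real r \<odot> \<one>"
    unfolding S by (simp add: ev_simps[OF is_cstar_self])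
  then show ?thesis using x ev_closed[OF is_cstar_self, of S]
    by (intro bexI[of _ "ev (A, N) S"]) (simp_all add: ev_simps[OF is_cstar_self] ev_self_lift)
qed

text \<open>With \<open>e = lift \<one>\<close>, the identity lifts to one with \<open>r e\<close> on the right, and the missing \<open>r (1 - e)\<close> is positive.\<close>

lemma norm_le_of_complement_square:
  assumes x: "x \<in> carrier A" and s: "s \<in> carrier A" and r: "r \<ge> 0"
    and eq: "adj A x \<otimes> x \<oplus> adj A s \<otimes> s = complex_of_real r \<odot> \<one>"
  shows "(N x)\<^sup>2 \<le> r"
proof -
  define e where "e = lift \<one>"
  have e: "star e = e" "e * e = e" by (simp_all add: e_def lift_one_star lift_one_mult)
  have "lift (adj A x \<otimes> x \<oplus> adj A s \<otimes> s) = lift (complex_of_real r \<odot> \<one>)" by (simp add: eq)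
  then have 1: "star (lift x) * lift x + star (lift s) * lift s = r *\<^sub>R e"
    using x s by (simp add: lift_add lift_mult lift_adj adj_closed lift_smult cplx_of_real e_def)
  have "pos (star (1 - e) * (1 - e))" by (rule pos_star_mult_self)
  moreover have "star (1 - e) * (1 - e) = 1 - e" by (simp add: star_diff e algebra_simps)
  ultimately have "pos (star (lift s) * lift s + r *\<^sub>R (1 - e))"
    using r by (intro pos_add pos_scaleR pos_star_mult_self) simp_all
  moreover have "star (lift x) * lift x + (star (lift s) * lift s + r *\<^sub>R (1 - e)) = r *\<^sub>R 1"
    using 1 by (simp add: add.assoc[symmetric] scaleR_right_diff_distrib)
  ultimately have "(norm (lift x))\<^sup>2 \<le> r" using r by (intro norm_le_of_complement_pos)
  then show ?thesis using x by (simp add: norm_lift)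
qed

end

text \<open>Both norms are determined by the solvability of \<open>x\<^sup>*x + s\<^sup>*s = r\<close>, which does not refer to a norm.\<close>

lemma cstar_norm_unique:
  assumes "cstar_norm A N" "cstar_norm A M" "x \<in> carrier A"
  shows "N x = M x"
proof -
  have le: "N x \<le> M x" if N: "cstar_norm A N" and M: "cstar_norm A M" for N M
  proof -
    interpret N: cstar_norm A N by fact
    interpret M: cstar_norm A M by fact
    have "(N x)\<^sup>2 \<le> (M x)\<^sup>2"
    proof (rule dense_ge)
      fix r assume r: "(M x)\<^sup>2 < r"
      then have "r \<ge> 0" by (meson less_imp_le order_trans zero_le_power2)
      then show "(N x)\<^sup>2 \<le> r"
        using M.exists_complement_square[OF assms(3) r] N.norm_le_of_complement_square[OF assms(3)] by blast
    qed
    then show ?thesis using M.norm_nonneg[OF assms(3)] power2_le_imp_le by blast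
  qed
  show ?thesis using le[OF assms(1,2)] le[OF assms(2,1)] by simp
qed

context cstar_norm begin

abbreviation MA :: "nat \<Rightarrow> 'a mat star_algebra" where "MA n \<equiv> matrix_algebra n A"

definition lift_mat :: "'a mat \<Rightarrow> nat \<Rightarrow> nat \<Rightarrow> ('a, 'b) cstar_product" where
  "lift_mat X i j = lift (X $$ (i, j))"

lemma MA_carrier: "X \<in> carrier (MA n) \<longleftrightarrow> X \<in> carrier_mat n n \<and> (\<forall>i<n. \<forall>j<n. X $$ (i, j) \<in> carrier A)"
  by (simp add: matrix_algebra_def)

lemma MA_entry: "X \<in> carrier (MA n) \<Longrightarrow> i < n \<Longrightarrow> j < n \<Longrightarrow> X $$ (i, j) \<in> carrier A"
  by (simp add: MA_carrier)

lemma MA_eqI: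
  assumes "X \<in> carrier (MA n)" "Y \<in> carrier (MA n)" "\<And>i j. i < n \<Longrightarrow> j < n \<Longrightarrow> lift_mat X i j = lift_mat Y i j"
  shows "X = Y"
proof (rule eq_matI)
  show "dim_row X = dim_row Y" "dim_col X = dim_col Y" using assms(1,2) by (auto simp: MA_carrier)
  fix i j assume "i < dim_row Y" "j < dim_col Y"
  then have ij: "i < n" "j < n" using assms(2) by (auto simp: MA_carrier)
  show "X $$ (i, j) = Y $$ (i, j)"
    using assms(3)[OF ij] lift_inject MA_entry[OF assms(1) ij] MA_entry[OF assms(2) ij] by (simp add: lift_mat_def)
qed

lemma MA_add:
  assumes "X \<in> carrier (MA n)" "Y \<in> carrier (MA n)"
  shows "X \<oplus>\<^bsub>MA n\<^esub> Y \<in> carrier (MA n)"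
    and "\<And>i j. i < n \<Longrightarrow> j < n \<Longrightarrow> lift_mat (X \<oplus>\<^bsub>MA n\<^esub> Y) i j = lift_mat X i j + lift_mat Y i j"
  using assms by (auto simp: matrix_algebra_def lift_mat_def lift_add)

lemma MA_mult:
  assumes "X \<in> carrier (MA n)" "Y \<in> carrier (MA n)"
  shows "X \<otimes>\<^bsub>MA n\<^esub> Y \<in> carrier (MA n)"
    and "\<And>i j. i < n \<Longrightarrow> j < n \<Longrightarrow> lift_mat (X \<otimes>\<^bsub>MA n\<^esub> Y) i j = (\<Sum>k<n. lift_mat X i k * lift_mat Y k j)"
proof -
  have "(\<Oplus>\<^bsub>A\<^esub>k\<in>{..<n}. X $$ (i, k) \<otimes> Y $$ (k, j)) \<in> carrier A" if "i < n" "j < n" for i j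
    by (rule finsum_closed) (use assms that in \<open>auto simp: MA_carrier\<close>)
  then show "X \<otimes>\<^bsub>MA n\<^esub> Y \<in> carrier (MA n)"
    by (simp add: matrix_algebra_def)
  fix i j assume "i < n" "j < n"
  then show "lift_mat (X \<otimes>\<^bsub>MA n\<^esub> Y) i j = (\<Sum>k<n. lift_mat X i k * lift_mat Y k j)"
    using assms by (simp add: matrix_algebra_def lift_mat_def) (subst lift_finsum, auto simp: lift_mult intro!: sum.cong)
qed

lemma MA_zero: "\<zero>\<^bsub>MA n\<^esub> \<in> carrier (MA n)"
    "\<And>i j. i < n \<Longrightarrow> j < n \<Longrightarrow> lift_mat (\<zero>\<^bsub>MA n\<^esub>) i j = 0"
  by (auto simp: matrix_algebra_def lift_mat_def lift_zero)

lemma MA_one: "\<one>\<^bsub>MA n\<^esub> \<in> carrier (MA n)"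
    "\<And>i j. i < n \<Longrightarrow> j < n \<Longrightarrow> lift_mat (\<one>\<^bsub>MA n\<^esub>) i j = (if i = j then lift \<one> else 0)"
  by (auto simp: matrix_algebra_def lift_mat_def lift_zero)

lemma MA_smult:
  assumes "X \<in> carrier (MA n)"
  shows "c \<odot>\<^bsub>MA n\<^esub> X \<in> carrier (MA n)"
    and "\<And>i j. i < n \<Longrightarrow> j < n \<Longrightarrow> lift_mat (c \<odot>\<^bsub>MA n\<^esub> X) i j = cplx c * lift_mat X i j"
  using assms by (auto simp: matrix_algebra_def lift_mat_def lift_smult smult_closed)

lemma MA_adj:
  assumes "X \<in> carrier (MA n)"
  shows "adj (MA n) X \<in> carrier (MA n)"
    and "\<And>i j. i < n \<Longrightarrow> j < n \<Longrightarrow> lift_mat (adj (MA n) X) i j = star (lift_mat X j i)"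
  using assms by (auto simp: matrix_algebra_def lift_mat_def lift_adj adj_closed)

lemmas MA_closed = MA_add(1) MA_mult(1) MA_zero(1) MA_one(1) MA_smult(1) MA_adj(1)
lemmas MA_lift = MA_add(2) MA_mult(2) MA_zero(2) MA_one(2) MA_smult(2) MA_adj(2)

lemma lift_mat_one:
  assumes "X \<in> carrier (MA n)" "i < n" "j < n"
  shows "lift \<one> * lift_mat X i j = lift_mat X i j" "lift_mat X i j * lift \<one> = lift_mat X i j"
  using assms by (simp_all add: lift_mat_def lift_one_mult MA_entry)

lemma unital_star_algebra_matrix_algebra: "unital_star_algebra (MA n)"
proof -
  have ab: "abelian_group (MA n)"
  proof (rule abelian_groupI)
    fix X assume X: "X \<in> carrier (MA n)"
    have "cplx (- 1) * x + x = 0" for x :: "('a, 'b) cstar_product"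
      by (metis cplx_0 cplx_1 cplx_add distrib_right mult_1 add.left_inverse mult_zero_left)
    then have "((- 1) \<odot>\<^bsub>MA n\<^esub> X) \<oplus>\<^bsub>MA n\<^esub> X = \<zero>\<^bsub>MA n\<^esub>"
      using X by (intro MA_eqI[where n = n] MA_closed) (auto simp: MA_lift MA_closed)
    then show "\<exists>Y\<in>carrier (MA n). Y \<oplus>\<^bsub>MA n\<^esub> X = \<zero>\<^bsub>MA n\<^esub>" using X MA_closed by blast
  qed (auto intro!: MA_eqI[where n = n] simp: MA_lift MA_closed add_ac)
  have one: "(\<Sum>k<n. (if i = k then lift \<one> else 0) * lift_mat X k j) = lift_mat X i j"
    "(\<Sum>k<n. lift_mat X i k * (if k = j then lift \<one> else 0)) = lift_mat X i j"
    if "X \<in> carrier (MA n)" "i < n" "j < n" for X i j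
  proof -
    have "(\<Sum>k<n. (if i = k then lift \<one> else 0) * lift_mat X k j) = (\<Sum>k<n. if k = i then lift_mat X i j else 0)"
      using that by (intro sum.cong) (auto simp: lift_mat_one)
    then show "(\<Sum>k<n. (if i = k then lift \<one> else 0) * lift_mat X k j) = lift_mat X i j" using that by simp
    have "(\<Sum>k<n. lift_mat X i k * (if k = j then lift \<one> else 0)) = (\<Sum>k<n. if k = j then lift_mat X i j else 0)"
      using that by (intro sum.cong) (auto simp: lift_mat_one)
    then show "(\<Sum>k<n. lift_mat X i k * (if k = j then lift \<one> else 0)) = lift_mat X i j" using that by simp
  qed
  have mon: "monoid (MA n)"
  proof (rule monoidI)
    fix X Y Z assume XYZ: "X \<in> carrier (MA n)" "Y \<in> carrier (MA n)" "Z \<in> carrier (MA n)"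
    show "X \<otimes>\<^bsub>MA n\<^esub> Y \<otimes>\<^bsub>MA n\<^esub> Z = X \<otimes>\<^bsub>MA n\<^esub> (Y \<otimes>\<^bsub>MA n\<^esub> Z)"
    proof (rule MA_eqI[where n = n])
      fix i j assume ij: "i < n" "j < n"
      have "(\<Sum>k<n. (\<Sum>l<n. lift_mat X i l * lift_mat Y l k) * lift_mat Z k j) =
        (\<Sum>l<n. lift_mat X i l * (\<Sum>k<n. lift_mat Y l k * lift_mat Z k j))"
        unfolding sum_distrib_left sum_distrib_right mult.assoc by (rule sum.swap)
      then show "lift_mat (X \<otimes>\<^bsub>MA n\<^esub> Y \<otimes>\<^bsub>MA n\<^esub> Z) i j = lift_mat (X \<otimes>\<^bsub>MA n\<^esub> (Y \<otimes>\<^bsub>MA n\<^esub> Z)) i j"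
        using XYZ ij by (simp add: MA_lift MA_closed)
    qed (use XYZ in \<open>auto simp: MA_closed\<close>)
  qed (auto intro!: MA_eqI[where n = n] simp: MA_lift MA_closed one)
  have ring: "ring (MA n)"
  proof (rule ring.intro[OF ab mon], unfold_locales)
  qed (auto intro!: MA_eqI[where n = n] simp: MA_lift MA_closed distrib_left distrib_right sum.distrib)
  show ?thesis
  proof (rule unital_star_algebra.intro[OF ring], unfold_locales)
    fix X Y c assume XY: "X \<in> carrier (MA n)" "Y \<in> carrier (MA n)"
    show "(c \<odot>\<^bsub>MA n\<^esub> X) \<otimes>\<^bsub>MA n\<^esub> Y = c \<odot>\<^bsub>MA n\<^esub> (X \<otimes>\<^bsub>MA n\<^esub> Y)"
      using XY by (intro MA_eqI[where n = n] MA_closed) (auto simp: MA_lift MA_closed sum_distrib_left mult.assoc)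
    have cm: "x * (cplx c * y) = cplx c * (x * y)" for x y :: "('a, 'b) cstar_product"
      by (metis cplx_commute mult.assoc)
    show "X \<otimes>\<^bsub>MA n\<^esub> (c \<odot>\<^bsub>MA n\<^esub> Y) = c \<odot>\<^bsub>MA n\<^esub> (X \<otimes>\<^bsub>MA n\<^esub> Y)"
      using XY by (intro MA_eqI[where n = n] MA_closed) (auto simp: MA_lift MA_closed sum_distrib_left cm)
    show "adj (MA n) (c \<odot>\<^bsub>MA n\<^esub> X) = cnj c \<odot>\<^bsub>MA n\<^esub> adj (MA n) X"
      using XY by (intro MA_eqI[where n = n] MA_closed) (auto simp: MA_lift MA_closed star_mult star_cplx cplx_commute)
    show "adj (MA n) (X \<otimes>\<^bsub>MA n\<^esub> Y) = adj (MA n) Y \<otimes>\<^bsub>MA n\<^esub> adj (MA n) X"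
      using XY by (intro MA_eqI[where n = n] MA_closed) (auto simp: MA_lift MA_closed star_mult star_sum)
  qed (auto intro!: MA_eqI[where n = n] simp: MA_lift MA_closed distrib_left distrib_right cplx_add cplx_mult mult.assoc star_add)
qed

lemma lift_minus: assumes "x \<in> carrier A" "y \<in> carrier A" shows "lift (x \<ominus> y) = lift x - lift y"
proof -
  have "lift (\<ominus> y) + lift y = 0" using assms by (simp add: lift_add[symmetric] lift_zero l_neg)
  then have "lift (\<ominus> y) = - lift y" by (simp add: eq_neg_iff_add_eq_0)
  then show ?thesis using assms by (simp add: a_minus_def lift_add)
qed

lemma norm_lift_minus:
  "x \<in> carrier A \<Longrightarrow> y \<in> carrier A \<Longrightarrow> norm (lift x - lift y) = N (x \<ominus> y)"
  using norm_lift[of "x \<ominus> y"] by (simp add: lift_minus)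

lemma MA_minus:
  assumes "X \<in> carrier (MA n)" "Y \<in> carrier (MA n)"
  shows "X \<ominus>\<^bsub>MA n\<^esub> Y \<in> carrier (MA n)"
    and "\<And>i j. i < n \<Longrightarrow> j < n \<Longrightarrow> lift_mat (X \<ominus>\<^bsub>MA n\<^esub> Y) i j = lift_mat X i j - lift_mat Y i j"
proof -
  interpret M: unital_star_algebra "MA n" by (rule unital_star_algebra_matrix_algebra)
  show "X \<ominus>\<^bsub>MA n\<^esub> Y \<in> carrier (MA n)" using assms by simp
  fix i j assume ij: "i < n" "j < n"
  have "X = (X \<ominus>\<^bsub>MA n\<^esub> Y) \<oplus>\<^bsub>MA n\<^esub> Y"
    using assms by (simp add: a_minus_def M.a_assoc M.l_neg)
  then have "lift_mat X i j = lift_mat (X \<ominus>\<^bsub>MA n\<^esub> Y) i j + lift_mat Y i j"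
    using MA_add(2)[OF M.minus_closed[OF assms] assms(2) ij] by simp
  then show "lift_mat (X \<ominus>\<^bsub>MA n\<^esub> Y) i j = lift_mat X i j - lift_mat Y i j" by simp
qed

text \<open>The norm lies between the largest entry and the sum of the norms of the entries, so completeness is
entrywise.\<close>

lemma cstar_norm_matrix_algebra: "cstar_norm (MA n) (\<lambda>X. mnorm {..<n} (lift_mat X))"
proof (rule cstar_norm.intro[OF unital_star_algebra_matrix_algebra], unfold_locales)
  interpret M: unital_star_algebra "MA n" by (rule unital_star_algebra_matrix_algebra)
  let ?I = "{..<n}"
  let ?N = "\<lambda>X. mnorm ?I (lift_mat X)"
  fix X assume X: "X \<in> carrier (MA n)"
  show "0 \<le> ?N X" by (rule mnorm_nonneg) simp
  show "?N X = 0 \<longleftrightarrow> X = \<zero>\<^bsub>MA n\<^esub>"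
  proof
    assume n0: "?N X = 0"
    show "X = \<zero>\<^bsub>MA n\<^esub>"
    proof (rule MA_eqI[OF X MA_zero(1)])
      fix i j assume "i < n" "j < n"
      then show "lift_mat X i j = lift_mat \<zero>\<^bsub>MA n\<^esub> i j"
        using norm_entry_le_mnorm[of ?I i j "lift_mat X"] n0 by (simp add: MA_lift)
    qed
  next
    assume X0: "X = \<zero>\<^bsub>MA n\<^esub>"
    have "?N X \<le> (\<Sum>(a,b)\<in>?I \<times> ?I. norm (lift_mat X a b))" by (rule mnorm_le_entries) simp
    also have "\<dots> = 0" by (rule sum.neutral) (auto simp: X0 MA_lift)
    finally show "?N X = 0" using mnorm_nonneg[of ?I "lift_mat X"] by simp
  qed
  show "?N (c \<odot>\<^bsub>MA n\<^esub> X) = cmod c * ?N X" for c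
  proof -
    have "?N (c \<odot>\<^bsub>MA n\<^esub> X) = mnorm ?I (\<lambda>i j. cplx c * lift_mat X i j)"
      by (rule mnorm_cong) (simp add: MA_lift X)
    then show ?thesis by (simp add: mnorm_scale)
  qed
  show "?N (adj (MA n) X \<otimes>\<^bsub>MA n\<^esub> X) = (?N X)\<^sup>2"
  proof -
    have "?N (adj (MA n) X \<otimes>\<^bsub>MA n\<^esub> X) = mnorm ?I (\<lambda>i j. \<Sum>k\<in>?I. star (lift_mat X k i) * lift_mat X k j)"
      by (rule mnorm_cong) (simp add: MA_lift MA_closed X)
    then show ?thesis by (simp add: mnorm_cstar)
  qed
  fix Y assume Y: "Y \<in> carrier (MA n)"
  show "?N (X \<oplus>\<^bsub>MA n\<^esub> Y) \<le> ?N X + ?N Y"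
  proof -
    have "?N (X \<oplus>\<^bsub>MA n\<^esub> Y) = mnorm ?I (\<lambda>i j. lift_mat X i j + lift_mat Y i j)"
      by (rule mnorm_cong) (simp add: MA_lift X Y)
    then show ?thesis by (simp add: mnorm_triangle)
  qed
  show "?N (X \<otimes>\<^bsub>MA n\<^esub> Y) \<le> ?N X * ?N Y"
  proof -
    have "?N (X \<otimes>\<^bsub>MA n\<^esub> Y) = mnorm ?I (\<lambda>i j. \<Sum>k\<in>?I. lift_mat X i k * lift_mat Y k j)"
      by (rule mnorm_cong) (simp add: MA_lift X Y)
    then show ?thesis by (simp add: mnorm_mult)
  qed
next
  let ?I = "{..<n}"
  let ?N = "\<lambda>X. mnorm ?I (lift_mat X)"
  fix s assume s: "\<And>k. s k \<in> carrier (MA n)" and cauchy: "norm_Cauchy (MA n) ?N s"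
  have "\<exists>x\<in>carrier A. norm_converges A N (\<lambda>k. s k $$ (i, j)) x" if ij: "i < n" "j < n" for i j
  proof (rule complete)
    show "s k $$ (i, j) \<in> carrier A" for k using s ij by (rule MA_entry)
    show "norm_Cauchy A N (\<lambda>k. s k $$ (i, j))" unfolding norm_Cauchy_def
    proof (intro allI impI)
      fix e :: real assume "e > 0"
      then obtain K where K: "\<And>l k. l \<ge> K \<Longrightarrow> k \<ge> K \<Longrightarrow> ?N (s l \<ominus>\<^bsub>MA n\<^esub> s k) < e"
        using cauchy unfolding norm_Cauchy_def by blast
      have "N (s l $$ (i, j) \<ominus> s k $$ (i, j)) < e" if "l \<ge> K" "k \<ge> K" for l k
      proof -
        have "N (s l $$ (i, j) \<ominus> s k $$ (i, j)) = norm (lift_mat (s l \<ominus>\<^bsub>MA n\<^esub> s k) i j)"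
          using s ij by (simp add: MA_minus) (simp add: lift_mat_def norm_lift_minus MA_entry[OF s ij])
        also have "\<dots> \<le> ?N (s l \<ominus>\<^bsub>MA n\<^esub> s k)" using ij by (intro norm_entry_le_mnorm) auto
        also have "\<dots> < e" using K that by blast
        finally show ?thesis .
      qed
      then show "\<exists>K. \<forall>l\<ge>K. \<forall>k\<ge>K. N (s l $$ (i, j) \<ominus> s k $$ (i, j)) < e" by blast
    qed
  qed
  then obtain x where x: "\<And>i j. i < n \<Longrightarrow> j < n \<Longrightarrow> x i j \<in> carrier A"
    "\<And>i j. i < n \<Longrightarrow> j < n \<Longrightarrow> norm_converges A N (\<lambda>k. s k $$ (i, j)) (x i j)"
    by metis
  define X where "X = mat n n (\<lambda>(i, j). x i j)"
  have X: "X \<in> carrier (MA n)" using x by (simp add: MA_carrier X_def)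
  have lim: "(\<lambda>k. \<Sum>(i, j)\<in>?I \<times> ?I. N (s k $$ (i, j) \<ominus> x i j)) \<longlonglongrightarrow> (\<Sum>ij\<in>?I \<times> ?I. 0)"
    unfolding case_prod_beta
    by (rule tendsto_sum) (use x(2) in \<open>auto simp: norm_converges_def\<close>)
  have le: "?N (s k \<ominus>\<^bsub>MA n\<^esub> X) \<le> (\<Sum>(i, j)\<in>?I \<times> ?I. N (s k $$ (i, j) \<ominus> x i j))" for k
  proof -
    have "?N (s k \<ominus>\<^bsub>MA n\<^esub> X) \<le> (\<Sum>(i, j)\<in>?I \<times> ?I. norm (lift_mat (s k \<ominus>\<^bsub>MA n\<^esub> X) i j))"
      by (rule mnorm_le_entries) simp
    also have "\<dots> = (\<Sum>(i, j)\<in>?I \<times> ?I. N (s k $$ (i, j) \<ominus> x i j))"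
    proof -
      have "norm (lift_mat (s k \<ominus>\<^bsub>MA n\<^esub> X) i j) = N (s k $$ (i, j) \<ominus> x i j)" if ij: "i < n" "j < n" for i j
        using s X x(1) ij by (simp add: MA_minus) (simp add: lift_mat_def norm_lift_minus MA_entry[OF s] X_def)
      then show ?thesis by (intro sum.cong) auto
    qed
    finally show ?thesis .
  qed
  have "(\<lambda>k. ?N (s k \<ominus>\<^bsub>MA n\<^esub> X)) \<longlonglongrightarrow> 0"
  proof (rule tendsto_sandwich[OF _ _ tendsto_const])
    show "\<forall>\<^sub>F k in sequentially. 0 \<le> ?N (s k \<ominus>\<^bsub>MA n\<^esub> X)"
      by (intro always_eventually allI mnorm_nonneg) simp
    show "\<forall>\<^sub>F k in sequentially. ?N (s k \<ominus>\<^bsub>MA n\<^esub> X) \<le> (\<Sum>(i, j)\<in>?I \<times> ?I. N (s k $$ (i, j) \<ominus> x i j))"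
      by (intro always_eventually allI le)
  qed (use lim in simp)
  then show "\<exists>X\<in>carrier (MA n). norm_converges (MA n) ?N s X" using X unfolding norm_converges_def by blast
qed

lemma matrix_cstar_norm_eq_mnorm:
  assumes "X \<in> carrier (MA n)" shows "matrix_cstar_norm n A X = mnorm {..<n} (lift_mat X)"
  unfolding matrix_cstar_norm_def
proof (rule the_equality)
  show "\<exists>M. cstar_norm (MA n) M \<and> mnorm {..<n} (lift_mat X) = M X"
    using cstar_norm_matrix_algebra by blast
  show "r = mnorm {..<n} (lift_mat X)" if "\<exists>M. cstar_norm (MA n) M \<and> r = M X" for r
    using that cstar_norm_unique[OF _ cstar_norm_matrix_algebra assms] by blast
qed

end

section \<open>Quadratic forms and polynomial values\<close>

definition form_le :: "'i set \<Rightarrow> ('i \<Rightarrow> 'i \<Rightarrow> 'a::cstar_algebra) \<Rightarrow> ('i \<Rightarrow> 'i \<Rightarrow> 'a) \<Rightarrow> bool" where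
  "form_le J G H \<longleftrightarrow> gram J (\<lambda>p q. H p q - G p q)"

text \<open>The square \<open>|\<Sum>\<^sub>p r p x\<^sub>p|\<^sup>2\<close> as a quadratic form in the variables \<open>x\<^sub>p\<close>.\<close>

definition sq :: "('i \<Rightarrow> 'a::cstar_algebra) \<Rightarrow> 'i \<Rightarrow> 'i \<Rightarrow> 'a" where
  "sq r p q = star (r p) * r q"

lemma star_sq: "star (sq r p q) = sq r q p"
  by (simp add: sq_def star_mult)

lemma gram_sq: "gram J (sq r)"
  using gram_row[of J r] by (simp add: sq_def[abs_def])

lemma form_le_refl: "form_le J G G"
  using gram_zero by (simp add: form_le_def)

lemma form_le_trans [trans]: assumes "form_le J F G" "form_le J G H" shows "form_le J F H"
  using gram_add[OF assms[unfolded form_le_def]] by (simp add: form_le_def)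

lemma form_le_add:
  assumes "form_le J F G" "form_le J F' G'" shows "form_le J (\<lambda>p q. F p q + F' p q) (\<lambda>p q. G p q + G' p q)"
  using gram_add[OF assms[unfolded form_le_def]] by (simp add: form_le_def algebra_simps)

lemma form_le_scale:
  assumes "form_le J F G" "r \<ge> 0" shows "form_le J (\<lambda>p q. r *\<^sub>R F p q) (\<lambda>p q. r *\<^sub>R G p q)"
  using gram_scale[OF assms(1)[unfolded form_le_def] assms(2)] by (simp add: form_le_def scaleR_right_diff_distrib)

lemma form_le_scale_mono:
  assumes "gram J G" "r \<le> s" shows "form_le J (\<lambda>p q. r *\<^sub>R G p q) (\<lambda>p q. s *\<^sub>R G p q)"
  using gram_scale[OF assms(1), of "s - r"] assms(2) by (simp add: form_le_def scaleR_left_diff_distrib)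

lemma form_le_sum:
  "(\<And>k. k \<in> K \<Longrightarrow> form_le J (F k) (G k)) \<Longrightarrow> form_le J (\<lambda>p q. \<Sum>k\<in>K. F k p q) (\<lambda>p q. \<Sum>k\<in>K. G k p q)"
  unfolding form_le_def by (simp add: gram_sum flip: sum_subtractf)

lemma form_le_gram_add: "gram J H \<Longrightarrow> form_le J G (\<lambda>p q. G p q + H p q)"
  by (simp add: form_le_def)

lemma form_le_member:
  assumes "finite K" "k \<in> K" "\<And>k. k \<in> K \<Longrightarrow> gram J (G k)" shows "form_le J (G k) (\<lambda>p q. \<Sum>k\<in>K. G k p q)"
proof -
  have "form_le J (G k) (\<lambda>p q. G k p q + (\<Sum>k\<in>K - {k}. G k p q))"
    using assms(3) by (intro form_le_gram_add gram_sum) auto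
  then show ?thesis using assms by (simp add: sum.remove)
qed

text \<open>The difference is \<open>|c x - y|\<^sup>2 / c\<close>.\<close>

lemma form_le_sq_add:
  assumes "c > 0"
  shows "form_le J (sq (\<lambda>p. x p + y p)) (\<lambda>p q. (1 + c) *\<^sub>R sq x p q + (1 + 1 / c) *\<^sub>R sq y p q)"
  unfolding form_le_def
proof (rule gram_cong)
  show "gram J (\<lambda>p q. (1 / c) *\<^sub>R sq (\<lambda>p. c *\<^sub>R x p - y p) p q)"
    using assms by (intro gram_scale gram_sq) auto
  fix p q
  show "(1 / c) *\<^sub>R sq (\<lambda>p. c *\<^sub>R x p - y p) p q = (1 + c) *\<^sub>R sq x p q + (1 + 1 / c) *\<^sub>R sq y p q - sq (\<lambda>p. x p + y p) p q"
    using assms by (simp add: sq_def star_diff star_add star_scaleR algebra_simps)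
qed

lemma form_le_sq_sum:
  assumes "finite S"
  shows "form_le J (sq (\<lambda>p. \<Sum>t\<in>S. r t p)) (\<lambda>p q. real (card S) *\<^sub>R (\<Sum>t\<in>S. sq (r t) p q))"
  using assms
proof (induction S rule: finite_induct)
  case empty
  then show ?case using form_le_refl[of J "\<lambda>p q. 0"] by (simp add: sq_def[abs_def])
next
  case (insert t S)
  show ?case
  proof (cases "S = {}")
    case True
    then show ?thesis using form_le_refl by (simp add: sq_def[abs_def])
  next
    case False
    define n where "n = real (card S)"
    have n: "n > 0" using False insert by (simp add: n_def card_gt_0_iff)
    have "form_le J (sq (\<lambda>p. r t p + (\<Sum>t\<in>S. r t p))) (\<lambda>p q. (1 + n) *\<^sub>R sq (r t) p q + (1 + 1 / n) *\<^sub>R sq (\<lambda>p. \<Sum>t\<in>S. r t p) p q)"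
      by (rule form_le_sq_add[OF n])
    also have "form_le J \<dots> (\<lambda>p q. (1 + n) *\<^sub>R sq (r t) p q + (1 + 1 / n) *\<^sub>R (n *\<^sub>R (\<Sum>t\<in>S. sq (r t) p q)))"
      using insert.IH n unfolding n_def[symmetric] by (intro form_le_add form_le_scale form_le_refl) auto
    also have "(\<lambda>p q. (1 + n) *\<^sub>R sq (r t) p q + (1 + 1 / n) *\<^sub>R (n *\<^sub>R (\<Sum>t\<in>S. sq (r t) p q))) =
      (\<lambda>p q. (1 + n) *\<^sub>R (sq (r t) p q + (\<Sum>t\<in>S. sq (r t) p q)))"
    proof -
      have "(1 + 1 / n) * n = 1 + n" using n by (simp add: field_simps)
      then show ?thesis by (simp only: scaleR_scaleR scaleR_right_distrib)
    qed
    finally show ?thesis using insert.hyps by (simp add: n_def)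
  qed
qed

lemma sq_cplx_mult: "sq (\<lambda>p. cplx c * x p) p q = (cmod c)\<^sup>2 *\<^sub>R sq x p q"
  by (simp add: sq_def star_cplx_mult)

text \<open>The form that arises from \<open>H\<close> by the substitution \<open>x\<^sub>p = \<Sum>\<^sub>j V p j y\<^sub>j\<close>.\<close>

definition pull :: "('j \<Rightarrow> 'i \<Rightarrow> 'a::cstar_algebra) \<Rightarrow> 'j set \<Rightarrow> ('j \<Rightarrow> 'j \<Rightarrow> 'a) \<Rightarrow> 'i \<Rightarrow> 'i \<Rightarrow> 'a" where
  "pull V J H i j = (\<Sum>p\<in>J. \<Sum>q\<in>J. star (V p i) * H p q * V q j)"

lemma gram_pull: "gram J H \<Longrightarrow> gram I (pull V J H)"
  using gram_pullback[of J H I V] by (simp add: pull_def[abs_def])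

lemma pull_add: "pull V J (\<lambda>p q. G p q + H p q) i j = pull V J G i j + pull V J H i j"
  by (simp add: pull_def distrib_left distrib_right sum.distrib)

lemma pull_diff: "pull V J (\<lambda>p q. G p q - H p q) i j = pull V J G i j - pull V J H i j"
  by (simp add: pull_def left_diff_distrib right_diff_distrib sum_subtractf)

lemma pull_scaleR: "pull V J (\<lambda>p q. r *\<^sub>R G p q) i j = r *\<^sub>R pull V J G i j"
  by (simp add: pull_def scaleR_sum_right)

lemma pull_sum: "pull V J (\<lambda>p q. \<Sum>k\<in>K. G k p q) i j = (\<Sum>k\<in>K. pull V J (G k) i j)"
  unfolding pull_def sum_distrib_left sum_distrib_right by (rule sum_swap3)

lemma pull_sq: "pull V J (sq r) i j = sq (\<lambda>j. \<Sum>p\<in>J. r p * V p j) i j"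
  by (simp add: pull_def sq_def star_sum sum_product star_mult mult.assoc)

lemma cplx_minus: "cplx (- c) = - cplx c"
  by (simp add: cplx_def)

primrec adj_letter :: "letter \<Rightarrow> letter" where
  "adj_letter (Z i) = Zstar i"
| "adj_letter (Zstar i) = Z i"

lemma adj_letter_index [simp]: "letter_index (adj_letter l) = letter_index l"
  by (cases l) simp_all

text \<open>The empty word has the value \<open>e\<close>, which will be the unit of a corner.\<close>

definition word_value :: "'a::cstar_algebra \<Rightarrow> (letter \<Rightarrow> 'a) \<Rightarrow> letter list \<Rightarrow> 'a" where
  "word_value e u w = foldr (\<lambda>l x. u l * x) w e"

definition poly_value :: "'a::cstar_algebra \<Rightarrow> (letter \<Rightarrow> 'a) \<Rightarrow> star_poly \<Rightarrow> 'a" where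
  "poly_value e u p = (\<Sum>w\<in>Poly_Mapping.keys p. cplx (Poly_Mapping.lookup p w) * word_value e u w)"

abbreviation matrix_value :: "'a::cstar_algebra \<Rightarrow> (letter \<Rightarrow> 'a) \<Rightarrow> star_poly mat \<Rightarrow> nat \<Rightarrow> nat \<Rightarrow> 'a" where
  "matrix_value e u P \<equiv> \<lambda>i j. poly_value e u (P $$ (i, j))"

lemma word_value_Nil [simp]: "word_value e u [] = e"
  and word_value_Cons [simp]: "word_value e u (l # w) = u l * word_value e u w"
  by (simp_all add: word_value_def)

lemma poly_value_superset:
  assumes "finite S" "Poly_Mapping.keys p \<subseteq> S"
  shows "poly_value e u p = (\<Sum>w\<in>S. cplx (Poly_Mapping.lookup p w) * word_value e u w)"
  unfolding poly_value_def by (rule sum.mono_neutral_left) (use assms in \<open>auto simp: in_keys_iff\<close>)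

lemma poly_value_add: "poly_value e u (p + q) = poly_value e u p + poly_value e u q"
proof -
  let ?S = "Poly_Mapping.keys p \<union> Poly_Mapping.keys q"
  have "Poly_Mapping.keys (p + q) \<subseteq> ?S" by (rule Poly_Mapping.keys_add)
  then show ?thesis
    by (simp add: poly_value_superset[of ?S] Poly_Mapping.lookup_add cplx_add distrib_right sum.distrib)
qed

lemma poly_value_zero [simp]: "poly_value e u 0 = 0"
  by (simp add: poly_value_def)

lemma poly_value_sum: "poly_value e u (\<Sum>k\<in>K. f k) = (\<Sum>k\<in>K. poly_value e u (f k))"
  by (induction K rule: infinite_finite_induct) (simp_all add: poly_value_add)

lemma poly_value_single: "poly_value e u (Poly_Mapping.single w c) = cplx c * word_value e u w"
  by (simp add: poly_value_def)

text \<open>The letters are unitaries of the corner with unit \<open>e\<close>. This is the situation of the algebras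
inside their product.\<close>

definition unitary_letters :: "nat \<Rightarrow> 'a::cstar_algebra \<Rightarrow> (letter \<Rightarrow> 'a) \<Rightarrow> bool" where
  "unitary_letters d e u \<longleftrightarrow> star e = e \<and> e * e = e \<and>
     (\<forall>l. letter_index l < d \<longrightarrow> u l * e = u l \<and> e * u l = u l \<and> star (u l) * u l = e \<and> u (adj_letter l) = star (u l))"

definition words :: "nat \<Rightarrow> letter list set" where
  "words d = {w. \<forall>l\<in>set w. letter_index l < d}"

lemma star_polys_iff: "p \<in> star_polys d \<longleftrightarrow> Poly_Mapping.keys p \<subseteq> words d"
  by (auto simp: star_polys_def words_def)

lemma star_polys_1_single:
  "w \<in> words d \<Longrightarrow> length w \<le> 1 \<Longrightarrow> Poly_Mapping.single w c \<in> star_polys_1 d"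
  by (auto simp: star_polys_1_def star_polys_def words_def)

lemma star_polys_1_add: "p \<in> star_polys_1 d \<Longrightarrow> q \<in> star_polys_1 d \<Longrightarrow> p + q \<in> star_polys_1 d"
  using Poly_Mapping.keys_add[of p q] unfolding star_polys_1_def star_polys_def by blast

lemma star_polys_1_sum: "(\<And>k. k \<in> K \<Longrightarrow> f k \<in> star_polys_1 d) \<Longrightarrow> (\<Sum>k\<in>K. f k) \<in> star_polys_1 d"
proof (induction K rule: infinite_finite_induct)
  case (insert k K) then show ?case by (simp add: star_polys_1_add)
qed (auto simp: star_polys_1_def star_polys_def)

lemma word_value_unitary:
  assumes "unitary_letters d e u" "w \<in> words d"
  shows "e * word_value e u w = word_value e u w" "star (word_value e u w) * word_value e u w = e"
proof -
  have "e * word_value e u w = word_value e u w \<and> star (word_value e u w) * word_value e u w = e"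
    using assms(2)
  proof (induction w)
    case Nil then show ?case using assms(1) by (simp add: unitary_letters_def)
  next
    case (Cons l w)
    have l: "e * u l = u l" "star (u l) * u l = e" using assms(1) Cons.prems by (auto simp: unitary_letters_def words_def)
    have IH: "e * word_value e u w = word_value e u w" "star (word_value e u w) * word_value e u w = e"
      using Cons by (auto simp: words_def)
    have "star (u l * word_value e u w) * (u l * word_value e u w) = star (word_value e u w) * ((star (u l) * u l) * word_value e u w)"
      by (simp only: star_mult mult.assoc)
    also have "\<dots> = e" by (simp only: l IH)
    finally show ?case using l IH by (simp add: mult.assoc[symmetric])
  qed
  then show "e * word_value e u w = word_value e u w" "star (word_value e u w) * word_value e u w = e" by auto
qed

section \<open>Linearization\<close>

text \<open>The coefficients \<open>a\<close> describe the matrix polynomial \<open>\<Sum>\<^sub>w a\<^sub>w w\<close> over the index set \<open>I\<close>, with words in \<open>W\<close>.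
The variables of the linearized form are indexed by \<open>I \<times> W\<close>; the variable \<open>(i, w)\<close> is meant to take
the value \<open>w x\<^sub>i\<close>. Closure of \<open>W\<close> under suffixes makes these values computable one letter at a time.\<close>

locale pencil =
  fixes d :: nat and I :: "'i set" and W :: "letter list set" and a :: "letter list \<Rightarrow> 'i \<Rightarrow> 'i \<Rightarrow> complex"
  assumes finI: "finite I" and finW: "finite W" and Nil_W: "[] \<in> W" and W_words: "W \<subseteq> words d"
    and W_suffix: "\<And>l w. l # w \<in> W \<Longrightarrow> w \<in> W"
begin

definition "J = I \<times> W"
definition "T = {(l, w). l # w \<in> W}"

lemma finJ: "finite J" using finI finW by (simp add: J_def)

lemma J_components: "x \<in> J \<Longrightarrow> fst x \<in> I" "x \<in> J \<Longrightarrow> snd x \<in> W"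
  by (auto simp: J_def)

lemma finT: "finite T"
proof -
  have "T \<subseteq> (\<lambda>w. (hd w, tl w)) ` W" by (force simp: T_def)
  then show ?thesis using finW finite_surj by blast
qed

text \<open>The rows of the form: \<open>coord\<close> is the variable \<open>(i, w)\<close>, \<open>pen\<close> is the deviation of the variable \<open>(i, l w)\<close>
from \<open>l\<close> times the variable \<open>(i, w)\<close>, and \<open>outp\<close> is the output \<open>k\<close> of the matrix polynomial, linear in
the variables.\<close>

definition "coord e i w p = (if p = (i, w) then e else 0)"

definition "pen e u i l w p = coord e i (l # w) p - u l * coord e i w p"

definition "outp e k p = cplx (a (snd p) k (fst p)) * e"

definition poly_matrix :: "'a::cstar_algebra \<Rightarrow> (letter \<Rightarrow> 'a) \<Rightarrow> 'i \<Rightarrow> 'i \<Rightarrow> 'a" where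
  "poly_matrix e u i j = (\<Sum>w\<in>W. cplx (a w i j) * word_value e u w)"

definition "full e p p' = (\<Sum>(i, w)\<in>J. sq (coord e i w) p p')"

definition "start e p p' = (\<Sum>i\<in>I. sq (coord e i []) p p')"

definition "outs e p p' = (\<Sum>k\<in>I. sq (outp e k) p p')"

definition "pens e u p p' = (\<Sum>(i, l, w)\<in>I \<times> T. sq (pen e u i l w) p p')"

text \<open>The form \<open>L\<close> with bound \<open>r\<close> and penalty \<open>K\<close>. It is at most \<open>upper r K\<close>, because all its rows are bounded
by the sum \<open>full\<close> of the squares of the variables; \<open>pencil_value\<close> is the difference.\<close>

definition "form r K e u p p' = r *\<^sub>R start e p p' - outs e p p' + K *\<^sub>R pens e u p p'"

definition "upper r K = r * real (card I) + K * (real (card (I \<times> T)) * 4)"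

definition word_weight :: real where "word_weight = (\<Sum>w\<in>W. 2 ^ Suc (length w))"

text \<open>The factor by which the penalties control the error in the outputs, see \<open>rest_le\<close>. It depends only on
the coefficients.\<close>

definition gain :: real where
  "gain = real (card J) * ((\<Sum>k\<in>I. \<Sum>(j, w)\<in>J. (cmod (a w k j))\<^sup>2) * word_weight)"

definition "pencil_value r K e u p p' = upper r K *\<^sub>R full e p p' - form r K e u p p'"

lemma gain_nonneg: "gain \<ge> 0"
  unfolding gain_def word_weight_def by (intro mult_nonneg_nonneg sum_nonneg) (auto simp: case_prod_beta)

lemma upper_pos: "r > 0 \<Longrightarrow> K \<ge> 0 \<Longrightarrow> I \<noteq> {} \<Longrightarrow> upper r K > 0"
  using finI unfolding upper_def
  by (intro add_pos_nonneg mult_pos_pos mult_nonneg_nonneg) (auto simp: card_gt_0_iff)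

lemma gram_start: "gram J (start e)" and gram_outs: "gram J (outs e)" and gram_pens: "gram J (pens e u)" and gram_full: "gram J (full e)"
  unfolding start_def[abs_def] outs_def[abs_def] pens_def[abs_def] full_def[abs_def] case_prod_beta
  by (intro gram_sum gram_sq)+

lemma coord_le_full: assumes "i \<in> I" "w \<in> W" shows "form_le J (sq (coord e i w)) (full e)"
proof -
  have "form_le J (sq (coord e (fst (i, w)) (snd (i, w)))) (\<lambda>p q. \<Sum>x\<in>J. sq (coord e (fst x) (snd x)) p q)"
    by (rule form_le_member[OF finJ, where G = "\<lambda>x. sq (coord e (fst x) (snd x))"]) (use assms in \<open>simp_all add: J_def gram_sq\<close>)
  then show ?thesis by (simp add: full_def[abs_def] case_prod_beta)
qed

lemma pen_le_pens: assumes "i \<in> I" "l # w \<in> W" shows "form_le J (sq (pen e u i l w)) (pens e u)"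
proof -
  have "form_le J (sq (pen e u (fst (i, l, w)) (fst (snd (i, l, w))) (snd (snd (i, l, w)))))
      (\<lambda>p q. \<Sum>x\<in>I \<times> T. sq (pen e u (fst x) (fst (snd x)) (snd (snd x))) p q)"
    by (rule form_le_member[where G = "\<lambda>x. sq (pen e u (fst x) (fst (snd x)) (snd (snd x)))"])
      (use assms in \<open>simp_all add: T_def[symmetric] gram_sq finI finT\<close>, simp add: T_def)
  then show ?thesis by (simp add: pens_def[abs_def] case_prod_beta)
qed

text \<open>The difference between a variable and the value it is meant to take.\<close>

definition defect :: "'a::cstar_algebra \<Rightarrow> (letter \<Rightarrow> 'a) \<Rightarrow> 'i \<Rightarrow> letter list \<Rightarrow> 'i \<times> letter list \<Rightarrow> 'a" where
  "defect e u i w p = coord e i w p - word_value e u w * coord e i [] p"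

context
  fixes e :: "'a::cstar_algebra" and u :: "letter \<Rightarrow> 'a"
  assumes unitary: "unitary_letters d e u"
begin

lemma e: "star e = e" "e * e = e"
  using unitary by (auto simp: unitary_letters_def)

lemma letter: assumes "l # w \<in> W" shows "u l * e = u l" "e * u l = u l" "star (u l) * u l = e" "u (adj_letter l) = star (u l)" "letter_index l < d"
  using unitary assms W_words by (auto simp: unitary_letters_def words_def)

lemma word: assumes "w \<in> W" shows "e * word_value e u w = word_value e u w" "star (word_value e u w) * word_value e u w = e"
  using word_value_unitary[OF unitary] assms W_words by auto

lemma sq_letter:
  assumes "l # w \<in> W" "\<And>p. e * x p = x p" shows "sq (\<lambda>p. u l * x p) = sq x"
proof (intro ext)
  fix p p'
  have "sq (\<lambda>p. u l * x p) p p' = star (x p) * ((star (u l) * u l) * x p')" by (simp only: sq_def star_mult mult.assoc)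
  then show "sq (\<lambda>p. u l * x p) p p' = sq x p p'" by (simp add: letter[OF assms(1)] assms(2) sq_def)
qed

lemma e_coord: "e * coord e i w p = coord e i w p" by (simp add: coord_def e)

lemma e_defect: assumes "w \<in> W" shows "e * defect e u i w p = defect e u i w p"
  using word[OF assms] by (simp add: defect_def right_diff_distrib e_coord mult.assoc[symmetric])

text \<open>The defect of \<open>l w\<close> is the penalty row plus \<open>l\<close> times the defect of \<open>w\<close>, and multiplication by the
isometry \<open>l\<close> does not change squares. So the constants satisfy \<open>c\<^sub>l\<^sub>w = 2 + 2 c\<^sub>w\<close>.\<close>

lemma defect_le_pens:
  assumes "i \<in> I" "w \<in> W"
  shows "form_le J (sq (defect e u i w)) (\<lambda>p p'. (2 ^ Suc (length w) - 2) *\<^sub>R pens e u p p')"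
  using assms(2)
proof (induction w)
  case Nil
  have "defect e u i [] = (\<lambda>p. 0)" by (rule ext) (simp add: defect_def coord_def e)
  then show ?case using form_le_refl[of J "\<lambda>p q. 0"] by (simp add: sq_def[abs_def])
next
  case (Cons l w)
  have w: "w \<in> W" by (rule W_suffix[OF Cons.prems])
  have Yl: "defect e u i (l # w) = (\<lambda>p. pen e u i l w p + u l * defect e u i w p)"
    by (rule ext) (simp add: defect_def pen_def right_diff_distrib mult.assoc)
  have "form_le J (sq (defect e u i (l # w))) (\<lambda>p p'. (1 + 1) *\<^sub>R sq (pen e u i l w) p p' + (1 + 1 / 1) *\<^sub>R sq (\<lambda>p. u l * defect e u i w p) p p')"
    unfolding Yl by (rule form_le_sq_add) simp
  also have "sq (\<lambda>p. u l * defect e u i w p) = sq (defect e u i w)"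
    by (rule sq_letter[OF Cons.prems e_defect[OF w]])
  also have "form_le J (\<lambda>p p'. (1 + 1) *\<^sub>R sq (pen e u i l w) p p' + (1 + 1 / 1) *\<^sub>R sq (defect e u i w) p p')
    (\<lambda>p p'. (1 + 1) *\<^sub>R pens e u p p' + (1 + 1 / 1) *\<^sub>R ((2 ^ Suc (length w) - 2) *\<^sub>R pens e u p p'))"
    by (intro form_le_add form_le_scale Cons.IH[OF w] pen_le_pens assms(1) Cons.prems) auto
  also have "\<dots> = (\<lambda>p p'. (2 ^ Suc (length (l # w)) - 2) *\<^sub>R pens e u p p')"
  proof -
    have "2 * (2 ^ Suc (length w) - 2) + 2 = (2 ^ Suc (length (l # w)) - 2 :: real)" by simp
    then show ?thesis by (simp only: scaleR_scaleR scaleR_left_distrib[symmetric]) (simp add: algebra_simps)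
  qed
  finally show ?case .
qed

text \<open>An output is its intended value \<open>q x\<close>, called \<open>leading\<close>, plus the contribution \<open>rest\<close> of the defects.\<close>

definition leading :: "'i \<Rightarrow> 'i \<times> letter list \<Rightarrow> 'a" where
  "leading k p = (\<Sum>j\<in>I. poly_matrix e u k j * coord e j [] p)"

lemma outp_split:
  assumes "p \<in> J"
  shows "outp e k p = leading k p + (\<Sum>(j, w)\<in>J. cplx (a w k j) * defect e u j w p)"
proof -
  have "(\<Sum>(j, w)\<in>J. cplx (a w k j) * coord e j w p) = (\<Sum>x\<in>J. if x = p then outp e k p else 0)"
    by (intro sum.cong) (auto simp: coord_def outp_def)
  then have 1: "(\<Sum>(j, w)\<in>J. cplx (a w k j) * coord e j w p) = outp e k p" using assms finJ by simp
  have "leading k p = (\<Sum>(j, w)\<in>J. cplx (a w k j) * (word_value e u w * coord e j [] p))"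
    by (simp add: leading_def poly_matrix_def J_def sum.cartesian_product[symmetric] sum_distrib_right mult.assoc)
  then have "leading k p + (\<Sum>(j, w)\<in>J. cplx (a w k j) * defect e u j w p) = (\<Sum>(j, w)\<in>J. cplx (a w k j) * coord e j w p)"
    by (simp add: case_prod_beta defect_def right_diff_distrib sum_subtractf)
  then show ?thesis using 1 by simp
qed

lemma leading_le:
  assumes "mbound I r (poly_matrix e u)"
  shows "form_le J (\<lambda>p p'. \<Sum>k\<in>I. sq (leading k) p p') (\<lambda>p p'. r *\<^sub>R start e p p')"
  using gram_pull_diff[OF assms[unfolded mbound_def] finI, of J "\<lambda>j p. coord e j [] p"]
  by (simp add: form_le_def start_def sq_def leading_def)

lemma defect_le:
  assumes "(i, w) \<in> J"
  shows "form_le J (sq (defect e u i w)) (\<lambda>p p'. word_weight *\<^sub>R pens e u p p')"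
proof -
  have "2 ^ Suc (length w) \<le> word_weight" unfolding word_weight_def
    by (rule member_le_sum) (use assms finW in \<open>auto simp: J_def\<close>)
  then have "form_le J (\<lambda>p p'. (2 ^ Suc (length w) - 2) *\<^sub>R pens e u p p') (\<lambda>p p'. word_weight *\<^sub>R pens e u p p')"
    by (intro form_le_scale_mono gram_pens) simp
  moreover have "i \<in> I" "w \<in> W" using assms by (auto simp: J_def)
  ultimately show ?thesis using form_le_trans[OF defect_le_pens] by blast
qed

definition rest :: "'i \<Rightarrow> 'i \<times> letter list \<Rightarrow> 'a" where
  "rest k p = (\<Sum>x\<in>J. cplx (a (snd x) k (fst x)) * defect e u (fst x) (snd x) p)"

lemma rest_le: "form_le J (\<lambda>p p'. \<Sum>k\<in>I. sq (rest k) p p') (\<lambda>p p'. gain *\<^sub>R pens e u p p')"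
proof -
  have "form_le J (sq (rest k)) (\<lambda>p p'. real (card J) *\<^sub>R (\<Sum>x\<in>J. (cmod (a (snd x) k (fst x)))\<^sup>2 *\<^sub>R (word_weight *\<^sub>R pens e u p p')))"
    if "k \<in> I" for k
  proof -
    have "form_le J (sq (rest k)) (\<lambda>p p'. real (card J) *\<^sub>R (\<Sum>x\<in>J. sq (\<lambda>p. cplx (a (snd x) k (fst x)) * defect e u (fst x) (snd x) p) p p'))"
      unfolding rest_def[abs_def] by (rule form_le_sq_sum[OF finJ])
    also have "form_le J \<dots> (\<lambda>p p'. real (card J) *\<^sub>R (\<Sum>x\<in>J. (cmod (a (snd x) k (fst x)))\<^sup>2 *\<^sub>R (word_weight *\<^sub>R pens e u p p')))"
      unfolding sq_cplx_mult by (intro form_le_scale form_le_sum defect_le) auto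
    finally show ?thesis .
  qed
  then have "form_le J (\<lambda>p p'. \<Sum>k\<in>I. sq (rest k) p p')
    (\<lambda>p p'. \<Sum>k\<in>I. real (card J) *\<^sub>R (\<Sum>x\<in>J. (cmod (a (snd x) k (fst x)))\<^sup>2 *\<^sub>R (word_weight *\<^sub>R pens e u p p')))"
    by (rule form_le_sum)
  also have "\<dots> = (\<lambda>p p'. gain *\<^sub>R pens e u p p')"
  proof (intro ext)
    fix p p'
    have "(\<Sum>k\<in>I. real (card J) *\<^sub>R (\<Sum>x\<in>J. (cmod (a (snd x) k (fst x)))\<^sup>2 *\<^sub>R (word_weight *\<^sub>R pens e u p p'))) =
      real (card J) *\<^sub>R ((\<Sum>k\<in>I. \<Sum>x\<in>J. (cmod (a (snd x) k (fst x)))\<^sup>2) *\<^sub>R (word_weight *\<^sub>R pens e u p p'))"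
      by (simp only: scaleR_sum_left scaleR_sum_right)
    then show "(\<Sum>k\<in>I. real (card J) *\<^sub>R (\<Sum>x\<in>J. (cmod (a (snd x) k (fst x)))\<^sup>2 *\<^sub>R (word_weight *\<^sub>R pens e u p p'))) = gain *\<^sub>R pens e u p p'"
      by (simp add: gain_def case_prod_beta)
  qed
  finally show ?thesis .
qed

text \<open>Splitting the outputs costs a factor \<open>1 + \<eta>\<close> on the leading part, and \<open>\<eta> = r/r' - 1\<close> is chosen to turn
the given bound \<open>r'\<close> into \<open>r\<close>. The rest is absorbed by the penalty.\<close>

lemma gram_form:
  assumes "mbound I r' (poly_matrix e u)" "0 < r'" "r' < r"
  shows "gram J (form r ((1 + 1 / (r / r' - 1)) * gain) e u)"
proof -
  define \<eta> where "\<eta> = r / r' - 1"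
  have \<eta>: "\<eta> > 0" "(1 + \<eta>) * r' = r" using assms(2,3) by (auto simp: \<eta>_def)
  have "form_le J (\<lambda>p p'. \<Sum>k\<in>I. sq (\<lambda>p. leading k p + rest k p) p p')
      (\<lambda>p p'. \<Sum>k\<in>I. (1 + \<eta>) *\<^sub>R sq (leading k) p p' + (1 + 1 / \<eta>) *\<^sub>R sq (rest k) p p')"
    by (intro form_le_sum form_le_sq_add \<eta>)
  also have "\<dots> = (\<lambda>p p'. (1 + \<eta>) *\<^sub>R (\<Sum>k\<in>I. sq (leading k) p p') + (1 + 1 / \<eta>) *\<^sub>R (\<Sum>k\<in>I. sq (rest k) p p'))"
    by (simp only: sum.distrib scaleR_sum_right)
  also have "form_le J \<dots> (\<lambda>p p'. (1 + \<eta>) *\<^sub>R (r' *\<^sub>R start e p p') + (1 + 1 / \<eta>) *\<^sub>R (gain *\<^sub>R pens e u p p'))"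
    using \<eta>(1) by (intro form_le_add form_le_scale leading_le assms rest_le) auto
  finally show ?thesis unfolding form_le_def
  proof (rule gram_cong)
    fix p p' assume "p \<in> J" "p' \<in> J"
    then have "(\<Sum>k\<in>I. sq (\<lambda>p. leading k p + rest k p) p p') = outs e p p'"
      by (simp add: outs_def sq_def outp_split rest_def case_prod_beta)
    then show "(1 + \<eta>) *\<^sub>R (r' *\<^sub>R start e p p') + (1 + 1 / \<eta>) *\<^sub>R (gain *\<^sub>R pens e u p p') - (\<Sum>k\<in>I. sq (\<lambda>p. leading k p + rest k p) p p')
       = form r ((1 + 1 / (r / r' - 1)) * gain) e u p p'"
      by (simp only: form_def scaleR_scaleR \<eta>(2) \<eta>_def[symmetric]) (simp add: algebra_simps)
  qed
qed

lemma gram_pencil_value: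
  assumes "r \<ge> 0" "K \<ge> 0" shows "gram J (pencil_value r K e u)"
proof -
  have pen_le: "form_le J (sq (pen e u i l w)) (\<lambda>p p'. 4 *\<^sub>R full e p p')" if iw: "i \<in> I" "l # w \<in> W" for i l w
  proof -
    have "form_le J (sq (\<lambda>p. coord e i (l # w) p + - (u l * coord e i w p)))
       (\<lambda>p p'. (1 + 1) *\<^sub>R sq (coord e i (l # w)) p p' + (1 + 1 / 1) *\<^sub>R sq (\<lambda>p. - (u l * coord e i w p)) p p')"
      by (rule form_le_sq_add) simp
    also have "sq (\<lambda>p. - (u l * coord e i w p)) = sq (\<lambda>p. u l * coord e i w p)" by (intro ext) (simp add: sq_def)
    also have "\<dots> = sq (coord e i w)" by (rule sq_letter[OF iw(2) e_coord])
    also have "form_le J (\<lambda>p p'. (1 + 1) *\<^sub>R sq (coord e i (l # w)) p p' + (1 + 1 / 1) *\<^sub>R sq (coord e i w) p p')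
      (\<lambda>p p'. (1 + 1) *\<^sub>R full e p p' + (1 + 1 / 1) *\<^sub>R full e p p')"
      using iw W_suffix by (intro form_le_add form_le_scale coord_le_full) auto
    also have "\<dots> = (\<lambda>p p'. 4 *\<^sub>R full e p p')" by (simp only: scaleR_left_distrib[symmetric]) simp
    finally show ?thesis by (simp add: pen_def[abs_def])
  qed
  have outs0: "form_le J (\<lambda>p p'. - outs e p p') (\<lambda>p p'. 0)" using gram_outs by (simp add: form_le_def)
  have "form_le J (start e) (\<lambda>p p'. \<Sum>i\<in>I. full e p p')"
    unfolding start_def[abs_def] by (intro form_le_sum coord_le_full Nil_W)
  then have "form_le J (start e) (\<lambda>p p'. real (card I) *\<^sub>R full e p p')" by (simp add: sum_constant_scaleR)
  moreover have "form_le J (pens e u) (\<lambda>p p'. \<Sum>x\<in>I \<times> T. 4 *\<^sub>R full e p p')"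
    unfolding pens_def[abs_def] case_prod_beta by (intro form_le_sum pen_le) (auto simp: T_def)
  then have "form_le J (pens e u) (\<lambda>p p'. real (card (I \<times> T)) *\<^sub>R (4 *\<^sub>R full e p p'))" by (simp only: sum_constant_scaleR)
  ultimately have "form_le J (\<lambda>p p'. r *\<^sub>R start e p p' + - outs e p p' + K *\<^sub>R pens e u p p')
     (\<lambda>p p'. r *\<^sub>R (real (card I) *\<^sub>R full e p p') + 0 + K *\<^sub>R (real (card (I \<times> T)) *\<^sub>R (4 *\<^sub>R full e p p')))"
    using assms by (intro form_le_add form_le_scale outs0)
  then show ?thesis unfolding form_le_def
    by (rule gram_cong) (simp add: pencil_value_def form_def upper_def scaleR_left_distrib)
qed

lemma full_apply: "p \<in> J \<Longrightarrow> full e' p p' = (if p = p' then star e' * e' else 0)" for e' :: 'a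
proof -
  assume p: "p \<in> J"
  have "full e' p p' = (\<Sum>x\<in>J. if x = p then (if p = p' then star e' * e' else 0) else 0)"
    unfolding full_def by (intro sum.cong) (auto simp: sq_def coord_def)
  then show ?thesis using p finJ by simp
qed

lemma star_pencil_value: "star (pencil_value r K e u p p') = pencil_value r K e u p' p"
  by (simp add: pencil_value_def form_def full_def start_def outs_def pens_def star_diff star_add star_scaleR star_sum star_sq case_prod_beta)

lemma complement_square_e: "star (1 - e) * (1 - e) = 1 - e"
  by (simp add: star_diff e algebra_simps)

text \<open>The bound by a scalar refers to the unit of the whole algebra, the form to the corner of \<open>e\<close>; the
two units differ by \<open>1 - e\<close>.\<close>

lemma scalar_minus_pencil_value:
  assumes "p \<in> J" "p' \<in> J"
  shows "scalar \<rho> p p' - pencil_value r K e u p p' =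
    \<rho> *\<^sub>R full (1 - e) p p' + (\<rho> - upper r K) *\<^sub>R full e p p' + form r K e u p p'"
proof -
  have "full (1 - e) p p' = (if p = p' then 1 - e else 0)" "full e p p' = (if p = p' then e else 0)"
    by (simp_all only: full_apply[OF assms(1)] complement_square_e e)
  then show ?thesis by (simp add: pencil_value_def scalar_def algebra_simps)
qed

lemma mnorm_pencil_value_le:
  assumes "mbound I r' (poly_matrix e u)" "0 < r'" "r' < r" "I \<noteq> {}"
  defines "K \<equiv> (1 + 1 / (r / r' - 1)) * gain"
  shows "mnorm J (pencil_value r K e u) \<le> upper r K"
proof -
  have K: "K \<ge> 0" using gain_nonneg assms(2,3) by (simp add: K_def)
  have c: "upper r K > 0" using upper_pos assms K by simp
  have g: "gram J (pencil_value r K e u)" using assms K by (intro gram_pencil_value) auto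
  have "gram J (\<lambda>p p'. upper r K *\<^sub>R full (1 - e) p p' + 0 *\<^sub>R full e p p' + form r K e u p p')"
    using c gram_form[OF assms(1-3)] by (intro gram_add gram_scale gram_full) (auto simp: K_def)
  then have "gram J (\<lambda>p p'. scalar (upper r K) p p' - pencil_value r K e u p p')"
    by (rule gram_cong) (simp add: scalar_minus_pencil_value)
  with g c have "mbound J ((upper r K)\<^sup>2) (pencil_value r K e u)" by (intro mbound_of_gram_herm finJ)
  with c show ?thesis by (rule mnorm_le_of_mbound)
qed

text \<open>The substitution that gives every variable its intended value.\<close>

definition V :: "'i \<times> letter list \<Rightarrow> 'i \<Rightarrow> 'a" where
  "V p j = (if fst p = j then word_value e u (snd p) else 0)"

lemma e_V: "p \<in> J \<Longrightarrow> e * V p j = V p j"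
  using word(1) by (auto simp: V_def J_def)

lemma coord_V:
  assumes "i \<in> I" "w \<in> W" shows "(\<Sum>p\<in>J. coord e' i w p * V p j) = e' * V (i, w) j"
proof -
  have "(\<Sum>p\<in>J. coord e' i w p * V p j) = (\<Sum>p\<in>J. if p = (i, w) then e' * V (i, w) j else 0)"
    by (intro sum.cong) (auto simp: coord_def)
  then show ?thesis using assms finJ by (simp add: J_def)
qed

lemma pull_full_complement: "pull V J (full (1 - e)) i j = 0"
proof -
  have "pull V J (full (1 - e)) i j = (\<Sum>x\<in>J. sq (\<lambda>j. (1 - e) * V x j) i j)"
    unfolding full_def[abs_def] case_prod_beta pull_sum pull_sq
    by (intro sum.cong refl) (simp add: coord_V J_components)
  also have "\<dots> = 0" by (rule sum.neutral) (simp add: left_diff_distrib e_V sq_def)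
  finally show ?thesis .
qed

lemma sq_V: "(i', w) \<in> J \<Longrightarrow> sq (V (i', w)) i j = (if i = i' \<and> j = i' then e else 0)"
proof -
  assume "(i', w) \<in> J"
  then have "star (word_value e u w) * word_value e u w = e" by (intro word(2)) (simp add: J_def)
  then show ?thesis by (simp add: sq_def V_def)
qed

lemma pull_full: assumes "i \<in> I" shows "pull V J (full e) i j = (if i = j then real (card W) *\<^sub>R e else 0)"
proof -
  have "pull V J (full e) i j = (\<Sum>x\<in>J. sq (\<lambda>j. e * V x j) i j)"
    unfolding full_def[abs_def] case_prod_beta pull_sum pull_sq
    by (intro sum.cong refl) (simp add: coord_V J_components)
  also have "\<dots> = (\<Sum>x\<in>J. sq (V x) i j)" by (rule sum.cong) (simp_all add: e_V sq_def)
  also have "\<dots> = (\<Sum>i'\<in>I. \<Sum>w\<in>W. if i' = i then (if i = j then e else 0) else 0)"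
    unfolding J_def sum.cartesian_product by (rule sum.cong) (auto simp: sq_V J_def)
  also have "\<dots> = (\<Sum>i'\<in>I. if i' = i then real (card W) *\<^sub>R (if i = j then e else 0) else 0)"
    by (rule sum.cong) (simp_all add: sum_constant_scaleR)
  also have "\<dots> = (if i = j then real (card W) *\<^sub>R e else 0)" using assms finI by simp
  finally show ?thesis .
qed

lemma pull_start: assumes "i \<in> I" shows "pull V J (start e) i j = (if i = j then e else 0)"
proof -
  have "pull V J (start e) i j = (\<Sum>i'\<in>I. sq (\<lambda>j. e * V (i', []) j) i j)"
    unfolding start_def[abs_def] pull_sum pull_sq
    by (intro sum.cong refl) (simp add: coord_V[OF _ Nil_W])
  also have "\<dots> = (\<Sum>i'\<in>I. sq (V (i', [])) i j)" by (rule sum.cong) (simp_all add: e_V sq_def J_def Nil_W)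
  also have "\<dots> = (\<Sum>i'\<in>I. if i' = i then (if i = j then e else 0) else 0)"
    by (rule sum.cong) (auto simp: sq_V J_def Nil_W)
  finally show ?thesis using assms finI by simp
qed

lemma pull_pens: "pull V J (pens e u) i j = 0"
proof -
  have row: "(\<Sum>p\<in>J. pen e u i' l w p * V p j) = 0" if "i' \<in> I" "l # w \<in> W" for i' l w j
  proof -
    have w: "w \<in> W" using that W_suffix by blast
    have "(\<Sum>p\<in>J. pen e u i' l w p * V p j) = (\<Sum>p\<in>J. coord e i' (l # w) p * V p j) - u l * (\<Sum>p\<in>J. coord e i' w p * V p j)"
      by (simp add: pen_def left_diff_distrib sum_subtractf sum_distrib_left mult.assoc)
    also have "\<dots> = V (i', l # w) j - u l * V (i', w) j"
      using that w e_V[of "(i', w)"] e_V[of "(i', l # w)"] by (simp add: coord_V) (simp add: J_def)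
    finally show ?thesis by (simp add: V_def)
  qed
  show ?thesis unfolding pens_def[abs_def] case_prod_beta pull_sum pull_sq
    by (intro sum.neutral) (auto simp: row T_def sq_def)
qed

lemma pull_outs: assumes "i \<in> I" "j \<in> I" shows "pull V J (outs e) i j = (\<Sum>k\<in>I. star (poly_matrix e u k i) * poly_matrix e u k j)"
proof -
  have row: "(\<Sum>p\<in>J. outp e k p * V p j) = poly_matrix e u k j" if "j \<in> I" for k j
  proof -
    have "(\<Sum>p\<in>J. outp e k p * V p j) = (\<Sum>i\<in>I. \<Sum>w\<in>W. cplx (a w k i) * V (i, w) j)"
      unfolding J_def sum.cartesian_product
      by (rule sum.cong) (auto simp: outp_def mult.assoc e_V J_def)
    also have "\<dots> = (\<Sum>i\<in>I. if i = j then poly_matrix e u k j else 0)"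
      by (rule sum.cong) (auto simp: V_def poly_matrix_def)
    finally show ?thesis using that finI by simp
  qed
  show ?thesis using assms unfolding outs_def[abs_def] pull_sum pull_sq by (simp add: sq_def row)
qed

text \<open>A bound \<open>\<rho>\<close> for the norm says \<open>L \<ge> - (\<rho> - upper r K) full\<close>. Under the substitution \<open>V\<close> the form \<open>L\<close> becomes
\<open>r - q\<^sup>*q\<close> and \<open>full\<close> becomes the number of words, all on the corner of \<open>e\<close>.\<close>

lemma mbound_of_mnorm_pencil_value:
  assumes "mnorm J (pencil_value r K e u) < \<rho>" "\<rho> > upper r K" "\<rho> > 0" "r \<ge> 0"
  shows "mbound I ((\<rho> - upper r K) * real (card W) + r) (poly_matrix e u)"
proof -
  define s where "s = (\<rho> - upper r K) * real (card W) + r"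
  have s: "s \<ge> 0" using assms by (simp add: s_def)
  have "gram J (\<lambda>p p'. scalar \<rho> p p' - pencil_value r K e u p p')"
    using assms by (intro gram_of_mbound_herm finJ star_pencil_value mbound_of_mnorm_less)
  then have "gram J (\<lambda>p p'. \<rho> *\<^sub>R full (1 - e) p p' + (\<rho> - upper r K) *\<^sub>R full e p p' + form r K e u p p')"
    by (rule gram_cong) (simp add: scalar_minus_pencil_value)
  then have "gram I (pull V J (\<lambda>p p'. \<rho> *\<^sub>R full (1 - e) p p' + (\<rho> - upper r K) *\<^sub>R full e p p' + form r K e u p p'))"
    by (rule gram_pull)
  moreover have "gram I (\<lambda>i j. \<Sum>k\<in>I. star (scalar (sqrt s) k i * (1 - e)) * (scalar (sqrt s) k j * (1 - e)))"
    by (intro gram_sum gram_row)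
  ultimately have "gram I (\<lambda>i j. pull V J (\<lambda>p p'. \<rho> *\<^sub>R full (1 - e) p p' + (\<rho> - upper r K) *\<^sub>R full e p p' + form r K e u p p') i j
     + (\<Sum>k\<in>I. star (scalar (sqrt s) k i * (1 - e)) * (scalar (sqrt s) k j * (1 - e))))"
    by (rule gram_add)
  then show ?thesis unfolding mbound_def s_def[symmetric]
  proof (rule gram_cong)
    fix i j assume ij: "i \<in> I" "j \<in> I"
    have "(\<Sum>k\<in>I. star (scalar (sqrt s) k i * (1 - e)) * (scalar (sqrt s) k j * (1 - e))) =
       (\<Sum>k\<in>I. if k = i then (if i = j then s *\<^sub>R (1 - e) else 0) else 0)"
      using s by (intro sum.cong) (auto simp: scalar_def star_scaleR star_mult complement_square_e)
    also have "\<dots> = (if i = j then s *\<^sub>R (1 - e) else 0)" using ij finI by simp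
    finally have 1: "(\<Sum>k\<in>I. star (scalar (sqrt s) k i * (1 - e)) * (scalar (sqrt s) k j * (1 - e))) = (if i = j then s *\<^sub>R (1 - e) else 0)" .
    have "pull V J (\<lambda>p p'. \<rho> *\<^sub>R full (1 - e) p p' + (\<rho> - upper r K) *\<^sub>R full e p p' + form r K e u p p') i j =
      (if i = j then s *\<^sub>R e else 0) - (\<Sum>k\<in>I. star (poly_matrix e u k i) * poly_matrix e u k j)"
      using ij by (simp add: form_def pull_add pull_diff pull_scaleR pull_full_complement pull_full pull_start pull_pens pull_outs s_def scaleR_left_distrib)
    then show "pull V J (\<lambda>p p'. \<rho> *\<^sub>R full (1 - e) p p' + (\<rho> - upper r K) *\<^sub>R full e p p' + form r K e u p p') i j
     + (\<Sum>k\<in>I. star (scalar (sqrt s) k i * (1 - e)) * (scalar (sqrt s) k j * (1 - e))) =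
      scalar s i j - (\<Sum>k\<in>I. star (poly_matrix e u k i) * poly_matrix e u k j)"
      unfolding 1 by (simp add: scalar_def scaleR_right_diff_distrib)
  qed
qed

end

definition matrix_unit :: "'k \<Rightarrow> 'k \<Rightarrow> 'k \<Rightarrow> 'k \<Rightarrow> complex" where
  "matrix_unit x y p p' = (if p = x \<and> p' = y then 1 else 0)"

text \<open>The expansion of \<open>- K |x\<^sub>l\<^sub>w - l x\<^sub>w|\<^sup>2\<close>. The part \<open>|l x\<^sub>w|\<^sup>2\<close> is constant because \<open>l\<^sup>*l\<close> is the unit of the
corner, so the degree is one.\<close>

definition pen_poly :: "real \<Rightarrow> 'i \<Rightarrow> letter \<Rightarrow> letter list \<Rightarrow> 'i \<times> letter list \<Rightarrow> 'i \<times> letter list \<Rightarrow> star_poly" where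
  "pen_poly K i l w p p' =
     Poly_Mapping.single [] (- of_real K * (matrix_unit (i, l # w) (i, l # w) p p'))
   + Poly_Mapping.single [] (- of_real K * (matrix_unit (i, w) (i, w) p p'))
   + Poly_Mapping.single [l] (of_real K * (matrix_unit (i, l # w) (i, w) p p'))
   + Poly_Mapping.single [adj_letter l] (of_real K * (matrix_unit (i, w) (i, l # w) p p'))"

definition pencil_poly :: "real \<Rightarrow> real \<Rightarrow> 'i \<times> letter list \<Rightarrow> 'i \<times> letter list \<Rightarrow> star_poly" where
  "pencil_poly r K p p' =
     (\<Sum>x\<in>J. Poly_Mapping.single [] (of_real (upper r K) * (matrix_unit x x p p')))
   + (\<Sum>i\<in>I. Poly_Mapping.single [] (- of_real r * (matrix_unit (i, []) (i, []) p p')))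
   + (\<Sum>k\<in>I. Poly_Mapping.single [] (cnj (a (snd p) k (fst p)) * a (snd p') k (fst p')))
   + (\<Sum>(i, l, w)\<in>I \<times> T. pen_poly K i l w p p')"

lemma pencil_poly_linear: "pencil_poly r K p p' \<in> star_polys_1 d"
proof -
  have "letter_index l < d" if "l # w \<in> W" for l w using W_words that by (auto simp: words_def)
  then show ?thesis unfolding pencil_poly_def pen_poly_def
    by (intro star_polys_1_add star_polys_1_sum) (auto intro!: star_polys_1_add star_polys_1_single simp: words_def T_def)
qed

lemma cplx_of_real_mult: "cplx (of_real x * c) * y = x *\<^sub>R (cplx c * y)" "cplx (- of_real x * c) * y = - (x *\<^sub>R (cplx c * y))"
  by (simp_all add: cplx_mult cplx_of_real cplx_minus)

lemma poly_value_pen_poly: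
  assumes un: "unitary_letters d e u" and lw: "l # w \<in> W"
  shows "poly_value e u (pen_poly K i l w p p') = - (K *\<^sub>R sq (pen e u i l w) p p')"
proof -
  note e = e[OF un] and letter = letter[OF un lw]
  have u: "star (u l) * e = star (u l)" "e * star (u l) = star (u l)"
    using letter(1,2) by (metis star_mult e(1))+
  then have "sq (pen e u i l w) p p' = cplx (matrix_unit (i, l # w) (i, l # w) p p') * e
      + cplx (matrix_unit (i, w) (i, w) p p') * e
      - cplx (matrix_unit (i, l # w) (i, w) p p') * u l
      - cplx (matrix_unit (i, w) (i, l # w) p p') * star (u l)"
    using letter e by (simp add: sq_def pen_def coord_def matrix_unit_def star_diff star_mult algebra_simps)
  then show ?thesis
    unfolding pen_poly_def poly_value_add poly_value_single cplx_of_real_mult using letter u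
    by (simp add: scaleR_right_diff_distrib scaleR_right_distrib)
qed

lemma poly_value_pencil_poly:
  fixes e :: "'b::cstar_algebra"
  assumes un: "unitary_letters d e u"
  shows "poly_value e u (pencil_poly r K p p') = pencil_value r K e u p p'"
proof -
  note e = e[OF un]
  have coord: "sq (coord e i w) p p' = cplx (matrix_unit (i, w) (i, w) p p') * e" for i w
    by (auto simp: sq_def coord_def matrix_unit_def e)
  have outp: "sq (outp e k) p p' = cplx (cnj (a (snd p) k (fst p)) * a (snd p') k (fst p')) * e" for k
  proof -
    have "sq (outp e k) p p' = e * (cplx (cnj (a (snd p) k (fst p)) * a (snd p') k (fst p')) * e)"
      by (simp add: sq_def outp_def star_mult star_cplx cplx_mult e mult.assoc)
    also have "\<dots> = cplx (cnj (a (snd p) k (fst p)) * a (snd p') k (fst p')) * (e * e)"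
      by (metis cplx_commute mult.assoc)
    finally show ?thesis by (simp add: e)
  qed
  have pens: "(\<Sum>(i, l, w)\<in>I \<times> T. poly_value e u (pen_poly K i l w p p')) = - (K *\<^sub>R pens e u p p')"
    unfolding pens_def scaleR_sum_right sum_negf[symmetric]
    by (rule sum.cong) (auto simp: T_def poly_value_pen_poly[OF un])
  show ?thesis
    unfolding pencil_poly_def poly_value_add poly_value_sum case_prod_beta
    unfolding pens[unfolded case_prod_beta] poly_value_single cplx_of_real_mult
    by (simp add: pencil_value_def form_def full_def start_def outs_def coord outp case_prod_beta sum_negf scaleR_sum_right)
qed

text \<open>Scaling the excess over \<open>c\<close> by the number of words turns it into an excess of the square of the norm. The
matrix polynomial \<open>P\<close> of degree one and the constant \<open>c\<close> serve all unitary tuples in all algebras at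
the same time.\<close>

lemma linearization:
  assumes b: "0 < b'" "b' < b" and I: "I \<noteq> {}"
  obtains N P c where "N \<ge> (1::nat)" "P \<in> matrices_over N (star_polys_1 d)"
    "\<And>(e :: 'b::cstar_algebra) u. unitary_letters d e u \<Longrightarrow> mnorm I (poly_matrix e u) < b' \<Longrightarrow>
        mnorm {..<N} (matrix_value e u P) \<le> c"
    "\<And>(e :: 'b::cstar_algebra) u s. unitary_letters d e u \<Longrightarrow> b < s \<Longrightarrow>
        mnorm {..<N} (matrix_value e u P) < c + (s\<^sup>2 - b\<^sup>2) / real (card W) \<Longrightarrow> mnorm I (poly_matrix e u) \<le> s"
proof -
  have sq: "0 < b'\<^sup>2" "b'\<^sup>2 < b\<^sup>2" using b by (auto intro!: power_strict_mono)
  define K where "K = (1 + 1 / (b\<^sup>2 / b'\<^sup>2 - 1)) * gain"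
  define N where "N = card J"
  obtain f where f: "bij_betw f {..<N} J"
    using ex_bij_betw_nat_finite[OF finJ] by (auto simp: N_def atLeast0LessThan)
  define P where "P = mat N N (\<lambda>(x, y). pencil_poly (b\<^sup>2) K (f x) (f y))"
  have eq: "mnorm {..<N} (matrix_value e u P) = mnorm J (pencil_value (b\<^sup>2) K e u)"
    if un: "unitary_letters d e u" for e :: 'b and u
  proof -
    have "mnorm {..<N} (matrix_value e u P) = mnorm {..<N} (\<lambda>x y. pencil_value (b\<^sup>2) K e u (f x) (f y))"
      by (rule mnorm_cong) (simp add: P_def poly_value_pencil_poly[OF un])
    also have "\<dots> = mnorm (f ` {..<N}) (pencil_value (b\<^sup>2) K e u)"
      by (rule mnorm_reindex[symmetric]) (use f in \<open>simp add: bij_betw_def\<close>)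
    finally show ?thesis using f by (simp add: bij_betw_def)
  qed
  have K: "K \<ge> 0" using gain_nonneg sq by (simp add: K_def)
  have W0: "real (card W) > 0" using finW Nil_W by (auto simp: card_gt_0_iff)
  show ?thesis
  proof (rule that[of N P "upper (b\<^sup>2) K"])
    show "N \<ge> 1" using I Nil_W finJ by (auto simp: N_def J_def Suc_le_eq card_gt_0_iff)
    show "P \<in> matrices_over N (star_polys_1 d)" by (auto simp: matrices_over_def P_def pencil_poly_linear)
    fix e :: 'b and u assume un: "unitary_letters d e u"
    show "mnorm {..<N} (matrix_value e u P) \<le> upper (b\<^sup>2) K" if "mnorm I (poly_matrix e u) < b'"
      unfolding eq[OF un] K_def by (rule mnorm_pencil_value_le[OF un mbound_of_mnorm_less[OF that finI] sq I])
    fix s assume s: "b < s" and less: "mnorm {..<N} (matrix_value e u P) < upper (b\<^sup>2) K + (s\<^sup>2 - b\<^sup>2) / real (card W)"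
    have "b\<^sup>2 < s\<^sup>2" using s b by (intro power_strict_mono) auto
    then have \<rho>: "(s\<^sup>2 - b\<^sup>2) / real (card W) > 0" using W0 by simp
    have "mbound I ((upper (b\<^sup>2) K + (s\<^sup>2 - b\<^sup>2) / real (card W) - upper (b\<^sup>2) K) * real (card W) + b\<^sup>2) (poly_matrix e u)"
      using \<rho> upper_pos[OF sq(1)[THEN less_trans, OF sq(2)] K I] less unfolding eq[OF un]
      by (intro mbound_of_mnorm_pencil_value[OF un]) auto
    then have "mbound I (s\<^sup>2) (poly_matrix e u)" using W0 by simp
    then show "mnorm I (poly_matrix e u) \<le> s" using s b by (intro mnorm_le_of_mbound) auto
  qed
qed

end

section \<open>Convergence of norms\<close>

lemma mnorm_singleton: "mnorm {i} X = norm (X i i)"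
  using mnorm_le_entries[of "{i}" X] norm_entry_le_mnorm[of "{i}" i i X] by simp

lemma finite_short_words: "finite {w \<in> words d. length w \<le> m}"
proof -
  have "{l. letter_index l < d} \<subseteq> Z ` {..<d} \<union> Zstar ` {..<d}"
  proof
    fix l assume "l \<in> {l. letter_index l < d}"
    then show "l \<in> Z ` {..<d} \<union> Zstar ` {..<d}" by (cases l) auto
  qed
  then have "finite {l. letter_index l < d}" by (rule finite_subset) simp
  then have "finite {w. set w \<subseteq> {l. letter_index l < d} \<and> length w \<le> m}" by (rule finite_lists_length_le)
  then show ?thesis by (rule finite_subset[rotated]) (auto simp: words_def)
qed

text \<open>If \<open>\<parallel>q\<parallel> < b' < b\<close> at \<open>t0\<close>, the norm of the linearization is at most \<open>c\<close> there, hence at most slightly more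
nearby, which bounds \<open>\<parallel>q\<parallel>\<close> nearby by a given \<open>s > b\<close>. If \<open>\<parallel>q\<parallel> > s > b > b'\<close> at \<open>t0\<close>, the norm of the
linearization exceeds \<open>c\<close> there, hence nearby, which excludes \<open>\<parallel>q\<parallel> < b'\<close> nearby.\<close>

lemma mnorm_tendsto_of_linear:
  fixes E :: "'t \<Rightarrow> 'b::cstar_algebra" and U :: "'t \<Rightarrow> letter \<Rightarrow> 'b"
  assumes un: "\<And>t. unitary_letters d (E t) (U t)"
    and lin: "\<And>N P. N \<ge> 1 \<Longrightarrow> P \<in> matrices_over N (star_polys_1 d) \<Longrightarrow>
      ((\<lambda>t. mnorm {..<N} (matrix_value (E t) (U t) P)) \<longlongrightarrow>
        mnorm {..<N} (matrix_value (E t0) (U t0) P)) F"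
    and n: "n \<ge> 1" and P: "P \<in> matrices_over n (star_polys d)"
  shows "((\<lambda>t. mnorm {..<n} (matrix_value (E t) (U t) P)) \<longlongrightarrow>
        mnorm {..<n} (matrix_value (E t0) (U t0) P)) F"
proof -
  define S where "S = (\<Union>ij\<in>{..<n} \<times> {..<n}. Poly_Mapping.keys (P $$ ij))"
  define m where "m = (\<Sum>w\<in>S. length w)"
  \<comment> \<open>The total length of the occurring words bounds each of them; all shorter words are added to close under suffixes.\<close>
  define W where "W = {w \<in> words d. length w \<le> m}"
  define a where "a w i j = Poly_Mapping.lookup (P $$ (i, j)) w" for w i j
  have finS: "finite S" by (simp add: S_def)
  have S: "Poly_Mapping.keys (P $$ (i, j)) \<subseteq> W" if "i < n" "j < n" for i j
  proof
    fix w assume w: "w \<in> Poly_Mapping.keys (P $$ (i, j))"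
    have "P $$ (i, j) \<in> star_polys d" using P that by (auto simp: matrices_over_def)
    then have "w \<in> words d" using w by (auto simp: star_polys_iff)
    moreover have "w \<in> S" using w that by (auto simp: S_def)
    then have "length w \<le> m" unfolding m_def using finS by (intro member_le_sum) auto
    ultimately show "w \<in> W" by (simp add: W_def)
  qed
  interpret pencil d "{..<n}" W a
    by unfold_locales (auto simp: W_def finite_short_words, auto simp: words_def)
  define f where "f t = mnorm {..<n} (poly_matrix (E t) (U t))" for t
  have f: "mnorm {..<n} (matrix_value (E t) (U t) P) = f t" for t
    unfolding f_def by (rule mnorm_cong) (simp add: poly_matrix_def a_def poly_value_superset[OF finW S])
  have f0: "f t \<ge> 0" for t unfolding f_def by (rule mnorm_nonneg) simp
  have ne: "{..<n} \<noteq> {}" using n by (auto simp: lessThan_empty_iff)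
  have "real (card W) > 0" using finW Nil_W by (auto simp: card_gt_0_iff)
  then have W0: "(s\<^sup>2 - b\<^sup>2) / real (card W) > 0" if "0 < b" "b < s" for s b
    using that power_strict_mono[of b s 2] by simp
  have semicontinuous: "(f t0 < b' \<longrightarrow> (\<forall>\<^sub>F t in F. f t \<le> s)) \<and> (s < f t0 \<longrightarrow> (\<forall>\<^sub>F t in F. b' \<le> f t))"
    if b: "0 < b'" "b' < b" "b < s" for b' b s
  proof -
    obtain N Q c where Q: "N \<ge> 1" "Q \<in> matrices_over N (star_polys_1 d)"
      and small: "\<And>(e :: 'b) u. unitary_letters d e u \<Longrightarrow> mnorm {..<n} (poly_matrix e u) < b' \<Longrightarrow>
        mnorm {..<N} (matrix_value e u Q) \<le> c"
      and large: "\<And>(e :: 'b) u s. unitary_letters d e u \<Longrightarrow> b < s \<Longrightarrow>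
        mnorm {..<N} (matrix_value e u Q) < c + (s\<^sup>2 - b\<^sup>2) / real (card W) \<Longrightarrow> mnorm {..<n} (poly_matrix e u) \<le> s"
      by (rule linearization[OF b(1,2) ne, where 'b = 'b]) (rule that)
    define g where "g t = mnorm {..<N} (matrix_value (E t) (U t) Q)" for t
    have g: "(g \<longlongrightarrow> g t0) F" unfolding g_def by (rule lin[OF Q])
    have excess: "(s\<^sup>2 - b\<^sup>2) / real (card W) > 0" using b by (intro W0) auto
    have small': "g t \<le> c" if "f t < b'" for t
      using small[OF un, of t] that by (simp add: f_def g_def)
    have large': "f t \<le> s" if "g t < c + (s\<^sup>2 - b\<^sup>2) / real (card W)" for t
      using large[OF un b(3), of t] that by (simp add: f_def g_def)
    show ?thesis
    proof (intro conjI impI)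
      assume "f t0 < b'"
      then have "g t0 < c + (s\<^sup>2 - b\<^sup>2) / real (card W)" using small'[of t0] excess by linarith
      from order_tendstoD(2)[OF g this] show "\<forall>\<^sub>F t in F. f t \<le> s"
        by (rule eventually_mono) (rule large')
    next
      assume "s < f t0"
      then have "c < g t0" using large'[of t0] excess by linarith
      from order_tendstoD(1)[OF g this] show "\<forall>\<^sub>F t in F. b' \<le> f t"
        by (rule eventually_mono) (use small' in \<open>meson not_le\<close>)
    qed
  qed
  have "(f \<longlongrightarrow> f t0) F"
  proof (rule order_tendstoI)
    fix x assume "f t0 < x"
    then obtain s where s: "f t0 < s" "s < x" using dense by blast
    then obtain b where b: "f t0 < b" "b < s" using dense by blast
    then obtain b' where b': "f t0 < b'" "b' < b" using dense by blast
    then have "0 < b'" using f0[of t0] by linarith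
    then have "\<forall>\<^sub>F t in F. f t \<le> s" using semicontinuous[of b' b s] b b' by blast
    then show "\<forall>\<^sub>F t in F. f t < x" by (rule eventually_mono) (use s in simp)
  next
    fix x assume x: "x < f t0"
    show "\<forall>\<^sub>F t in F. x < f t"
    proof (cases "x < 0")
      case True
      then show ?thesis using f0 by (intro always_eventually allI) (meson less_le_trans)
    next
      case False
      obtain s where s: "x < s" "s < f t0" using x dense by blast
      then obtain b where b: "x < b" "b < s" using dense by blast
      then obtain b' where b': "x < b'" "b' < b" using dense by blast
      then have "0 < b'" using False by linarith
      then have "\<forall>\<^sub>F t in F. b' \<le> f t" using semicontinuous[of b' b s] s b b' by blast
      then show ?thesis by (rule eventually_mono) (use b' in simp)
    qed
  qed
  then show ?thesis by (simp add: f)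
qed

context cstar_norm begin

abbreviation lift_letter :: "(nat \<Rightarrow> 'a) \<Rightarrow> letter \<Rightarrow> ('a, 'b) cstar_product" where
  "lift_letter \<xi> \<equiv> \<lambda>l. lift (eval_letter A \<xi> l)"

lemma eval_letter_closed:
  assumes "\<And>i. i < d \<Longrightarrow> \<xi> i \<in> carrier A" "letter_index l < d" shows "eval_letter A \<xi> l \<in> carrier A"
  using assms by (cases l) (auto simp: adj_closed)

lemma lift_eval_word:
  assumes "\<And>i. i < d \<Longrightarrow> \<xi> i \<in> carrier A" "w \<in> words d"
  shows "eval_word A \<xi> w \<in> carrier A \<and> lift (eval_word A \<xi> w) = word_value (lift \<one>) (lift_letter \<xi>) w"
  using assms(2)
proof (induction w)
  case (Cons l w)
  have l: "eval_letter A \<xi> l \<in> carrier A" by (rule eval_letter_closed[OF assms(1)]) (use Cons.prems in \<open>auto simp: words_def\<close>)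
  have "w \<in> words d" using Cons.prems by (simp add: words_def)
  with Cons.IH l show ?case by (simp add: eval_word_def lift_mult)
qed (simp add: eval_word_def)

lemma lift_eval_poly:
  assumes "\<And>i. i < d \<Longrightarrow> \<xi> i \<in> carrier A" "p \<in> star_polys d"
  shows "eval_poly A \<xi> p \<in> carrier A" "lift (eval_poly A \<xi> p) = poly_value (lift \<one>) (lift_letter \<xi>) p"
proof -
  have w: "eval_word A \<xi> w \<in> carrier A" "lift (eval_word A \<xi> w) = word_value (lift \<one>) (lift_letter \<xi>) w"
    if "w \<in> Poly_Mapping.keys p" for w
    using lift_eval_word[OF assms(1)] assms(2) that by (auto simp: star_polys_iff)
  then show "eval_poly A \<xi> p \<in> carrier A" unfolding eval_poly_def by (intro finsum_closed) (auto simp: smult_closed)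
  show "lift (eval_poly A \<xi> p) = poly_value (lift \<one>) (lift_letter \<xi>) p"
    unfolding eval_poly_def poly_value_def using w by (subst lift_finsum) (auto simp: smult_closed lift_smult)
qed

lemma unitary_letters_lift:
  assumes "\<And>i. i < d \<Longrightarrow> is_unitary A (\<xi> i)"
  shows "unitary_letters d (lift \<one>) (lift_letter \<xi>)"
  unfolding unitary_letters_def
proof (intro conjI allI impI)
  fix l assume l: "letter_index l < d"
  then have u: "is_unitary A (\<xi> (letter_index l))" by (rule assms)
  then have c: "\<xi> (letter_index l) \<in> carrier A" by (simp add: is_unitary_def)
  then have cl: "eval_letter A \<xi> l \<in> carrier A" by (cases l) (auto simp: adj_closed)
  show "lift (eval_letter A \<xi> l) * lift \<one> = lift (eval_letter A \<xi> l)" "lift \<one> * lift (eval_letter A \<xi> l) = lift (eval_letter A \<xi> l)"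
    using cl by (simp_all add: lift_one_mult)
  have "adj A (eval_letter A \<xi> l) \<otimes> eval_letter A \<xi> l = \<one>"
    using u c by (cases l) (auto simp: is_unitary_def adj_adj)
  then show "star (lift (eval_letter A \<xi> l)) * lift (eval_letter A \<xi> l) = lift \<one>"
    using cl by (simp add: lift_adj[symmetric] lift_mult[symmetric] adj_closed)
  show "lift (eval_letter A \<xi> (adj_letter l)) = star (lift (eval_letter A \<xi> l))"
    using c by (cases l) (simp_all add: lift_adj adj_closed)
qed (simp_all add: lift_one_star lift_one_mult)

lemma matrix_cstar_norm_eval:
  assumes "\<And>i. i < d \<Longrightarrow> \<xi> i \<in> carrier A" "P \<in> matrices_over n (star_polys d)"
  shows "matrix_cstar_norm n A (eval_matrix_poly n A \<xi> P) =
    mnorm {..<n} (matrix_value (lift \<one>) (lift_letter \<xi>) P)"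
proof -
  have p: "P $$ (i, j) \<in> star_polys d" if "i < n" "j < n" for i j using assms(2) that by (auto simp: matrices_over_def)
  have "eval_matrix_poly n A \<xi> P \<in> carrier (MA n)"
    using lift_eval_poly(1)[OF assms(1) p] by (simp add: MA_carrier eval_matrix_poly_def)
  then have "matrix_cstar_norm n A (eval_matrix_poly n A \<xi> P) = mnorm {..<n} (lift_mat (eval_matrix_poly n A \<xi> P))"
    by (rule matrix_cstar_norm_eq_mnorm)
  also have "\<dots> = mnorm {..<n} (matrix_value (lift \<one>) (lift_letter \<xi>) P)"
    by (rule mnorm_cong) (simp add: lift_mat_def eval_matrix_poly_def lift_eval_poly(2)[OF assms(1) p])
  finally show ?thesis .
qed

end

text \<open>Scalar polynomials are the case of matrices of size one.\<close>

theorem theorem2p4: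
  fixes d :: nat
    and A :: "'t::metric_space \<Rightarrow> 'a normed_star_algebra"
    and \<xi> :: "'t \<Rightarrow> nat \<Rightarrow> 'a"
    and t\<^sub>0 :: 't
  assumes "d \<ge> 1"
    and "\<And>t. unital_cstar_algebra (A t)"
    and "\<And>t. generates_unital_cstar (A t) (\<xi> t ` {..<d})"
    and "\<And>t i. i < d \<Longrightarrow> is_unitary (A t) (\<xi> t i)"
    and "\<And>n P. n \<ge> 1 \<Longrightarrow> P \<in> matrices_over n (star_polys_1 d) \<Longrightarrow>
      ((\<lambda>t. matrix_cstar_norm n (A t) (eval_matrix_poly n (A t) (\<xi> t) P)) \<longlongrightarrow>
        matrix_cstar_norm n (A t\<^sub>0) (eval_matrix_poly n (A t\<^sub>0) (\<xi> t\<^sub>0) P)) (at t\<^sub>0)"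
  shows "(\<forall>p\<in>star_polys d.
      ((\<lambda>t. nrm (A t) (eval_poly (A t) (\<xi> t) p)) \<longlongrightarrow>
        nrm (A t\<^sub>0) (eval_poly (A t\<^sub>0) (\<xi> t\<^sub>0) p)) (at t\<^sub>0)) \<and>
    (\<forall>n\<ge>1. \<forall>P\<in>matrices_over n (star_polys d).
      ((\<lambda>t. matrix_cstar_norm n (A t) (eval_matrix_poly n (A t) (\<xi> t) P)) \<longlongrightarrow>
        matrix_cstar_norm n (A t\<^sub>0) (eval_matrix_poly n (A t\<^sub>0) (\<xi> t\<^sub>0) P)) (at t\<^sub>0))"
proof -
  have cn: "cstar_norm (A t) (nrm (A t))" for t
    using assms(2)[of t] by (simp add: unital_cstar_algebra_def)
  define E where "E t = cstar_norm.lift (A t) (nrm (A t)) \<one>\<^bsub>A t\<^esub>" for t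
  define U where "U t l = cstar_norm.lift (A t) (nrm (A t)) (eval_letter (A t) (\<xi> t) l)" for t l
  have \<xi>: "\<xi> t i \<in> carrier (A t)" if "i < d" for t i
    using assms(4)[OF that, of t] by (simp add: is_unitary_def)
  have un: "unitary_letters d (E t) (U t)" for t
    unfolding E_def U_def[abs_def] by (rule cstar_norm.unitary_letters_lift[OF cn assms(4)])
  have norm: "matrix_cstar_norm n (A t) (eval_matrix_poly n (A t) (\<xi> t) P) =
      mnorm {..<n} (matrix_value (E t) (U t) P)" if "P \<in> matrices_over n (star_polys d)" for n P t
    unfolding E_def U_def[abs_def] by (rule cstar_norm.matrix_cstar_norm_eval[OF cn \<xi> that])
  have sub: "matrices_over n (star_polys_1 d) \<subseteq> matrices_over n (star_polys d)" for n
    by (auto simp: matrices_over_def star_polys_1_def)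
  have main: "((\<lambda>t. mnorm {..<n} (matrix_value (E t) (U t) P)) \<longlongrightarrow>
        mnorm {..<n} (matrix_value (E t\<^sub>0) (U t\<^sub>0) P)) (at t\<^sub>0)"
    if "n \<ge> 1" "P \<in> matrices_over n (star_polys d)" for n P
  proof (rule mnorm_tendsto_of_linear[OF un _ that])
    fix N Q assume N: "N \<ge> (1::nat)" and Q: "Q \<in> matrices_over N (star_polys_1 d)"
    show "((\<lambda>t. mnorm {..<N} (matrix_value (E t) (U t) Q)) \<longlongrightarrow>
        mnorm {..<N} (matrix_value (E t\<^sub>0) (U t\<^sub>0) Q)) (at t\<^sub>0)"
      using assms(5)[OF N Q] Q sub[of N] by (simp add: norm subset_iff)
  qed
  have scalar: "nrm (A t) (eval_poly (A t) (\<xi> t) p) = mnorm {..<1} (\<lambda>i j. poly_value (E t) (U t) (mat 1 1 (\<lambda>_. p) $$ (i, j)))"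
    if "p \<in> star_polys d" for p t
  proof -
    have "{..<1} = {0::nat}" by auto
    then have "mnorm {..<1} (\<lambda>i j. poly_value (E t) (U t) (mat 1 1 (\<lambda>_. p) $$ (i, j))) = norm (poly_value (E t) (U t) p)"
      by (simp add: mnorm_singleton)
    also have "poly_value (E t) (U t) p = cstar_norm.lift (A t) (nrm (A t)) (eval_poly (A t) (\<xi> t) p)"
      unfolding E_def U_def[abs_def] by (rule cstar_norm.lift_eval_poly(2)[OF cn \<xi> that, symmetric])
    also have "norm \<dots> = nrm (A t) (eval_poly (A t) (\<xi> t) p)"
      by (rule cstar_norm.norm_lift[OF cn cstar_norm.lift_eval_poly(1)[OF cn \<xi> that]])
    finally show ?thesis by simp
  qed
  show ?thesis
  proof (intro conjI ballI allI impI)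
    fix p assume p: "p \<in> star_polys d"
    then have "mat 1 1 (\<lambda>_. p) \<in> matrices_over 1 (star_polys d)" by (auto simp: matrices_over_def)
    from main[OF _ this] show "((\<lambda>t. nrm (A t) (eval_poly (A t) (\<xi> t) p)) \<longlongrightarrow>
        nrm (A t\<^sub>0) (eval_poly (A t\<^sub>0) (\<xi> t\<^sub>0) p)) (at t\<^sub>0)"
      unfolding scalar[OF p] by simp
  next
    fix n P assume "n \<ge> (1::nat)" and P: "P \<in> matrices_over n (star_polys d)"
    then show "((\<lambda>t. matrix_cstar_norm n (A t) (eval_matrix_poly n (A t) (\<xi> t) P)) \<longlongrightarrow>
        matrix_cstar_norm n (A t\<^sub>0) (eval_matrix_poly n (A t\<^sub>0) (\<xi> t\<^sub>0) P)) (at t\<^sub>0)"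
      unfolding norm[OF P] by (rule main)
  qed
qed

end
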